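(* Let $k\ge 2$, let $\Sigma$ be a Borel probability measure on the set of $k\times k$ column-stochastic matrices, and for each $n\ge1$ let $X^{[n]}$ be the EFCP chain on $[k]^{[n]}$ with paintbox measure $\Sigma$. Assume that $\Sigma$ is absolutely continuous relative to Lebesgue measure on the space of $k\times k$ column-stochastic matrices, with density of class $L^p$ for some $p>1$. Then the chains $X^{[n]}$ exhibit the cutoff phenomenon: there exists a positive constant $\theta$ such that for all sufficiently small $\delta,\varepsilon>0$ the total variation mixing times satisfy $$(\theta-\delta)\log n\le t^{(n)}_{\mathrm{mix}}(1-\varepsilon)\le t^{(n)}_{\mathrm{mix}}(\varepsilon)\le(\theta+\delta)\log n$$ for all sufficiently large $n$.
   Context: Notation: $[k]=\{1,\dots,k\}$; elements of $[k]^{[n]}$ are written $x=x^1x^2\cdots x^n$. A $k\times k$ matrix $S$ is column-stochastic if its entries are nonnegative and each column sums to $1$; $S(a,b)$ denotes the entry in row $a$, column $b$. The set of such matrices is identified with $\Delta_k^k$ ($k$-tuples of columns), where $\Delta_k=\{s\in\mathbb R^k:s_i\ge0,\ \sum_i s_i=1\}$. Lebesgue measure on $\Delta_k$ is the translate of $(k-1)$-dimensional Lebesgue measure on $V=\{v\in\mathbb R^k:\sum_i v_i=0\}$ (unique up to a scalar), and Lebesgue measure on $\Delta_k^k$ is its $k$-fold product. The EFCP (exchangeable Feller cut-and-paste) chain on $[k]^{[n]}$ with paintbox measure $\Sigma$ is the time-homogeneous Markov chain with transition probabilities $P(x,y)=\int \prod_{i=1}^n S(y^i,x^i)\,\Sigma(dS)$.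 Under the stated hypothesis it has a unique stationary distribution $\pi^{(n)}$. With $\mathcal D(X_m)$ the law of the chain at time $m$, the mixing time is $t^{(n)}_{\mathrm{mix}}(\varepsilon)=\min\{m\ge 1:\max_{x_0}\|\mathcal D(X_m)-\pi^{(n)}\|_{TV}<\varepsilon\}$, where the maximum is over initial states $X_0=x_0\in[k]^{[n]}$ and $\|\mu-\nu\|_{TV}=\frac12\sum_x|\mu(x)-\nu(x)|$. *)

theory Defs
  imports "HOL-Probability.Probability"
begin

text \<open>
  The index set [k] is a finite type \<open>'k\<close>.  A matrix \<open>S :: real ^ 'k ^ 'k\<close> has the entry
  \<open>S $ a $ b\<close> in row \<open>a\<close> and column \<open>b\<close>.
\<close>

definition prob_simplex :: "(real ^ 'k::finite) set" where
  "prob_simplex = {s. (\<forall>i. 0 \<le> s $ i) \<and> (\<Sum>i\<in>UNIV. s $ i) = 1}"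

definition col_stochastic :: "(real ^ 'k::finite ^ 'k) set" where
  "col_stochastic = {S. (\<forall>a b. 0 \<le> S $ a $ b) \<and> (\<forall>b. (\<Sum>a\<in>UNIV. S $ a $ b) = 1)}"

definition sum_zero :: "(real ^ 'k::finite) set" where
  "sum_zero = {v. (\<Sum>i\<in>UNIV. v $ i) = 0}"

text \<open>
  Lebesgue measure of dimension k - 1 on \<open>sum_zero\<close> is transported from the coordinate space of
  dimension k - 1 by the linear isomorphism that omits one coordinate; only the scalar normalisation
  depends on the choice of isomorphism.
\<close>

definition omitted :: "'k::finite" where
  "omitted = (SOME i. True)"

definition sum_zero_of_coords :: "('k::finite \<Rightarrow> real) \<Rightarrow> real ^ 'k" where
  "sum_zero_of_coords w =
     (\<chi> i. if i = omitted then - (\<Sum>j\<in>- {omitted}. w j) else w i)"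

lemma sum_eq_omitted:
  fixes g :: "'k::finite \<Rightarrow> real"
  shows "(\<Sum>i\<in>UNIV. g i) = g omitted + (\<Sum>i\<in>- {omitted}. g i)"
proof -
  have "(\<Sum>i\<in>UNIV. g i) = g omitted + (\<Sum>i\<in>UNIV - {omitted}. g i)"
    by (rule sum.remove) auto
  then show ?thesis by (simp only: Compl_eq_Diff_UNIV)
qed

lemma range_sum_zero_of_coords: "range sum_zero_of_coords = (sum_zero :: (real ^ 'k::finite) set)"
proof (intro equalityI subsetI)
  fix v :: "real ^ 'k"
  assume "v \<in> range sum_zero_of_coords"
  then obtain w where v: "v = sum_zero_of_coords w" by auto
  have "(\<Sum>i\<in>- {omitted}. v $ i) = (\<Sum>i\<in>- {omitted}. w i)"
    unfolding v by (rule sum.cong) (simp_all add: sum_zero_of_coords_def)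
  moreover have "v $ omitted = - (\<Sum>i\<in>- {omitted}. w i)"
    by (simp add: v sum_zero_of_coords_def)
  ultimately show "v \<in> sum_zero"
    unfolding sum_zero_def sum_eq_omitted by simp
next
  fix v :: "real ^ 'k"
  assume "v \<in> sum_zero"
  then have "- (\<Sum>i\<in>- {omitted}. v $ i) = v $ omitted"
    unfolding sum_zero_def sum_eq_omitted by simp
  then have "v = sum_zero_of_coords (\<lambda>i. v $ i)"
    by (simp add: sum_zero_of_coords_def vec_eq_iff)
  then show "v \<in> range sum_zero_of_coords" by blast
qed

definition lebesgue_sum_zero :: "(real ^ 'k::finite) measure" where
  "lebesgue_sum_zero =
     distr (Pi\<^sub>M (- {omitted}) (\<lambda>_. lborel)) borel sum_zero_of_coords"

definition barycentre :: "real ^ 'k::finite" where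
  "barycentre = (\<chi> i. 1 / real CARD('k))"

text \<open>
  The translate of \<open>sum_zero\<close> through any point of the simplex contains the simplex; by translation
  invariance the choice of that point is immaterial.
\<close>

definition lebesgue_simplex :: "(real ^ 'k::finite) measure" where
  "lebesgue_simplex =
     restrict_space (distr lebesgue_sum_zero borel (\<lambda>v. barycentre + v)) prob_simplex"

definition matrix_of_columns :: "('k::finite \<Rightarrow> real ^ 'k) \<Rightarrow> real ^ 'k ^ 'k" where
  "matrix_of_columns c = (\<chi> a b. c b $ a)"

definition lebesgue_stochastic :: "(real ^ 'k::finite ^ 'k) measure" where
  "lebesgue_stochastic =
     distr (Pi\<^sub>M UNIV (\<lambda>_. lebesgue_simplex)) (restrict_space borel col_stochastic)
       matrix_of_columns"

lemma prob_simplex_borel [measurable]: "(prob_simplex :: (real ^ 'k::finite) set) \<in> sets borel"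
proof -
  have "closed (prob_simplex :: (real ^ 'k) set)"
    unfolding prob_simplex_def
    by (intro closed_Collect_conj closed_Collect_all closed_Collect_le closed_Collect_eq
        continuous_intros)
  then show ?thesis by (rule borel_closed)
qed

lemma measurable_sum_zero_of_coords [measurable]:
  "sum_zero_of_coords \<in> Pi\<^sub>M (- {omitted :: 'k::finite}) (\<lambda>_. lborel) \<rightarrow>\<^sub>M borel"
proof -
  have "(\<lambda>w. sum_zero_of_coords w $ i)
      \<in> borel_measurable (Pi\<^sub>M (- {omitted :: 'k}) (\<lambda>_. lborel))" for i
    by (cases "i = omitted") (simp_all add: sum_zero_of_coords_def)
  then show ?thesis
    by (auto simp: borel_measurable_euclidean_space[where 'c = "real ^ 'k"] Basis_vec_def
        inner_axis)
qed

lemma measurable_matrix_of_columns [measurable]: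
  "matrix_of_columns \<in> Pi\<^sub>M (UNIV :: 'k::finite set) (\<lambda>_. lebesgue_simplex)
     \<rightarrow>\<^sub>M restrict_space borel col_stochastic"
proof -
  have sets_simplex: "sets lebesgue_simplex = sets (restrict_space borel (prob_simplex :: (real ^ 'k) set))"
    unfolding lebesgue_simplex_def by (rule sets_restrict_space_cong) simp
  have col: "(\<lambda>c. c b) \<in> borel_measurable (Pi\<^sub>M (UNIV :: 'k set) (\<lambda>_. lebesgue_simplex :: (real ^ 'k) measure))"
    for b
  proof -
    have "(\<lambda>c. c b) \<in> Pi\<^sub>M (UNIV :: 'k set) (\<lambda>_. lebesgue_simplex) \<rightarrow>\<^sub>M (lebesgue_simplex :: (real ^ 'k) measure)"
      by (rule measurable_component_singleton) simp
    then show ?thesis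
      unfolding measurable_cong_sets[OF refl sets_simplex] by (rule measurable_restrict_space2_iff[THEN iffD1, THEN conjunct1])
  qed
  have "(\<lambda>c. matrix_of_columns c $ a $ b)
      \<in> borel_measurable (Pi\<^sub>M (UNIV :: 'k set) (\<lambda>_. lebesgue_simplex))" for a b
    using measurable_compose[OF col[of b] borel_measurable_nth, of a] by (simp add: matrix_of_columns_def)
  then have "matrix_of_columns \<in> borel_measurable (Pi\<^sub>M (UNIV :: 'k set) (\<lambda>_. lebesgue_simplex))"
    by (auto simp: borel_measurable_euclidean_space[where 'c = "real ^ 'k ^ 'k"] Basis_vec_def
        inner_axis)
  moreover have "matrix_of_columns \<in> space (Pi\<^sub>M (UNIV :: 'k set) (\<lambda>_. lebesgue_simplex)) \<rightarrow> col_stochastic"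
    by (auto simp: space_PiM lebesgue_simplex_def space_restrict_space matrix_of_columns_def
        col_stochastic_def prob_simplex_def PiE_iff)
  ultimately show ?thesis
    by (simp add: measurable_restrict_space2_iff Pi_iff)
qed

lemma lebesgue_sum_zero_translation:
  assumes "v \<in> sum_zero"
  shows "distr lebesgue_sum_zero borel (\<lambda>u. v + u) = (lebesgue_sum_zero :: (real ^ 'k::finite) measure)"
proof -
  let ?I = "- {omitted :: 'k}"
  let ?N = "Pi\<^sub>M ?I (\<lambda>_. lborel :: real measure)"
  let ?t = "\<lambda>w. \<lambda>i\<in>?I. v $ i + w i"
  interpret product_sigma_finite "\<lambda>_ :: 'k. lborel :: real measure" ..
  have t [measurable]: "?t \<in> ?N \<rightarrow>\<^sub>M ?N" by measurable
  have shift: "emeasure lborel ((\<lambda>x. c + x) -` B) = emeasure lborel B"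
    if "B \<in> sets borel" for c :: real and B
    using that by (subst (2) lborel_distr_plus[of c, symmetric]) (simp add: emeasure_distr)
  have "distr ?N ?N ?t = ?N"
  proof (rule PiM_eqI)
    fix A assume A: "\<And>i. i \<in> ?I \<Longrightarrow> A i \<in> sets (lborel :: real measure)"
    let ?B = "\<lambda>i. (\<lambda>x. v $ i + x) -` A i"
    have B: "?B i \<in> sets lborel" if "i \<in> ?I" for i
      using measurable_sets[of "\<lambda>x. v $ i + x" borel borel "A i"] A[OF that] by simp
    have "emeasure (distr ?N ?N ?t) (PiE ?I A) = emeasure ?N (?t -` PiE ?I A \<inter> space ?N)"
      using A by (intro emeasure_distr t sets_PiM_I_finite) auto
    also have "?t -` PiE ?I A \<inter> space ?N = PiE ?I ?B"
      by (auto simp: space_PiM PiE_def Pi_def extensional_def)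
    also have "emeasure ?N (PiE ?I ?B) = (\<Prod>i\<in>?I. emeasure lborel (?B i))"
      using B by (intro emeasure_PiM) auto
    also have "\<dots> = (\<Prod>i\<in>?I. emeasure lborel (A i))"
      using A by (intro prod.cong refl shift) simp
    finally show "emeasure (distr ?N ?N ?t) (PiE ?I A) = (\<Prod>i\<in>?I. emeasure lborel (A i))" .
  qed simp_all
  moreover have "v $ omitted = - (\<Sum>j\<in>?I. v $ j)"
    using assms unfolding sum_zero_def sum_eq_omitted by simp
  then have "v + sum_zero_of_coords w = sum_zero_of_coords (?t w)" for w
    by (simp add: sum_zero_of_coords_def vec_eq_iff sum.distrib)
  ultimately have "distr ?N borel (\<lambda>w. v + sum_zero_of_coords w) = distr (distr ?N ?N ?t) borel sum_zero_of_coords"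
    by (subst distr_distr) (auto simp: comp_def)
  then show ?thesis
    unfolding lebesgue_sum_zero_def \<open>distr ?N ?N ?t = ?N\<close>
    by (subst distr_distr) (auto simp: comp_def)
qed


definition states :: "nat \<Rightarrow> (nat \<Rightarrow> 'k::finite) set" where
  "states n = PiE {1..n} (\<lambda>_. UNIV)"

definition efcp_transition ::
  "(real ^ 'k::finite ^ 'k) measure \<Rightarrow> nat \<Rightarrow> (nat \<Rightarrow> 'k) \<Rightarrow> (nat \<Rightarrow> 'k) \<Rightarrow> real" where
  "efcp_transition \<Sigma> n x y = (\<integral>S. (\<Prod>i=1..n. S $ y i $ x i) \<partial>\<Sigma>)"

fun chain_law :: "'s set \<Rightarrow> ('s \<Rightarrow> 's \<Rightarrow> real) \<Rightarrow> 's \<Rightarrow> nat \<Rightarrow> 's \<Rightarrow> real" where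
  "chain_law A P x0 0 y = (if y = x0 then 1 else 0)"
| "chain_law A P x0 (Suc m) y = (\<Sum>z\<in>A. chain_law A P x0 m z * P z y)"

definition markov_chain_from ::
  "'w measure \<Rightarrow> 's set \<Rightarrow> ('s \<Rightarrow> 's \<Rightarrow> real) \<Rightarrow> 's \<Rightarrow> (nat \<Rightarrow> 'w \<Rightarrow> 's) \<Rightarrow> bool" where
  "markov_chain_from M A P x0 X \<longleftrightarrow>
     prob_space M \<and> (\<forall>m. X m \<in> M \<rightarrow>\<^sub>M count_space A) \<and>
     (\<forall>m p. (\<forall>j\<le>m. p j \<in> A) \<longrightarrow>
        measure M {\<omega> \<in> space M. \<forall>j\<le>m. X j \<omega> = p j} =
          (if p 0 = x0 then \<Prod>j<m. P (p j) (p (Suc j)) else 0))"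

text \<open>
  \<open>chain_law A P x0 m\<close> is the law at time \<open>m\<close> of every Markov chain on the finite set \<open>A\<close> with
  transition probabilities \<open>P\<close> and initial state \<open>x0\<close>.
\<close>

lemma markov_chain_law:
  assumes "markov_chain_from M A P x0 X" "finite A" "y \<in> A"
  shows "measure M {\<omega> \<in> space M. X m \<omega> = y} = chain_law A P x0 m y"
proof -
  have law: "measure M {\<omega> \<in> space M. \<forall>j\<le>n. X j \<omega> = q j} =
      (if q 0 = x0 then \<Prod>j<n. P (q j) (q (Suc j)) else 0)" if "\<forall>j\<le>n. q j \<in> A" for n q
    using assms(1) that unfolding markov_chain_from_def by blast
  show ?thesis
    using \<open>y \<in> A\<close>
  proof (induction m arbitrary: y)
    case 0
    then show ?case
      using law[of 0 "\<lambda>_. y"] by simp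
  next
    case (Suc m)
    interpret prob_space M using assms(1) by (simp add: markov_chain_from_def)
    have X [measurable]: "X j \<in> M \<rightarrow>\<^sub>M count_space A" for j
      using assms(1) by (simp add: markov_chain_from_def)
    have XA: "X j \<omega> \<in> A" if "\<omega> \<in> space M" for j \<omega>
      using measurable_space[OF X that] by simp
    define Q where "Q = PiE {..m} (\<lambda>_. A)"
    have "finite Q"
      unfolding Q_def using assms(2) by (intro finite_PiE) auto
    have X_eq: "{\<omega> \<in> space M. X j \<omega> = a} \<in> sets M" for j a
    proof -
      have "X j -` ({a} \<inter> A) \<inter> space M \<in> sets M"
        by (intro measurable_sets[OF X]) simp
      also have "X j -` ({a} \<inter> A) \<inter> space M = {\<omega> \<in> space M. X j \<omega> = a}"
        using XA by auto
      finally show ?thesis .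
    qed
    have path: "{\<omega> \<in> space M. \<forall>j\<le>m. X j \<omega> = p j} \<in> sets M" for p
      using sets.sets_Collect_finite_All'[of "{..m}" M "\<lambda>j \<omega>. X j \<omega> = p j"] X_eq
      by (simp add: Ball_def)
    have in_Q: "\<exists>!p. p \<in> Q \<and> (\<forall>j\<le>m. X j \<omega> = p j)" if "\<omega> \<in> space M" for \<omega>
    proof (rule ex1I)
      show "(\<lambda>j\<in>{..m}. X j \<omega>) \<in> Q \<and> (\<forall>j\<le>m. X j \<omega> = (\<lambda>j\<in>{..m}. X j \<omega>) j)"
        using XA[OF that] by (auto simp: Q_def)
      show "p = (\<lambda>j\<in>{..m}. X j \<omega>)" if "p \<in> Q \<and> (\<forall>j\<le>m. X j \<omega> = p j)" for p
        using that by (auto simp: Q_def PiE_def extensional_def fun_eq_iff)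
    qed
    let ?E = "\<lambda>p R. {\<omega> \<in> space M. (\<forall>j\<le>m. X j \<omega> = p j) \<and> R \<omega>}"
    have part: "measure M {\<omega> \<in> space M. R \<omega>} = (\<Sum>p\<in>Q. measure M (?E p R))"
      if R: "{\<omega> \<in> space M. R \<omega>} \<in> sets M" for R
      using in_Q path R
      by (intro prob_sum \<open>finite Q\<close> AE_I2 sets.sets_Collect_conj) blast+
    have step: "measure M (?E p (\<lambda>\<omega>. X (Suc m) \<omega> = y)) = measure M {\<omega> \<in> space M. \<forall>j\<le>m. X j \<omega> = p j} * P (p m) y"
      if "p \<in> Q" for p
    proof -
      let ?p = "p(Suc m := y)"
      have mem: "\<forall>j\<le>m. p j \<in> A" "\<forall>j\<le>Suc m. ?p j \<in> A"
        using that Suc.prems by (auto simp: Q_def le_Suc_eq)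
      have "?E p (\<lambda>\<omega>. X (Suc m) \<omega> = y) = {\<omega> \<in> space M. \<forall>j\<le>Suc m. X j \<omega> = ?p j}"
        by (auto simp: le_Suc_eq)
      then show ?thesis
        by (simp only: law[OF mem(1)] law[OF mem(2)]) simp
    qed
    have "measure M {\<omega> \<in> space M. X (Suc m) \<omega> = y} =
        (\<Sum>p\<in>Q. measure M {\<omega> \<in> space M. \<forall>j\<le>m. X j \<omega> = p j} * P (p m) y)"
      by (simp add: part[OF X_eq] step)
    also have "\<dots> = (\<Sum>z\<in>A. \<Sum>p | p \<in> Q \<and> p m = z. measure M {\<omega> \<in> space M. \<forall>j\<le>m. X j \<omega> = p j} * P (p m) y)"
      by (intro sum.group[symmetric] \<open>finite Q\<close> assms(2)) (auto simp: Q_def)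
    also have "\<dots> = (\<Sum>z\<in>A. measure M {\<omega> \<in> space M. X m \<omega> = z} * P z y)"
    proof (rule sum.cong[OF refl])
      fix z
      have "measure M {\<omega> \<in> space M. X m \<omega> = z} = (\<Sum>p\<in>Q. measure M (?E p (\<lambda>\<omega>. X m \<omega> = z)))"
        by (rule part[OF X_eq])
      also have "\<dots> = (\<Sum>p\<in>Q. if p m = z then measure M {\<omega> \<in> space M. \<forall>j\<le>m. X j \<omega> = p j} else 0)"
      proof (rule sum.cong[OF refl])
        fix p
        have "?E p (\<lambda>\<omega>. X m \<omega> = z) =
            (if p m = z then {\<omega> \<in> space M. \<forall>j\<le>m. X j \<omega> = p j} else {})"
          by auto
        then show "measure M (?E p (\<lambda>\<omega>. X m \<omega> = z)) =
            (if p m = z then measure M {\<omega> \<in> space M. \<forall>j\<le>m. X j \<omega> = p j} else 0)"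
          by simp
      qed
      also have "\<dots> = (\<Sum>p | p \<in> Q \<and> p m = z. measure M {\<omega> \<in> space M. \<forall>j\<le>m. X j \<omega> = p j})"
        using \<open>finite Q\<close> by (simp add: sum.If_cases Int_def)
      finally show "(\<Sum>p | p \<in> Q \<and> p m = z. measure M {\<omega> \<in> space M. \<forall>j\<le>m. X j \<omega> = p j} * P (p m) y) =
          measure M {\<omega> \<in> space M. X m \<omega> = z} * P z y"
        by (simp add: sum_distrib_right)
    qed
    also have "\<dots> = chain_law A P x0 (Suc m) y"
      by (simp add: Suc.IH)
    finally show ?case .
  qed
qed

definition is_stationary :: "'s set \<Rightarrow> ('s \<Rightarrow> 's \<Rightarrow> real) \<Rightarrow> ('s \<Rightarrow> real) \<Rightarrow> bool" where
  "is_stationary A P \<pi> \<longleftrightarrow>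
     (\<forall>x. 0 \<le> \<pi> x) \<and> (\<forall>x. x \<notin> A \<longrightarrow> \<pi> x = 0) \<and> (\<Sum>x\<in>A. \<pi> x) = 1 \<and>
     (\<forall>y\<in>A. (\<Sum>x\<in>A. \<pi> x * P x y) = \<pi> y)"

definition stationary :: "'s set \<Rightarrow> ('s \<Rightarrow> 's \<Rightarrow> real) \<Rightarrow> 's \<Rightarrow> real" where
  "stationary A P = (THE \<pi>. is_stationary A P \<pi>)"

definition tv_dist :: "'s set \<Rightarrow> ('s \<Rightarrow> real) \<Rightarrow> ('s \<Rightarrow> real) \<Rightarrow> real" where
  "tv_dist A \<mu> \<nu> = 1 / 2 * (\<Sum>x\<in>A. \<bar>\<mu> x - \<nu> x\<bar>)"

text \<open>
  As used below, \<open>A\<close> is finite and nonempty, so \<open>Max\<close> is an actual maximum.  \<open>LEAST\<close>, like \<open>THE\<close> in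
  \<open>stationary\<close>, is unspecified when there is no witness.
\<close>

definition mixing_time :: "'s set \<Rightarrow> ('s \<Rightarrow> 's \<Rightarrow> real) \<Rightarrow> real \<Rightarrow> nat" where
  "mixing_time A P \<epsilon> =
     (LEAST m. 1 \<le> m \<and>
        Max ((\<lambda>x0. tv_dist A (chain_law A P x0 m) (stationary A P)) ` A) < \<epsilon>)"

definition efcp_mixing_time :: "(real ^ 'k::finite ^ 'k) measure \<Rightarrow> nat \<Rightarrow> real \<Rightarrow> nat" where
  "efcp_mixing_time \<Sigma> n = mixing_time (states n) (efcp_transition \<Sigma> n)"

end

theory Submission
  imports Defs "HOL-Real_Asymp.Real_Asymp"
begin

text \<open>
  Given the independent random matrices \<open>S\<^sub>1, S\<^sub>2, \<dots>\<close> the coordinates of the chain at time \<open>m\<close>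
  are independent, and a coordinate with initial label \<open>a\<close> is distributed as the column \<open>a\<close> of
  \<open>Q = S\<^sub>m \<cdots> S\<^sub>1\<close>. From \<open>n\<close> coordinates two columns can be told apart if and only if
  their distance is much larger than \<open>n powr (-1/2)\<close>. The largest distance between two columns,
  Dobrushin's coefficient, is submultiplicative and behaves like \<open>exp (- \<lambda> * m)\<close> in probability,
  where \<open>0 < \<lambda> < \<infinity>\<close>, so that \<open>\<theta> = 1 / (2 * \<lambda>)\<close>.

  Finiteness of \<open>\<lambda>\<close> is where the density enters: by Young's inequality
  the integral of \<open>ln (norm (S *v u))\<close> is bounded below uniformly in the unit vector \<open>u\<close>. The upper
  tail of the coefficient is controlled by Chernoff's bound; since the mean of its logarithm is at least
  \<open>- \<lambda> * m\<close>, the lower tail is controlled by the upper one.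
\<close>

section \<open>Finite chains with positive transition probabilities\<close>

text \<open>The value \<open>1 / (2 * \<lambda>)\<close> comes from solving
  \<open>n * exp (- 2 * \<lambda> * m) = 1\<close>: for columns at distance \<open>d\<close>,
  \<open>n\<close> independent coordinates accumulate divergence of order \<open>n * d^2\<close>.
  The obstacle in the upper bound is that the divergence which is multiplicative over coordinates
  has column entries in its denominators. Every new factor multiplies on the left, so the entries of
  a product are averages of entries of its latest factor; a single exceptional event, of probability
  small uniformly in time, therefore takes care of all denominators. The number
  \<open>\<lambda>\<close> is a supremum of normalised means of \<open>- ln\<close> of the
  coefficient \<open>D\<close>, and both halves of this definition are used. Some block length
  almost attains it; the derivative of \<open>s \<mapsto> E (D powr s)\<close> at 0 turns this into
  exponential decay of a moment of small positive order. Conversely it bounds the mean at every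
  time, which leaves no room for atypically small coefficients. Only the law of the matrix product
  at one time at a time enters, so the product is encoded as a recursively defined measure and not
  as a process.\<close>

locale positive_chain =
  fixes A :: "'s set" and P :: "'s \<Rightarrow> 's \<Rightarrow> real"
  assumes finite_A: "finite A" and A_ne: "A \<noteq> {}"
    and P_pos: "\<And>x y. x \<in> A \<Longrightarrow> y \<in> A \<Longrightarrow> 0 < P x y"
    and P_sum: "\<And>x. x \<in> A \<Longrightarrow> (\<Sum>y\<in>A. P x y) = 1"
begin

lemma nonexpansive: "(\<Sum>y\<in>A. \<bar>\<Sum>x\<in>A. g x * P x y\<bar>) \<le> (\<Sum>x\<in>A. \<bar>g x\<bar>)"
proof -
  have "(\<Sum>y\<in>A. \<bar>\<Sum>x\<in>A. g x * P x y\<bar>) \<le> (\<Sum>y\<in>A. \<Sum>x\<in>A. \<bar>g x\<bar> * P x y)"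
    by (intro sum_mono order_trans[OF sum_abs]) (simp add: abs_mult P_pos less_imp_le)
  also have "\<dots> = (\<Sum>x\<in>A. \<bar>g x\<bar> * (\<Sum>y\<in>A. P x y))"
    by (subst sum.swap) (simp add: sum_distrib_left)
  finally show ?thesis by (simp add: P_sum)
qed

text \<open>Subtracting a common lower bound of the entries of \<open>P\<close> does not change the image of a vector
  of total mass zero (Doeblin).\<close>

lemma contraction:
  obtains \<rho> where "0 \<le> \<rho>" "\<rho> < 1"
    "\<And>g. (\<Sum>x\<in>A. g x) = 0 \<Longrightarrow>
      (\<Sum>y\<in>A. \<bar>\<Sum>x\<in>A. g x * P x y\<bar>) \<le> \<rho> * (\<Sum>x\<in>A. \<bar>g x\<bar>)"
proof
  define c where "c = Min ((\<lambda>(x, y). P x y) ` (A \<times> A))"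
  have fin: "finite ((\<lambda>(x, y). P x y) ` (A \<times> A))" using finite_A by simp
  have c_le: "c \<le> P x y" if "x \<in> A" "y \<in> A" for x y
    unfolding c_def using that by (intro Min_le fin) force
  have "c \<in> (\<lambda>(x, y). P x y) ` (A \<times> A)"
    unfolding c_def using A_ne by (intro Min_in fin) auto
  then have c_pos: "0 < c" using P_pos by auto
  \<comment> \<open>The entries \<open>P x y - c\<close> are nonnegative and every row of them sums
    to this number.\<close>
  let ?\<rho> = "1 - real (card A) * c"
  obtain x where x: "x \<in> A" using A_ne by blast
  have "real (card A) * c = (\<Sum>y\<in>A. c)" by simp
  also have "\<dots> \<le> (\<Sum>y\<in>A. P x y)" by (intro sum_mono c_le x)
  finally show "0 \<le> ?\<rho>" using P_sum[OF x] by simp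
  show "?\<rho> < 1" using c_pos A_ne finite_A by (simp add: card_gt_0_iff)
  show "(\<Sum>y\<in>A. \<bar>\<Sum>x\<in>A. g x * P x y\<bar>) \<le> ?\<rho> * (\<Sum>x\<in>A. \<bar>g x\<bar>)"
    if "(\<Sum>x\<in>A. g x) = 0" for g
  proof -
    have "(\<Sum>x\<in>A. g x * P x y) = (\<Sum>x\<in>A. g x * (P x y - c))" for y
      using that by (simp add: right_diff_distrib sum_subtractf flip: sum_distrib_right)
    then have "(\<Sum>y\<in>A. \<bar>\<Sum>x\<in>A. g x * P x y\<bar>) = (\<Sum>y\<in>A. \<bar>\<Sum>x\<in>A. g x * (P x y - c)\<bar>)"
      by simp
    also have "\<dots> \<le> (\<Sum>y\<in>A. \<Sum>x\<in>A. \<bar>g x\<bar> * (P x y - c))"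
      by (intro sum_mono order_trans[OF sum_abs]) (simp add: abs_mult c_le)
    also have "\<dots> = (\<Sum>x\<in>A. \<bar>g x\<bar> * (\<Sum>y\<in>A. P x y - c))"
      by (subst sum.swap) (simp add: sum_distrib_left)
    also have "\<dots> = ?\<rho> * (\<Sum>x\<in>A. \<bar>g x\<bar>)"
      by (simp add: sum_subtractf P_sum flip: sum_distrib_right)
    finally show ?thesis .
  qed
qed

lemma chain_law_nonneg: "x0 \<in> A \<Longrightarrow> y \<in> A \<Longrightarrow> 0 \<le> chain_law A P x0 m y"
proof (induction m arbitrary: y)
  case (Suc m)
  then show ?case by (auto intro!: sum_nonneg mult_nonneg_nonneg P_pos[THEN less_imp_le])
qed simp

lemma chain_law_sum: "x0 \<in> A \<Longrightarrow> (\<Sum>y\<in>A. chain_law A P x0 m y) = 1"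
proof (induction m)
  case (Suc m)
  have "(\<Sum>y\<in>A. chain_law A P x0 (Suc m) y) = (\<Sum>z\<in>A. chain_law A P x0 m z * (\<Sum>y\<in>A. P z y))"
    by (simp add: sum_distrib_left) (rule sum.swap)
  then show ?case using Suc by (simp add: P_sum)
qed (simp add: finite_A)

text \<open>Stated for two arbitrary evolutions of equal mass, so that it compares the chain both
  with its own shift by one step (existence of a limit) and with a constant sequence, a stationary
  law (uniqueness of the limit). The equality of masses is preserved because rows sum to 1.\<close>

lemma distance_decay:
  assumes "(\<Sum>x\<in>A. u 0 x) = (\<Sum>x\<in>A. v 0 x)"
    and "\<And>m y. y \<in> A \<Longrightarrow> u (Suc m) y = (\<Sum>x\<in>A. u m x * P x y)"
    and "\<And>m y. y \<in> A \<Longrightarrow> v (Suc m) y = (\<Sum>x\<in>A. v m x * P x y)"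
    and "0 \<le> \<rho>" and \<rho>: "\<And>g. (\<Sum>x\<in>A. g x) = 0 \<Longrightarrow>
      (\<Sum>y\<in>A. \<bar>\<Sum>x\<in>A. g x * P x y\<bar>) \<le> \<rho> * (\<Sum>x\<in>A. \<bar>g x\<bar>)"
  shows "(\<Sum>x\<in>A. \<bar>u m x - v m x\<bar>) \<le> \<rho> ^ m * (\<Sum>x\<in>A. \<bar>u 0 x - v 0 x\<bar>)"
proof -
  have step: "u (Suc m) y - v (Suc m) y = (\<Sum>x\<in>A. (u m x - v m x) * P x y)" if "y \<in> A" for m y
    by (simp add: assms(2,3) that left_diff_distrib sum_subtractf)
  have zero: "(\<Sum>x\<in>A. u m x - v m x) = 0" for m
  proof (induction m)
    case (Suc m)
    have "(\<Sum>y\<in>A. u (Suc m) y - v (Suc m) y) = (\<Sum>x\<in>A. (u m x - v m x) * (\<Sum>y\<in>A. P x y))"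
      by (simp add: step sum_distrib_left) (rule sum.swap)
    then show ?case using Suc by (simp add: P_sum)
  qed (simp add: assms(1) sum_subtractf)
  show ?thesis
  proof (induction m)
    case (Suc m)
    have "(\<Sum>y\<in>A. \<bar>u (Suc m) y - v (Suc m) y\<bar>) \<le> \<rho> * (\<Sum>x\<in>A. \<bar>u m x - v m x\<bar>)"
      using \<rho>[OF zero[of m]] by (simp add: step)
    also have "\<dots> \<le> \<rho> * (\<rho> ^ m * (\<Sum>x\<in>A. \<bar>u 0 x - v 0 x\<bar>))"
      by (intro mult_left_mono Suc \<open>0 \<le> \<rho>\<close>)
    finally show ?case by simp
  qed simp
qed

text \<open>The chain and its shift by one step approach each other geometrically, so the increments
  of the law are summable.\<close>

lemma chain_law_convergent:
  assumes "x0 \<in> A" "y \<in> A"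
  shows "convergent (\<lambda>m. chain_law A P x0 m y)"
proof -
  obtain \<rho> where \<rho>: "0 \<le> \<rho>" "\<rho> < 1" "\<And>g. (\<Sum>x\<in>A. g x) = 0 \<Longrightarrow>
      (\<Sum>y\<in>A. \<bar>\<Sum>x\<in>A. g x * P x y\<bar>) \<le> \<rho> * (\<Sum>x\<in>A. \<bar>g x\<bar>)"
    by (rule contraction) blast
  let ?u = "\<lambda>m. chain_law A P x0 m"
  let ?K = "\<Sum>x\<in>A. \<bar>?u (Suc 0) x - ?u 0 x\<bar>"
  have "(\<Sum>x\<in>A. \<bar>?u (Suc m) x - ?u m x\<bar>) \<le> \<rho> ^ m * ?K" for m
    by (rule distance_decay[where u = "\<lambda>m. ?u (Suc m)" and v = ?u, OF _ _ _ \<rho>(1,3)])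
      (use chain_law_sum[OF assms(1), of "Suc 0"] chain_law_sum[OF assms(1), of 0] in simp_all)
  moreover have "\<bar>?u (Suc m) y - ?u m y\<bar> \<le> (\<Sum>x\<in>A. \<bar>?u (Suc m) x - ?u m x\<bar>)" for m
    using assms(2) finite_A by (intro member_le_sum) auto
  ultimately have "\<bar>?u (Suc m) y - ?u m y\<bar> \<le> \<rho> ^ m * ?K" for m
    using order_trans by blast
  then have bound: "norm (?u (Suc m) y - ?u m y) \<le> \<rho> ^ m * ?K" for m by (simp only: real_norm_def)
  have "summable (\<lambda>m. \<rho> ^ m * ?K)"
    using \<rho> by (intro summable_mult2 summable_geometric) simp
  then have "summable (\<lambda>m. ?u (Suc m) y - ?u m y)"
    by (rule summable_comparison_test') (rule bound)
  then have "convergent (\<lambda>n. \<Sum>m<n. ?u (Suc m) y - ?u m y)"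
    by (simp only: summable_iff_convergent)
  then have "convergent (\<lambda>n. ?u n y - ?u 0 y)"
    using sum_lessThan_telescope[of "\<lambda>m. ?u m y"] by (simp del: chain_law.simps)
  then have "convergent (\<lambda>n. (?u n y - ?u 0 y) + ?u 0 y)"
    by (intro convergent_add convergent_const)
  then show ?thesis by simp
qed

lemma stationary_exists: "\<exists>\<pi>. is_stationary A P \<pi>"
proof -
  obtain x0 where x0: "x0 \<in> A" using A_ne by blast
  define \<pi> where "\<pi> y = (if y \<in> A then lim (\<lambda>m. chain_law A P x0 m y) else 0)" for y
  have lim: "(\<lambda>m. chain_law A P x0 m y) \<longlonglongrightarrow> \<pi> y" if "y \<in> A" for y
    using chain_law_convergent[OF x0 that] that by (simp add: \<pi>_def convergent_LIMSEQ_iff)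
  have "0 \<le> \<pi> y" for y
    using LIMSEQ_le_const[OF lim, of y 0] chain_law_nonneg[OF x0] by (cases "y \<in> A") (auto simp: \<pi>_def)
  moreover have "(\<Sum>x\<in>A. \<pi> x) = 1"
  proof -
    have "(\<lambda>m. \<Sum>y\<in>A. chain_law A P x0 m y) \<longlonglongrightarrow> (\<Sum>y\<in>A. \<pi> y)"
      by (intro tendsto_sum lim)
    then show ?thesis by (simp add: chain_law_sum x0 LIMSEQ_const_iff)
  qed
  moreover have "(\<Sum>x\<in>A. \<pi> x * P x y) = \<pi> y" if "y \<in> A" for y
  proof -
    have "(\<lambda>m. \<Sum>x\<in>A. chain_law A P x0 m x * P x y) \<longlonglongrightarrow> (\<Sum>x\<in>A. \<pi> x * P x y)"
      by (intro tendsto_intros lim)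
    moreover have "(\<lambda>m. chain_law A P x0 (Suc m) y) \<longlonglongrightarrow> \<pi> y"
      by (rule LIMSEQ_Suc[OF lim[OF that]])
    ultimately show ?thesis by (simp add: LIMSEQ_unique)
  qed
  ultimately show ?thesis
    unfolding is_stationary_def by (intro exI[of _ \<pi>]) (auto simp: \<pi>_def)
qed

lemma chain_law_tendsto_stationary:
  assumes "is_stationary A P \<pi>" "x0 \<in> A" "y \<in> A"
  shows "(\<lambda>m. chain_law A P x0 m y) \<longlonglongrightarrow> \<pi> y"
proof -
  obtain \<rho> where \<rho>: "0 \<le> \<rho>" "\<rho> < 1" "\<And>g. (\<Sum>x\<in>A. g x) = 0 \<Longrightarrow>
      (\<Sum>y\<in>A. \<bar>\<Sum>x\<in>A. g x * P x y\<bar>) \<le> \<rho> * (\<Sum>x\<in>A. \<bar>g x\<bar>)"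
    by (rule contraction) blast
  let ?u = "\<lambda>m. chain_law A P x0 m"
  let ?K = "\<Sum>x\<in>A. \<bar>?u 0 x - \<pi> x\<bar>"
  have "(\<Sum>x\<in>A. \<bar>?u m x - \<pi> x\<bar>) \<le> \<rho> ^ m * ?K" for m
    by (rule distance_decay[where u = ?u and v = "\<lambda>_. \<pi>", OF _ _ _ \<rho>(1,3)])
      (use assms chain_law_sum[OF assms(2), of 0] in \<open>simp_all add: is_stationary_def\<close>)
  moreover have "\<bar>?u m y - \<pi> y\<bar> \<le> (\<Sum>x\<in>A. \<bar>?u m x - \<pi> x\<bar>)" for m
    using assms(3) finite_A by (intro member_le_sum) auto
  ultimately have bound: "norm (?u m y - \<pi> y) \<le> \<rho> ^ m * ?K" for m
    unfolding real_norm_def using order_trans by blast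
  have "(\<lambda>m. \<rho> ^ m * ?K) \<longlonglongrightarrow> 0"
    by (intro tendsto_mult_left_zero LIMSEQ_realpow_zero \<rho>)
  then have "(\<lambda>m. ?u m y - \<pi> y) \<longlonglongrightarrow> 0"
    by (rule Lim_null_comparison[OF always_eventually[OF allI[OF bound]]])
  then show ?thesis by (simp add: LIM_zero_iff)
qed

text \<open>Makes the \<open>THE\<close> in \<open>stationary\<close> meaningful: any two stationary
  laws are limits of one and the same sequence of laws, and they agree off \<open>A\<close> since
  both vanish there.\<close>

lemma is_stationary_stationary: "is_stationary A P (stationary A P)"
proof -
  obtain x0 where x0: "x0 \<in> A" using A_ne by blast
  obtain \<pi> where \<pi>: "is_stationary A P \<pi>" using stationary_exists by blast
  show ?thesis
    unfolding stationary_def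
  proof (rule theI[where P = "is_stationary A P", OF \<pi>])
    fix \<pi>' assume \<pi>': "is_stationary A P \<pi>'"
    have "\<pi>' y = \<pi> y" if "y \<in> A" for y
      using LIMSEQ_unique[OF chain_law_tendsto_stationary[OF \<pi>' x0 that]
          chain_law_tendsto_stationary[OF \<pi> x0 that]] .
    moreover have "\<pi>' y = \<pi> y" if "y \<notin> A" for y
      using \<pi> \<pi>' that by (simp add: is_stationary_def)
    ultimately show "\<pi>' = \<pi>" by blast
  qed
qed

section \<open>Distance to the stationary law and mixing times\<close>

lemma tv_dist_Suc_le:
  assumes "is_stationary A P \<pi>"
  shows "tv_dist A (chain_law A P x0 (Suc m)) \<pi> \<le> tv_dist A (chain_law A P x0 m) \<pi>"
proof -
  have "chain_law A P x0 (Suc m) y - \<pi> y = (\<Sum>x\<in>A. (chain_law A P x0 m x - \<pi> x) * P x y)"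
    if "y \<in> A" for y
    using assms that by (simp add: is_stationary_def left_diff_distrib sum_subtractf)
  then show ?thesis
    using nonexpansive[of "\<lambda>x. chain_law A P x0 m x - \<pi> x"] by (simp add: tv_dist_def)
qed

text \<open>Allows a lower bound on the distance at one time to exclude all earlier times as mixing
  times.\<close>

lemma tv_dist_antimono:
  assumes "is_stationary A P \<pi>" "m \<le> m'"
  shows "tv_dist A (chain_law A P x0 m') \<pi> \<le> tv_dist A (chain_law A P x0 m) \<pi>"
  using assms(2) tv_dist_Suc_le[OF assms(1)] by (induction rule: dec_induct) (auto intro: order_trans)

lemma stationary_chain_law:
  assumes "is_stationary A P \<pi>" "y \<in> A"
  shows "(\<Sum>x\<in>A. \<pi> x * chain_law A P x m y) = \<pi> y"
  using assms(2)
proof (induction m arbitrary: y)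
  case 0
  have "(\<Sum>x\<in>A. \<pi> x * chain_law A P x 0 y) = (\<Sum>x\<in>A. if y = x then \<pi> x else 0)"
    by (intro sum.cong) auto
  then show ?case using 0 finite_A by simp
next
  case (Suc m)
  have "(\<Sum>x\<in>A. \<pi> x * chain_law A P x (Suc m) y) = (\<Sum>z\<in>A. (\<Sum>x\<in>A. \<pi> x * chain_law A P x m z) * P z y)"
    by (simp add: sum_distrib_left sum_distrib_right mult.assoc) (rule sum.swap)
  also have "\<dots> = (\<Sum>z\<in>A. \<pi> z * P z y)" by (simp add: Suc.IH)
  finally show ?case using assms(1) Suc.prems by (simp add: is_stationary_def)
qed

text \<open>By invariance \<open>\<pi>\<close> is the mixture of the laws started from its own
  random state, so distances between pairs of initial states suffice and nothing explicit about
  \<open>\<pi>\<close> is required. The factor 2 undoes the half in \<open>tv_dist\<close>.\<close>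

lemma tv_dist_stationary_le:
  assumes "is_stationary A P \<pi>"
    and "\<And>x'. x' \<in> A \<Longrightarrow> (\<Sum>y\<in>A. \<bar>chain_law A P x0 m y - chain_law A P x' m y\<bar>) \<le> 2 * d"
  shows "tv_dist A (chain_law A P x0 m) \<pi> \<le> d"
proof -
  have \<pi>: "(\<Sum>x\<in>A. \<pi> x) = 1" "\<And>x. 0 \<le> \<pi> x" using assms(1) by (auto simp: is_stationary_def)
  have "(\<Sum>y\<in>A. \<bar>chain_law A P x0 m y - \<pi> y\<bar>)
      = (\<Sum>y\<in>A. \<bar>\<Sum>x\<in>A. \<pi> x * (chain_law A P x0 m y - chain_law A P x m y)\<bar>)"
    by (intro sum.cong refl arg_cong[where f = abs])
      (simp add: right_diff_distrib sum_subtractf stationary_chain_law assms(1) \<pi> flip: sum_distrib_right)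
  also have "\<dots> \<le> (\<Sum>y\<in>A. \<Sum>x\<in>A. \<pi> x * \<bar>chain_law A P x0 m y - chain_law A P x m y\<bar>)"
    by (intro sum_mono order_trans[OF sum_abs]) (simp add: abs_mult \<pi>)
  also have "\<dots> = (\<Sum>x\<in>A. \<pi> x * (\<Sum>y\<in>A. \<bar>chain_law A P x0 m y - chain_law A P x m y\<bar>))"
    by (subst sum.swap) (simp add: sum_distrib_left)
  also have "\<dots> \<le> (\<Sum>x\<in>A. \<pi> x * (2 * d))"
    by (intro sum_mono mult_left_mono assms(2) \<pi>)
  finally show ?thesis by (simp add: tv_dist_def \<pi> flip: sum_distrib_right)
qed

lemma mixing_time_le:
  assumes "1 \<le> m" "\<And>x0. x0 \<in> A \<Longrightarrow> tv_dist A (chain_law A P x0 m) (stationary A P) < \<epsilon>"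
  shows "mixing_time A P \<epsilon> \<le> m"
  unfolding mixing_time_def using assms finite_A A_ne by (intro Least_le) simp

text \<open>The time \<open>m'\<close> is the witness without which the \<open>LEAST\<close> in
  \<open>mixing_time\<close> would be unspecified.\<close>

lemma tv_dist_mixing_time:
  assumes "1 \<le> m'" "\<And>x0. x0 \<in> A \<Longrightarrow> tv_dist A (chain_law A P x0 m') (stationary A P) < \<epsilon>"
  shows "1 \<le> mixing_time A P \<epsilon>"
    "x0 \<in> A \<Longrightarrow> tv_dist A (chain_law A P x0 (mixing_time A P \<epsilon>)) (stationary A P) < \<epsilon>"
proof -
  have "1 \<le> mixing_time A P \<epsilon> \<and>
    Max ((\<lambda>x0. tv_dist A (chain_law A P x0 (mixing_time A P \<epsilon>)) (stationary A P)) ` A) < \<epsilon>"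
    unfolding mixing_time_def by (rule LeastI[where k = m']) (use assms finite_A A_ne in simp)
  then show "1 \<le> mixing_time A P \<epsilon>"
    "x0 \<in> A \<Longrightarrow> tv_dist A (chain_law A P x0 (mixing_time A P \<epsilon>)) (stationary A P) < \<epsilon>"
    using finite_A A_ne by auto
qed

end

text \<open>As both masses are 1, the excess of \<open>\<mu>\<close> on \<open>T\<close> equals the
  excess of \<open>\<nu>\<close> off \<open>T\<close>; the two together cancel the factor 1/2. Here
  \<open>T\<close> plays the role of a statistical test.\<close>

lemma tv_dist_ge:
  assumes "finite A" "T \<subseteq> A" "(\<Sum>x\<in>A. \<mu> x) = 1" "(\<Sum>x\<in>A. \<nu> x) = 1"
  shows "(\<Sum>x\<in>T. \<mu> x) - (\<Sum>x\<in>T. \<nu> x) \<le> tv_dist A \<mu> \<nu>"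
proof -
  have split: "sum g A = sum g T + sum g (A - T)" for g :: "'a \<Rightarrow> real"
    using sum.subset_diff[OF assms(2,1), of g] by simp
  have "(\<Sum>x\<in>T. \<mu> x - \<nu> x) + (\<Sum>x\<in>A-T. \<nu> x - \<mu> x) \<le> (\<Sum>x\<in>T. \<bar>\<mu> x - \<nu> x\<bar>) + (\<Sum>x\<in>A-T. \<bar>\<mu> x - \<nu> x\<bar>)"
    by (intro add_mono sum_mono) auto
  then show ?thesis
    using assms(3,4) split[of \<mu>] split[of \<nu>] split[of "\<lambda>x. \<bar>\<mu> x - \<nu> x\<bar>"]
    unfolding tv_dist_def sum_subtractf by linarith
qed

section \<open>Product measures on finite sets\<close>

lemma sum_UN_le:
  fixes f :: "'b \<Rightarrow> real"
  assumes "finite I" "\<And>i. finite (A i)" "\<And>x. 0 \<le> f x"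
  shows "(\<Sum>x\<in>(\<Union>i\<in>I. A i). f x) \<le> (\<Sum>i\<in>I. \<Sum>x\<in>A i. f x)"
  using assms(1)
proof (induction I rule: finite_induct)
  case (insert i I)
  have "(\<Sum>x\<in>A i \<union> (\<Union>i\<in>I. A i). f x) \<le> (\<Sum>x\<in>A i. f x) + (\<Sum>x\<in>(\<Union>i\<in>I. A i). f x)"
    using insert.hyps assms by (simp add: sum_Un sum_nonneg)
  then show ?case using insert by simp
qed simp

lemma sum_PiE_one:
  fixes p :: "'i \<Rightarrow> 'k::finite \<Rightarrow> real"
  assumes "finite I" "\<And>i. i \<in> I \<Longrightarrow> (\<Sum>a\<in>UNIV. p i a) = 1"
  shows "(\<Sum>y\<in>PiE I (\<lambda>_. UNIV). \<Prod>i\<in>I. p i (y i)) = 1"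
  using prod_sum_PiE[of I "\<lambda>_. UNIV" p] assms by simp

text \<open>The \<open>\<chi>\<^sup>2\<close>-divergence, unlike the total variation distance, is multiplicative
  (after adding 1) over product measures.\<close>

lemma product_l1_le:
  fixes p q :: "'i \<Rightarrow> 'k::finite \<Rightarrow> real"
  assumes "finite I" and p: "\<And>i. i \<in> I \<Longrightarrow> (\<Sum>a\<in>UNIV. p i a) = 1"
    and q: "\<And>i. i \<in> I \<Longrightarrow> (\<Sum>a\<in>UNIV. q i a) = 1"
    and pos: "\<And>i a. i \<in> I \<Longrightarrow> 0 < q i a"
    and chi: "\<And>i. i \<in> I \<Longrightarrow> (\<Sum>a\<in>UNIV. (p i a)\<^sup>2 / q i a) \<le> 1 + t"
    and "0 \<le> t"
  shows "(\<Sum>y\<in>PiE I (\<lambda>_. UNIV). \<bar>(\<Prod>i\<in>I. p i (y i)) - (\<Prod>i\<in>I. q i (y i))\<bar>)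
    \<le> sqrt ((1 + t) ^ card I - 1)"
proof -
  let ?Y = "PiE I (\<lambda>_. UNIV :: 'k set)"
  define f g where "f y = (\<Prod>i\<in>I. p i (y i))" and "g y = (\<Prod>i\<in>I. q i (y i))" for y
  have fg: "(\<Sum>y\<in>?Y. f y) = 1" "(\<Sum>y\<in>?Y. g y) = 1"
    unfolding f_def g_def using assms by (simp_all add: sum_PiE_one)
  have g_pos: "0 < g y" for y unfolding g_def using pos by (auto intro: prod_pos)
  \<comment> \<open>Cauchy-Schwarz with weight \<open>sqrt (g y)\<close>: one factor becomes the
    chi-square divergence, the other the total mass 1 of \<open>g\<close>.\<close>
  have "(\<Sum>y\<in>?Y. \<bar>f y - g y\<bar>)\<^sup>2 = (\<Sum>y\<in>?Y. (\<bar>f y - g y\<bar> / sqrt (g y)) * sqrt (g y))\<^sup>2"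
    using g_pos by (simp add: less_imp_neq[THEN not_sym])
  also have "\<dots> \<le> (\<Sum>y\<in>?Y. (\<bar>f y - g y\<bar> / sqrt (g y))\<^sup>2) * (\<Sum>y\<in>?Y. (sqrt (g y))\<^sup>2)"
    by (rule Cauchy_Schwarz_ineq_sum)
  also have "\<dots> = (\<Sum>y\<in>?Y. (f y)\<^sup>2 / g y - 2 * f y + g y)"
    using g_pos fg(2)
    by (simp add: power_divide less_imp_le)
      (intro sum.cong refl, simp add: field_simps power2_eq_square less_imp_neq[THEN not_sym])
  also have "\<dots> = (\<Sum>y\<in>?Y. (f y)\<^sup>2 / g y) - 1"
    by (simp add: sum.distrib sum_subtractf fg flip: sum_distrib_left)
  also have "(\<Sum>y\<in>?Y. (f y)\<^sup>2 / g y) = (\<Prod>i\<in>I. \<Sum>a\<in>UNIV. (p i a)\<^sup>2 / q i a)"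
    by (subst prod_sum_PiE) (use \<open>finite I\<close> in \<open>simp_all add: f_def g_def prod_dividef prod_power_distrib\<close>)
  also have "\<dots> \<le> (\<Prod>i\<in>I. 1 + t)"
    by (intro prod_mono conjI chi sum_nonneg divide_nonneg_pos pos) auto
  finally have "(\<Sum>y\<in>?Y. \<bar>f y - g y\<bar>)\<^sup>2 \<le> (1 + t) ^ card I - 1" by simp
  then show ?thesis unfolding f_def g_def by (rule real_le_rsqrt)
qed

text \<open>The lower bound \<open>c\<close> on the denominators turns an l1 distance into a
  divergence that is quadratic in it. This square is what places the threshold at distance
  \<open>n powr (-1/2)\<close>.\<close>

lemma chi_square_le:
  fixes p q :: "'k::finite \<Rightarrow> real"
  assumes "(\<Sum>a\<in>UNIV. p a) = 1" "(\<Sum>a\<in>UNIV. q a) = 1" "0 < c" "\<And>a. c \<le> q a"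
    "(\<Sum>a\<in>UNIV. \<bar>p a - q a\<bar>) \<le> d"
  shows "(\<Sum>a\<in>UNIV. (p a)\<^sup>2 / q a) \<le> 1 + d\<^sup>2 / c"
proof -
  have q: "0 < q a" for a using assms(3,4) less_le_trans by blast
  have "(\<Sum>a\<in>UNIV. (p a)\<^sup>2 / q a) = (\<Sum>a\<in>UNIV. (p a - q a)\<^sup>2 / q a + 2 * p a - q a)"
    using q by (intro sum.cong refl)
      (simp add: field_simps power2_eq_square less_imp_neq[THEN not_sym])
  also have "\<dots> = 1 + (\<Sum>a\<in>UNIV. (p a - q a)\<^sup>2 / q a)"
    by (simp add: sum.distrib sum_subtractf assms(1,2) flip: sum_distrib_left)
  also have "(\<Sum>a\<in>UNIV. (p a - q a)\<^sup>2 / q a) \<le> (\<Sum>a\<in>UNIV. \<bar>p a - q a\<bar> * (d / c))"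
  proof (rule sum_mono)
    fix a
    have "\<bar>p a - q a\<bar> \<le> (\<Sum>a\<in>UNIV. \<bar>p a - q a\<bar>)" by (intro member_le_sum) auto
    then have "\<bar>p a - q a\<bar> \<le> d" using assms(5) by linarith
    then have "\<bar>p a - q a\<bar> / q a \<le> d / c" using assms(3,4) q by (intro frac_le) auto
    then have "\<bar>p a - q a\<bar> * (\<bar>p a - q a\<bar> / q a) \<le> \<bar>p a - q a\<bar> * (d / c)"
      by (intro mult_left_mono) auto
    then show "(p a - q a)\<^sup>2 / q a \<le> \<bar>p a - q a\<bar> * (d / c)"
      by (simp add: power2_eq_square)
  qed
  also have "\<dots> = (\<Sum>a\<in>UNIV. \<bar>p a - q a\<bar>) * (d / c)" by (rule sum_distrib_right[symmetric])
  also have "\<dots> \<le> d * (d / c)"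
    using assms(3,5) by (intro mult_right_mono divide_nonneg_pos)
      (auto intro: order_trans[OF sum_nonneg])
  finally show ?thesis by (simp add: power2_eq_square)
qed

text \<open>Independence: in the expanded square a mixed term contains the factor
  \<open>\<Sum>a. p j a * h j a\<close>, which is zero, so only the diagonal survives.\<close>

lemma product_second_moment:
  fixes p h :: "'i \<Rightarrow> 'k::finite \<Rightarrow> real"
  assumes "finite I" and p: "\<And>i. i \<in> I \<Longrightarrow> (\<Sum>a\<in>UNIV. p i a) = 1"
    and mean: "\<And>i. i \<in> I \<Longrightarrow> (\<Sum>a\<in>UNIV. p i a * h i a) = 0"
  shows "(\<Sum>y\<in>PiE I (\<lambda>_. UNIV). (\<Prod>i\<in>I. p i (y i)) * (\<Sum>i\<in>I. h i (y i))\<^sup>2)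
    = (\<Sum>i\<in>I. \<Sum>a\<in>UNIV. p i a * (h i a)\<^sup>2)"
proof -
  let ?Y = "PiE I (\<lambda>_. UNIV :: 'k set)"
  have cross: "(\<Sum>y\<in>?Y. (\<Prod>i\<in>I. p i (y i)) * (h j (y j) * h l (y l))) =
      (if j = l then \<Sum>a\<in>UNIV. p j a * (h j a)\<^sup>2 else 0)" if jl: "j \<in> I" "l \<in> I" for j l
  proof -
    \<comment> \<open>Absorbs the factors \<open>h j\<close> and \<open>h l\<close> into the weights
      of their coordinates, so that the sum over \<open>?Y\<close> factorises; for
      \<open>j = l\<close> both land on the same coordinate and give the square.\<close>
    define w where "w i a = p i a * (if i = j then h i a else 1) * (if i = l then h i a else 1)" for i a
    have "(\<Prod>i\<in>I. w i (y i)) = (\<Prod>i\<in>I. p i (y i)) * (h j (y j) * h l (y l))" for y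
      using jl \<open>finite I\<close> by (simp add: w_def prod.distrib prod.delta)
    then have "(\<Sum>y\<in>?Y. (\<Prod>i\<in>I. p i (y i)) * (h j (y j) * h l (y l))) = (\<Prod>i\<in>I. \<Sum>a\<in>UNIV. w i a)"
      using prod_sum_PiE[of I "\<lambda>_. UNIV" w] \<open>finite I\<close> by simp
    also have "\<dots> = (\<Sum>a\<in>UNIV. w j a) * (\<Prod>i\<in>I-{j}. \<Sum>a\<in>UNIV. w i a)"
      using jl \<open>finite I\<close> by (simp add: prod.remove)
    also have "\<dots> = (if j = l then \<Sum>a\<in>UNIV. p j a * (h j a)\<^sup>2 else 0)"
    proof (cases "j = l")
      case True
      have "(\<Sum>a\<in>UNIV. w i a) = 1" if "i \<in> I - {j}" for i
        using that p True by (simp add: w_def)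
      then show ?thesis using True by (simp add: w_def power2_eq_square mult.assoc)
    next
      case False
      then have "(\<Sum>a\<in>UNIV. w j a) = 0" using mean jl by (simp add: w_def)
      then show ?thesis using False by simp
    qed
    finally show ?thesis .
  qed
  have square: "(\<Sum>i\<in>I. h i (y i))\<^sup>2 = (\<Sum>j\<in>I. \<Sum>l\<in>I. h j (y j) * h l (y l))" for y
    by (simp only: power2_eq_square sum_product)
  have "(\<Sum>y\<in>?Y. (\<Prod>i\<in>I. p i (y i)) * (\<Sum>i\<in>I. h i (y i))\<^sup>2)
      = (\<Sum>y\<in>?Y. \<Sum>j\<in>I. \<Sum>l\<in>I. (\<Prod>i\<in>I. p i (y i)) * (h j (y j) * h l (y l)))"
    unfolding square sum_distrib_left ..
  also have "\<dots> = (\<Sum>j\<in>I. \<Sum>l\<in>I. \<Sum>y\<in>?Y. (\<Prod>i\<in>I. p i (y i)) * (h j (y j) * h l (y l)))"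
    by (subst sum.swap, intro sum.cong refl, subst sum.swap, rule refl)
  also have "\<dots> = (\<Sum>i\<in>I. \<Sum>a\<in>UNIV. p i a * (h i a)\<^sup>2)"
    using \<open>finite I\<close> by (simp add: cross sum.delta)
  finally show ?thesis .
qed

text \<open>The bound \<open>v i\<close> may depend on the coordinate, so that coordinates on which
  the statistic does not depend cost nothing.\<close>

lemma product_chebyshev:
  fixes p h :: "'i \<Rightarrow> 'k::finite \<Rightarrow> real"
  assumes "finite I" and p: "\<And>i. i \<in> I \<Longrightarrow> (\<Sum>a\<in>UNIV. p i a) = 1"
    and nonneg: "\<And>i a. i \<in> I \<Longrightarrow> 0 \<le> p i a"
    and mean: "\<And>i. i \<in> I \<Longrightarrow> (\<Sum>a\<in>UNIV. p i a * h i a) = 0"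
    and h: "\<And>i a. i \<in> I \<Longrightarrow> (h i a)\<^sup>2 \<le> v i"
    and "0 < \<tau>" "T \<subseteq> PiE I (\<lambda>_. UNIV)" "\<And>y. y \<in> T \<Longrightarrow> \<tau> \<le> \<bar>\<Sum>i\<in>I. h i (y i)\<bar>"
  shows "(\<Sum>y\<in>T. \<Prod>i\<in>I. p i (y i)) \<le> (\<Sum>i\<in>I. v i) / \<tau>\<^sup>2"
proof -
  let ?Y = "PiE I (\<lambda>_. UNIV :: 'k set)"
  have fin: "finite ?Y" using \<open>finite I\<close> by (intro finite_PiE) auto
  have pr: "0 \<le> (\<Prod>i\<in>I. p i (y i))" for y using nonneg by (auto intro: prod_nonneg)
  have "\<tau>\<^sup>2 * (\<Sum>y\<in>T. \<Prod>i\<in>I. p i (y i)) \<le> (\<Sum>y\<in>T. (\<Prod>i\<in>I. p i (y i)) * (\<Sum>i\<in>I. h i (y i))\<^sup>2)"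
    unfolding sum_distrib_left
  proof (rule sum_mono)
    fix y assume "y \<in> T"
    then have "\<tau>\<^sup>2 \<le> (\<Sum>i\<in>I. h i (y i))\<^sup>2"
      using assms(6,8) by (subst power2_abs[of "sum _ _", symmetric]) (intro power_mono, auto)
    then show "\<tau>\<^sup>2 * (\<Prod>i\<in>I. p i (y i)) \<le> (\<Prod>i\<in>I. p i (y i)) * (\<Sum>i\<in>I. h i (y i))\<^sup>2"
      using pr[of y] by (subst mult.commute) (rule mult_left_mono)
  qed
  also have "\<dots> \<le> (\<Sum>y\<in>?Y. (\<Prod>i\<in>I. p i (y i)) * (\<Sum>i\<in>I. h i (y i))\<^sup>2)"
    using assms(7) fin pr by (intro sum_mono2) auto
  also have "\<dots> = (\<Sum>i\<in>I. \<Sum>a\<in>UNIV. p i a * (h i a)\<^sup>2)"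
    using assms by (intro product_second_moment) auto
  also have "\<dots> \<le> (\<Sum>i\<in>I. \<Sum>a\<in>UNIV. p i a * v i)"
    by (intro sum_mono mult_left_mono h nonneg)
  also have "\<dots> = (\<Sum>i\<in>I. v i)" by (simp add: p flip: sum_distrib_right)
  finally show ?thesis using \<open>0 < \<tau>\<close> by (simp add: pos_le_divide_eq mult.commute)
qed

section \<open>Dobrushin's coefficient\<close>

definition l1_norm :: "real ^ 'k::finite \<Rightarrow> real" where
  "l1_norm v = (\<Sum>a\<in>UNIV. \<bar>v $ a\<bar>)"

text \<open>The half makes this the largest total variation distance of two columns, hence at most 1
  for stochastic matrices and submultiplicative with constant 1.\<close>

definition dobrushin :: "real ^ 'k::finite ^ 'k \<Rightarrow> real" where
  "dobrushin Q = Max ((\<lambda>(a, b). (\<Sum>c\<in>UNIV. \<bar>Q $ c $ a - Q $ c $ b\<bar>) / 2) ` UNIV)"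

lemma l1_norm_nonneg: "0 \<le> l1_norm v"
  by (simp add: l1_norm_def sum_nonneg)

lemma l1_norm_scaleR: "l1_norm (c *\<^sub>R v) = \<bar>c\<bar> * l1_norm v"
  by (simp add: l1_norm_def abs_mult sum_distrib_left)

lemma l1_norm_eq_0_iff: "l1_norm v = 0 \<longleftrightarrow> v = 0"
  by (simp add: l1_norm_def sum_nonneg_eq_0_iff vec_eq_iff)

lemma component_le_l1_norm: "\<bar>v $ a\<bar> \<le> l1_norm v"
  unfolding l1_norm_def by (intro member_le_sum) auto

lemma col_stochastic_nonneg: "S \<in> col_stochastic \<Longrightarrow> 0 \<le> S $ a $ b"
  and col_stochastic_sum: "S \<in> col_stochastic \<Longrightarrow> (\<Sum>a\<in>UNIV. S $ a $ b) = 1"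
  by (auto simp: col_stochastic_def)

lemma col_stochastic_le_one:
  assumes "S \<in> col_stochastic" shows "S $ a $ b \<le> 1"
  using member_le_sum[of a UNIV "\<lambda>a. S $ a $ b"] assms
  by (simp add: col_stochastic_nonneg col_stochastic_sum)

lemma col_stochastic_mat_1: "mat 1 \<in> col_stochastic"
  by (simp add: col_stochastic_def mat_def)

lemma col_stochastic_mult:
  assumes "R \<in> col_stochastic" "Q \<in> col_stochastic"
  shows "R ** Q \<in> col_stochastic"
proof -
  have "(\<Sum>a\<in>UNIV. (R ** Q) $ a $ b) = 1" for b
  proof -
    have "(\<Sum>a\<in>UNIV. (R ** Q) $ a $ b) = (\<Sum>c\<in>UNIV. (\<Sum>a\<in>UNIV. R $ a $ c) * Q $ c $ b)"
      by (simp add: matrix_matrix_mult_def sum_distrib_right) (rule sum.swap)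
    then show ?thesis using assms by (simp add: col_stochastic_sum)
  qed
  moreover have "0 \<le> (R ** Q) $ a $ b" for a b
    by (simp add: matrix_matrix_mult_def sum_nonneg col_stochastic_nonneg assms)
  ultimately show ?thesis by (simp add: col_stochastic_def)
qed

text \<open>An entry of \<open>R ** Q\<close> is an average of a row of \<open>R\<close>, weighted
  by a column of \<open>Q\<close>; lower bounds on the left factor therefore survive any number of
  earlier factors.\<close>

lemma entry_mult_ge:
  assumes "Q \<in> col_stochastic" "\<And>a b. c \<le> R $ a $ b"
  shows "c \<le> (R ** Q) $ a $ b"
proof -
  have "c = (\<Sum>d\<in>UNIV. c * Q $ d $ b)"
    using assms(1) by (simp add: col_stochastic_sum flip: sum_distrib_left)
  also have "\<dots> \<le> (\<Sum>d\<in>UNIV. R $ a $ d * Q $ d $ b)"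
    by (intro sum_mono mult_right_mono assms(2) col_stochastic_nonneg assms(1))
  finally show ?thesis by (simp add: matrix_matrix_mult_def)
qed

lemma l1_norm_mult_le:
  assumes "S \<in> col_stochastic"
  shows "l1_norm (S *v u) \<le> l1_norm u"
proof -
  have "l1_norm (S *v u) \<le> (\<Sum>a\<in>UNIV. \<Sum>b\<in>UNIV. S $ a $ b * \<bar>u $ b\<bar>)"
    unfolding l1_norm_def matrix_vector_mult_def using assms
    by (auto intro!: sum_mono order_trans[OF sum_abs] simp: abs_mult col_stochastic_nonneg)
  also have "\<dots> = (\<Sum>b\<in>UNIV. (\<Sum>a\<in>UNIV. S $ a $ b) * \<bar>u $ b\<bar>)"
    by (subst sum.swap) (simp add: sum_distrib_right)
  finally show ?thesis using assms by (simp add: l1_norm_def col_stochastic_sum)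
qed

lemma dobrushin_ge: "(\<Sum>c\<in>UNIV. \<bar>Q $ c $ a - Q $ c $ b\<bar>) \<le> 2 * dobrushin Q"
proof -
  have "(\<lambda>(a, b). (\<Sum>c\<in>UNIV. \<bar>Q $ c $ a - Q $ c $ b\<bar>) / 2) (a, b) \<le> dobrushin Q"
    unfolding dobrushin_def by (intro Max_ge) (auto simp del: split_paired_All)
  then show ?thesis by simp
qed

lemma dobrushin_attained:
  obtains a b where "2 * dobrushin Q = (\<Sum>c\<in>UNIV. \<bar>Q $ c $ a - Q $ c $ b\<bar>)"
proof -
  have "dobrushin Q \<in> (\<lambda>(a, b). (\<Sum>c\<in>UNIV. \<bar>Q $ c $ a - Q $ c $ b\<bar>) / 2) ` UNIV"
    unfolding dobrushin_def by (intro Max_in) auto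
  then obtain a b where "dobrushin Q = (\<Sum>c\<in>UNIV. \<bar>Q $ c $ a - Q $ c $ b\<bar>) / 2" by auto
  then show thesis using that[of a b] by simp
qed

lemma dobrushin_nonneg: "0 \<le> dobrushin Q"
  using dobrushin_ge[of Q undefined undefined] by simp

text \<open>Pigeonhole over the rows. The lower bound of the mixing time counts a single label
  \<open>c\<close>, and this selects one whose frequencies differ noticeably.\<close>

lemma dobrushin_attained_entry:
  fixes Q :: "real ^ 'k::finite ^ 'k"
  obtains a b c where "2 * dobrushin Q / real CARD('k) \<le> \<bar>Q $ c $ a - Q $ c $ b\<bar>"
proof -
  obtain a b where ab: "2 * dobrushin Q = (\<Sum>c\<in>UNIV. \<bar>Q $ c $ a - Q $ c $ b\<bar>)"
    by (rule dobrushin_attained)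
  have "\<exists>c. 2 * dobrushin Q / real CARD('k) \<le> \<bar>Q $ c $ a - Q $ c $ b\<bar>"
  proof (rule ccontr)
    assume "\<not> ?thesis"
    then have "(\<Sum>c\<in>UNIV. \<bar>Q $ c $ a - Q $ c $ b\<bar>) < (\<Sum>c\<in>(UNIV::'k set). 2 * dobrushin Q / real CARD('k))"
      by (intro sum_strict_mono) (auto simp: not_le)
    then show False using ab by simp
  qed
  then show thesis using that by blast
qed

lemma dobrushin_le_one:
  assumes "Q \<in> col_stochastic" shows "dobrushin Q \<le> 1"
proof -
  obtain a b where "2 * dobrushin Q = (\<Sum>c\<in>UNIV. \<bar>Q $ c $ a - Q $ c $ b\<bar>)"
    by (rule dobrushin_attained)
  also have "\<dots> \<le> (\<Sum>c\<in>UNIV. Q $ c $ a + Q $ c $ b)"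
  proof (rule sum_mono)
    fix c
    show "\<bar>Q $ c $ a - Q $ c $ b\<bar> \<le> Q $ c $ a + Q $ c $ b"
      using col_stochastic_nonneg[OF assms, of c a] col_stochastic_nonneg[OF assms, of c b] by linarith
  qed
  also have "\<dots> = 2" using assms by (simp add: sum.distrib col_stochastic_sum)
  finally show ?thesis by simp
qed

lemma dobrushin_less_one:
  assumes "Q \<in> col_stochastic" "\<And>a b. 0 < Q $ a $ b"
  shows "dobrushin Q < 1"
proof -
  obtain a b where "2 * dobrushin Q = (\<Sum>c\<in>UNIV. \<bar>Q $ c $ a - Q $ c $ b\<bar>)"
    by (rule dobrushin_attained)
  also have "\<dots> < (\<Sum>c\<in>UNIV. Q $ c $ a + Q $ c $ b)"
  proof (rule sum_strict_mono)
    fix c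
    show "\<bar>Q $ c $ a - Q $ c $ b\<bar> < Q $ c $ a + Q $ c $ b"
      using assms(2)[of c a] assms(2)[of c b] by linarith
  qed auto
  also have "\<dots> = 2" using assms by (simp add: sum.distrib col_stochastic_sum)
  finally show ?thesis by simp
qed

text \<open>Positive and negative part of \<open>v\<close> have the same mass, so that \<open>v\<close> is a combination of
  differences of unit vectors.\<close>

lemma l1_norm_mult_le_dobrushin:
  assumes "(\<Sum>a\<in>UNIV. v $ a) = 0"
  shows "l1_norm (R *v v) \<le> dobrushin R * l1_norm v"
proof (cases "v = 0")
  case True
  then show ?thesis by (simp add: l1_norm_def)
next
  case False
  define vp vm where "vp a = max (v $ a) 0" and "vm a = max (- v $ a) 0" for a
  define t where "t = (\<Sum>a\<in>UNIV. vp a)"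
  have v: "v $ a = vp a - vm a" "\<bar>v $ a\<bar> = vp a + vm a" for a
    by (auto simp: vp_def vm_def)
  have nn: "0 \<le> vp a" "0 \<le> vm a" for a by (auto simp: vp_def vm_def)
  have tm: "(\<Sum>a\<in>UNIV. vm a) = t" using assms by (simp add: v sum_subtractf t_def)
  have norm: "l1_norm v = 2 * t" by (simp add: l1_norm_def v(2) sum.distrib tm) (simp add: t_def)
  have "0 < l1_norm v" using False l1_norm_nonneg[of v] l1_norm_eq_0_iff[of v] by linarith
  then have "0 < t" by (simp add: norm)
  \<comment> \<open>The weights \<open>vp a * vm b / t\<close> transport the positive part to the
    negative part; multiplying by \<open>t\<close> avoids the division.\<close>
  have R: "t * (R *v v) $ c = (\<Sum>a\<in>UNIV. \<Sum>b\<in>UNIV. vp a * vm b * (R $ c $ a - R $ c $ b))" for c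
  proof -
    have "(\<Sum>a\<in>UNIV. \<Sum>b\<in>UNIV. vp a * vm b * (R $ c $ a - R $ c $ b)) =
        (\<Sum>a\<in>UNIV. \<Sum>b\<in>UNIV. (vp a * R $ c $ a) * vm b) - (\<Sum>a\<in>UNIV. \<Sum>b\<in>UNIV. vp a * (vm b * R $ c $ b))"
      unfolding sum_subtractf[symmetric] by (intro sum.cong refl) (simp add: algebra_simps)
    also have "\<dots> = (\<Sum>a\<in>UNIV. vp a * R $ c $ a) * t - t * (\<Sum>b\<in>UNIV. vm b * R $ c $ b)"
      by (simp add: tm t_def flip: sum_product)
    also have "\<dots> = t * (\<Sum>a\<in>UNIV. R $ c $ a * v $ a)"
      by (simp add: v right_diff_distrib sum_subtractf mult.commute)
    finally show ?thesis by (simp add: matrix_vector_mult_def)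
  qed
  have "t * l1_norm (R *v v) = (\<Sum>c\<in>UNIV. \<bar>t * (R *v v) $ c\<bar>)"
    using \<open>0 < t\<close> by (simp add: l1_norm_def abs_mult sum_distrib_left)
  also have "\<dots> \<le> (\<Sum>c\<in>UNIV. \<Sum>a\<in>UNIV. \<Sum>b\<in>UNIV. vp a * vm b * \<bar>R $ c $ a - R $ c $ b\<bar>)"
    unfolding R by (intro sum_mono order_trans[OF sum_abs]) (simp add: abs_mult nn)
  also have "\<dots> = (\<Sum>a\<in>UNIV. \<Sum>b\<in>UNIV. \<Sum>c\<in>UNIV. vp a * vm b * \<bar>R $ c $ a - R $ c $ b\<bar>)"
    by (rule trans[OF sum.swap sum.cong[OF refl sum.swap]])
  also have "\<dots> \<le> (\<Sum>a\<in>UNIV. \<Sum>b\<in>UNIV. vp a * vm b * (2 * dobrushin R))"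
    unfolding sum_distrib_left[symmetric]
    by (intro sum_mono mult_left_mono dobrushin_ge) (simp add: nn)
  also have "\<dots> = t * t * (2 * dobrushin R)"
    by (simp add: t_def tm sum_product flip: sum_distrib_right) (simp add: t_def tm flip: sum_product)
  also have "\<dots> = t * (dobrushin R * l1_norm v)" by (simp add: norm)
  finally show ?thesis using \<open>0 < t\<close> by simp
qed

text \<open>A difference of two columns of \<open>R ** Q\<close> is \<open>R\<close> applied to the
  corresponding difference for \<open>Q\<close>, a vector of total mass zero.\<close>

lemma dobrushin_mult_le:
  assumes "Q \<in> col_stochastic"
  shows "dobrushin (R ** Q) \<le> dobrushin R * dobrushin Q"
proof -
  obtain a b where "2 * dobrushin (R ** Q) = (\<Sum>c\<in>UNIV. \<bar>(R ** Q) $ c $ a - (R ** Q) $ c $ b\<bar>)"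
    by (rule dobrushin_attained)
  also have "\<dots> = l1_norm (R *v (\<chi> d. Q $ d $ a - Q $ d $ b))"
    by (simp add: l1_norm_def matrix_vector_mult_def matrix_matrix_mult_def right_diff_distrib sum_subtractf)
  also have "\<dots> \<le> dobrushin R * l1_norm (\<chi> d. Q $ d $ a - Q $ d $ b)"
    using assms by (intro l1_norm_mult_le_dobrushin) (simp add: sum_subtractf col_stochastic_sum)
  also have "\<dots> \<le> dobrushin R * (2 * dobrushin Q)"
    using dobrushin_ge[of Q a b] by (intro mult_left_mono dobrushin_nonneg) (simp add: l1_norm_def)
  finally show ?thesis by simp
qed

section \<open>Measurability of the matrix functionals\<close>

lemma borel_measurable_entry [measurable]:
  "(\<lambda>Q :: real ^ 'k::finite ^ 'k. Q $ a $ b) \<in> borel_measurable borel"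
  by (intro borel_measurable_continuous_onI continuous_intros)

lemma borel_measurable_mult_vec [measurable]:
  "(\<lambda>Q :: real ^ 'k::finite ^ 'k. (Q *v u) $ a) \<in> borel_measurable borel"
  by (simp add: matrix_vector_mult_def)

lemma borel_measurable_l1_norm_mult [measurable]:
  "(\<lambda>Q :: real ^ 'k::finite ^ 'k. l1_norm (Q *v u)) \<in> borel_measurable borel"
  unfolding l1_norm_def by measurable

lemma borel_measurable_dobrushin [measurable]:
  "(dobrushin :: real ^ 'k::finite ^ 'k \<Rightarrow> real) \<in> borel_measurable borel"
  unfolding dobrushin_def[abs_def] by (intro borel_measurable_Max) (auto simp: split_beta)

lemma borel_measurable_matrix_mult [measurable]:
  "(\<lambda>(R, Q). R ** Q) \<in> (borel :: (real ^ 'k::finite ^ 'k) measure) \<Otimes>\<^sub>M borel \<rightarrow>\<^sub>M (borel :: (real ^ 'k ^ 'k) measure)"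
  unfolding borel_prod
  by (intro borel_measurable_continuous_onI) (auto simp: matrix_matrix_mult_def split_beta intro!: continuous_intros)

lemma col_stochastic_borel [measurable]: "(col_stochastic :: (real ^ 'k::finite ^ 'k) set) \<in> sets borel"
proof -
  have "closed (col_stochastic :: (real ^ 'k ^ 'k) set)"
    unfolding col_stochastic_def
    by (intro closed_Collect_conj closed_Collect_all closed_Collect_le closed_Collect_eq
        continuous_intros)
  then show ?thesis by (rule borel_closed)
qed

section \<open>Products of independent stochastic matrices\<close>

text \<open>The function \<open>- ln\<close> cut off at 0 for \<open>x \<ge> 1\<close> and infinite
  for \<open>x \<le> 0\<close>. Values in \<open>ennreal\<close> let its integrals be formed before
  they are known to be finite.\<close>

definition neglog :: "real \<Rightarrow> ennreal" where
  "neglog x = (if x \<le> 0 then \<infinity> else ennreal (- ln x))"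

lemma neglog_1 [simp]: "neglog 1 = 0"
  by (simp add: neglog_def)

lemma neglog_antimono: "x \<le> y \<Longrightarrow> neglog y \<le> neglog x"
  by (auto simp: neglog_def ennreal_leI)

lemma neglog_mult:
  assumes "0 \<le> x" "x \<le> 1" "0 \<le> y" "y \<le> 1"
  shows "neglog (x * y) = neglog x + neglog y"
proof (cases "x = 0 \<or> y = 0")
  case True
  then show ?thesis by (auto simp: neglog_def)
next
  case False
  then have "0 < x" "0 < y" using assms by auto
  then show ?thesis using assms by (simp add: neglog_def ln_mult not_le flip: ennreal_plus)
qed

lemma neglog_finite_iff: "neglog x < \<infinity> \<longleftrightarrow> 0 < x"
  by (auto simp: neglog_def)

lemma borel_measurable_neglog [measurable]: "neglog \<in> borel_measurable borel"
  unfolding neglog_def[abs_def] by measurable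

lemma measurable_mult_left [measurable]:
  fixes Q :: "real ^ 'k::finite ^ 'k"
  shows "(\<lambda>S :: real ^ 'k ^ 'k. S ** Q) \<in> borel \<rightarrow>\<^sub>M borel"
  using measurable_compose[OF _ borel_measurable_matrix_mult, of "\<lambda>S. (S, Q)" borel] by simp

text \<open>The law of \<open>S_m ** ... ** S_1\<close> for independent factors with law
  \<open>M\<close>, the latest factor standing on the left.\<close>

primrec walk :: "(real ^ 'k::finite ^ 'k) measure \<Rightarrow> nat \<Rightarrow> (real ^ 'k ^ 'k) measure" where
  "walk M 0 = return borel (mat 1)"
| "walk M (Suc m) = distr (M \<Otimes>\<^sub>M walk M m) borel (\<lambda>(S, Q). S ** Q)"

text \<open>The measure lives on all matrices and is stochastic only almost everywhere, so that
  multiplication and the coefficient are measurable for the plain Borel structure.\<close>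

locale stochastic_walk = prob_space M for M :: "(real ^ 'k::finite ^ 'k) measure" +
  assumes sets_M [measurable_cong]: "sets M = sets borel"
    and AE_stochastic: "AE S in M. S \<in> col_stochastic"
begin

lemma sets_walk [simp, measurable_cong]: "sets (walk M m) = sets borel"
  by (cases m) auto

lemma space_walk [simp]: "space (walk M m) = UNIV"
  using sets_eq_imp_space_eq[OF sets_walk] by simp

lemma space_M [simp]: "space M = UNIV"
  using sets_eq_imp_space_eq[OF sets_M] by simp

lemma prob_space_walk: "prob_space (walk M m)"
proof (induction m)
  case 0
  then show ?case by (simp add: prob_space_return)
next
  case (Suc m)
  interpret W: prob_space "walk M m" by fact
  interpret P: pair_prob_space M "walk M m" ..
  show ?case by (simp, intro P.prob_space_distr) measurable
qed

lemma nn_integral_walk_Suc: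
  assumes [measurable]: "h \<in> borel_measurable borel"
  shows "(\<integral>\<^sup>+Q. h Q \<partial>walk M (Suc m)) = (\<integral>\<^sup>+Q. \<integral>\<^sup>+S. h (S ** Q) \<partial>M \<partial>walk M m)"
proof -
  interpret W: prob_space "walk M m" by (rule prob_space_walk)
  interpret P: pair_prob_space M "walk M m" ..
  have [measurable]: "(\<lambda>(S, Q). h (S ** Q)) \<in> borel_measurable (M \<Otimes>\<^sub>M walk M m)"
    using measurable_compose[OF borel_measurable_matrix_mult assms]
    by (subst measurable_cong_sets[OF sets_pair_measure_cong[OF sets_M sets_walk] refl]) (simp add: split_beta')
  have "(\<integral>\<^sup>+Q. h Q \<partial>walk M (Suc m)) = (\<integral>\<^sup>+x. h (case x of (S, Q) \<Rightarrow> S ** Q) \<partial>(M \<Otimes>\<^sub>M walk M m))"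
    by (simp, rule nn_integral_distr) measurable
  also have "\<dots> = (\<integral>\<^sup>+x. (case x of (S, Q) \<Rightarrow> h (S ** Q)) \<partial>(M \<Otimes>\<^sub>M walk M m))"
    by (simp add: split_beta')
  also have "\<dots> = (\<integral>\<^sup>+Q. \<integral>\<^sup>+S. h (S ** Q) \<partial>M \<partial>walk M m)"
    by (subst P.nn_integral_snd[symmetric]) auto
  finally show ?thesis .
qed

lemma measurable_nn_integral_mult [measurable]:
  fixes N :: "(real ^ 'k ^ 'k) measure"
  assumes [measurable]: "h \<in> borel_measurable borel"
    and "sigma_finite_measure N" and N [measurable_cong]: "sets N = sets borel"
  shows "(\<lambda>Q :: real ^ 'k ^ 'k. \<integral>\<^sup>+S. h (S ** Q) \<partial>N) \<in> borel_measurable borel"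
proof -
  interpret N: sigma_finite_measure N by fact
  have m: "(\<lambda>(Q, S). S ** Q) \<in> (borel \<Otimes>\<^sub>M N) \<rightarrow>\<^sub>M (borel :: (real ^ 'k ^ 'k) measure)"
  proof -
    have "(\<lambda>(Q, S). (S, Q)) \<in> ((borel :: (real ^ 'k ^ 'k) measure) \<Otimes>\<^sub>M N) \<rightarrow>\<^sub>M borel \<Otimes>\<^sub>M borel"
      by measurable
    from measurable_compose[OF this borel_measurable_matrix_mult] show ?thesis
      by (simp add: split_beta')
  qed
  have "(\<lambda>(Q, S). h (S ** Q)) \<in> borel_measurable (borel \<Otimes>\<^sub>M N)"
    using measurable_compose[OF m assms(1)] by (simp add: split_beta')
  then show ?thesis by (rule N.borel_measurable_nn_integral)
qed

text \<open>Splits the walk into two independent stretches. The induction peels off the latest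
  factor and reassociates the product.\<close>

lemma nn_integral_walk_add:
  assumes "h \<in> borel_measurable borel"
  shows "(\<integral>\<^sup>+Q. h Q \<partial>walk M (l + m)) = (\<integral>\<^sup>+Q. \<integral>\<^sup>+R. h (R ** Q) \<partial>walk M l \<partial>walk M m)"
  using assms
proof (induction l arbitrary: h)
  case 0
  have [measurable]: "h \<in> borel_measurable borel" by fact
  show ?case by (simp add: nn_integral_return)
next
  case (Suc l)
  have [measurable]: "h \<in> borel_measurable borel" by fact
  have hQ [measurable]: "(\<lambda>R. h (R ** Q)) \<in> borel_measurable borel" for Q :: "real ^ 'k ^ 'k"
    by measurable
  have g: "(\<lambda>T. \<integral>\<^sup>+S. h (S ** T) \<partial>M) \<in> borel_measurable borel"
    by (intro measurable_nn_integral_mult sets_M sigma_finite_measure_axioms) measurable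
  have "(\<integral>\<^sup>+Q. h Q \<partial>walk M (Suc l + m)) = (\<integral>\<^sup>+T. \<integral>\<^sup>+S. h (S ** T) \<partial>M \<partial>walk M (l + m))"
    using nn_integral_walk_Suc[of h "l + m"] by simp
  also have "\<dots> = (\<integral>\<^sup>+Q. \<integral>\<^sup>+R. \<integral>\<^sup>+S. h (S ** (R ** Q)) \<partial>M \<partial>walk M l \<partial>walk M m)"
    by (rule Suc.IH[OF g])
  also have "\<dots> = (\<integral>\<^sup>+Q. \<integral>\<^sup>+R. h (R ** Q) \<partial>walk M (Suc l) \<partial>walk M m)"
    by (subst nn_integral_walk_Suc) (measurable, simp add: matrix_mul_assoc)
  finally show ?case .
qed

lemma AE_walk_stochastic: "AE Q in walk M m. Q \<in> col_stochastic"
proof (induction m)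
  case 0
  show ?case unfolding walk.simps by (subst AE_return) (simp_all add: col_stochastic_mat_1)
next
  case (Suc m)
  let ?h = "indicator (- col_stochastic) :: real ^ 'k ^ 'k \<Rightarrow> ennreal"
  have h: "?h \<in> borel_measurable borel" by measurable
  have "(\<integral>\<^sup>+Q. ?h Q \<partial>walk M (Suc m)) = (\<integral>\<^sup>+Q. \<integral>\<^sup>+S. ?h (S ** Q) \<partial>M \<partial>walk M m)"
    by (rule nn_integral_walk_Suc[OF h])
  also have "\<dots> \<le> (\<integral>\<^sup>+Q. \<integral>\<^sup>+S. 0 \<partial>M \<partial>walk M m)"
  proof (rule nn_integral_mono_AE, use Suc in eventually_elim, rule nn_integral_mono_AE)
    fix Q :: "real ^ 'k ^ 'k" assume Q: "Q \<in> col_stochastic"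
    from AE_stochastic show "AE S in M. ?h (S ** Q) \<le> 0"
      by eventually_elim (simp add: Q col_stochastic_mult)
  qed
  finally have "(\<integral>\<^sup>+Q. ?h Q \<partial>walk M (Suc m)) = 0" by simp
  then have "AE Q in walk M (Suc m). ?h Q = 0"
    by (subst (asm) nn_integral_0_iff_AE) measurable
  then show ?case by eventually_elim (simp add: indicator_def split: if_splits)
qed

lemma nn_integral_walk_1:
  assumes [measurable]: "h \<in> borel_measurable borel"
  shows "(\<integral>\<^sup>+Q. h Q \<partial>walk M 1) = (\<integral>\<^sup>+S. h S \<partial>M)"
proof -
  have "(\<lambda>Q. \<integral>\<^sup>+S. h (S ** Q) \<partial>M) \<in> borel_measurable borel"
    by (intro measurable_nn_integral_mult sets_M sigma_finite_measure_axioms) measurable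
  then show ?thesis
    using nn_integral_walk_Suc[of h 0] by (simp add: nn_integral_return)
qed

text \<open>By \<open>entry_mult_ge\<close> the latest factor alone decides, which makes the bound
  uniform in time. At time 0 the product is the identity, whence \<open>Suc m\<close>.\<close>

lemma emeasure_walk_Suc_le:
  assumes "0 < c"
  shows "emeasure (walk M (Suc m)) {Q. \<exists>a b. Q $ a $ b < c} \<le> emeasure M {S. \<exists>a b. S $ a $ b < c}"
proof -
  let ?B = "{Q :: real ^ 'k ^ 'k. \<exists>a b. Q $ a $ b < c}"
  interpret W: prob_space "walk M m" by (rule prob_space_walk)
  have B [measurable]: "?B \<in> sets borel" by measurable
  have "emeasure (walk M (Suc m)) ?B = (\<integral>\<^sup>+Q. \<integral>\<^sup>+S. indicator ?B (S ** Q) \<partial>M \<partial>walk M m)"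
    by (subst nn_integral_walk_Suc[symmetric]) (auto simp: B)
  also have "\<dots> \<le> (\<integral>\<^sup>+Q. \<integral>\<^sup>+S. indicator ?B S \<partial>M \<partial>walk M m)"
  proof (rule nn_integral_mono_AE, use AE_walk_stochastic[of m] in eventually_elim, rule nn_integral_mono)
    fix Q S :: "real ^ 'k ^ 'k" assume "Q \<in> col_stochastic"
    then show "indicator ?B (S ** Q) \<le> (indicator ?B S :: ennreal)"
      using entry_mult_ge[of Q c S] by (auto simp: indicator_def not_less split: if_splits) (meson not_less)
  qed
  also have "\<dots> = emeasure M ?B"
    using W.emeasure_space_1 by (simp add: B sets_M)
  finally show ?thesis .
qed

lemma integrable_bounded:
  fixes h :: "real ^ 'k ^ 'k \<Rightarrow> real"
  assumes "h \<in> borel_measurable borel" "\<And>Q. Q \<in> col_stochastic \<Longrightarrow> \<bar>h Q\<bar> \<le> B"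
  shows "integrable M h" "integrable (walk M m) h"
proof -
  interpret W: prob_space "walk M m" by (rule prob_space_walk)
  have [measurable]: "h \<in> borel_measurable borel" by fact
  show "integrable M h"
    by (rule integrable_const_bound[where B = B])
      (use AE_stochastic in eventually_elim, use assms(2) in \<open>auto simp: measurable_cong_sets[OF sets_M refl]\<close>)
  show "integrable (walk M m) h"
    by (rule W.integrable_const_bound[where B = B])
      (use AE_walk_stochastic[of m] in eventually_elim, use assms(2) in \<open>auto\<close>)
qed

lemma prod_entry_le_one:
  assumes "Q \<in> col_stochastic" shows "\<bar>\<Prod>i\<in>I. Q $ y i $ x i\<bar> \<le> 1"
  unfolding abs_prod using assms
  by (intro prod_le_1) (auto simp: col_stochastic_nonneg col_stochastic_le_one)

lemma integral_walk_Suc: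
  fixes h :: "real ^ 'k ^ 'k \<Rightarrow> real"
  assumes h [measurable]: "h \<in> borel_measurable borel" and bound: "\<And>Q. Q \<in> col_stochastic \<Longrightarrow> \<bar>h Q\<bar> \<le> B"
  shows "(\<integral>Q. h Q \<partial>walk M (Suc m)) = (\<integral>Q. \<integral>S. h (S ** Q) \<partial>M \<partial>walk M m)"
proof -
  interpret W: prob_space "walk M m" by (rule prob_space_walk)
  interpret P: pair_prob_space M "walk M m" ..
  have mult [measurable]: "(\<lambda>(S, Q). S ** Q) \<in> M \<Otimes>\<^sub>M walk M m \<rightarrow>\<^sub>M borel"
    by (subst measurable_cong_sets[OF sets_pair_measure_cong[OF sets_M sets_walk] refl])
      (rule borel_measurable_matrix_mult)
  have "(\<integral>Q. h Q \<partial>walk M (Suc m)) = (\<integral>x. h (case x of (S, Q) \<Rightarrow> S ** Q) \<partial>(M \<Otimes>\<^sub>M walk M m))"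
    by (simp, rule integral_distr) measurable
  also have "\<dots> = (\<integral>x. (case x of (S, Q) \<Rightarrow> h (S ** Q)) \<partial>(M \<Otimes>\<^sub>M walk M m))"
    by (simp add: split_beta')
  also have "\<dots> = (\<integral>Q. \<integral>S. h (S ** Q) \<partial>M \<partial>walk M m)"
  proof (rule P.integral_snd[symmetric])
    have "integrable (walk M (Suc m)) h" by (rule integrable_bounded[OF assms])
    then have "integrable (distr (M \<Otimes>\<^sub>M walk M m) borel (\<lambda>(S, Q). S ** Q)) h" by simp
    then have "integrable (M \<Otimes>\<^sub>M walk M m) (\<lambda>x. h (case x of (S, Q) \<Rightarrow> S ** Q))"
      by (rule integrable_distr[OF mult])
    then show "integrable (M \<Otimes>\<^sub>M walk M m) (\<lambda>(S, Q). h (S ** Q))"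
      by (simp add: split_beta')
  qed
  finally show ?thesis .
qed

text \<open>Exhibits the law of the chain as a mixture, over the random matrix product
  \<open>Q\<close>, of product measures; all later estimates are made for fixed
  \<open>Q\<close>.\<close>

lemma chain_law_eq_walk:
  assumes "x \<in> states n" "y \<in> states n"
  shows "chain_law (states n) (efcp_transition M n) x m y = (\<integral>Q. (\<Prod>i=1..n. Q $ y i $ x i) \<partial>walk M m)"
  using assms(2)
proof (induction m arbitrary: y)
  case 0
  have "(\<integral>Q. (\<Prod>i=1..n. Q $ y i $ x i) \<partial>walk M 0) = (\<Prod>i=1..n. (mat 1 :: real ^ 'k ^ 'k) $ y i $ x i)"
    unfolding walk.simps by (rule integral_return) auto
  also have "\<dots> = (if y = x then 1 else 0)"
  proof (cases "y = x")
    case False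
    then obtain i where "i \<in> {1..n}" "y i \<noteq> x i"
      using assms(1) 0 unfolding states_def by (metis PiE_ext)
    then show ?thesis using False by (auto simp: mat_def intro!: prod_zero)
  qed (simp add: mat_def)
  finally show ?case by simp
next
  case (Suc m)
  let ?W = "walk M m"
  have [measurable_cong]: "sets M = sets borel" by (rule sets_M)
  have fin: "finite (states n :: (nat \<Rightarrow> 'k) set)" by (simp add: states_def finite_PiE)
  \<comment> \<open>Distributive law: choosing an intermediate label in each coordinate is choosing
    an intermediate state \<open>z\<close>.\<close>
  have expand: "(\<Prod>i=1..n. (S ** Q) $ y i $ x i)
      = (\<Sum>z\<in>states n. (\<Prod>i=1..n. S $ y i $ z i) * (\<Prod>i=1..n. Q $ z i $ x i))" for S Q :: "real ^ 'k ^ 'k"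
    unfolding states_def matrix_matrix_mult_def
    using prod_sum_PiE[of "{1..n}" "\<lambda>_. UNIV" "\<lambda>i c. S $ y i $ c * Q $ c $ x i"]
    by (simp add: prod.distrib)
  have "(\<integral>Q. (\<Prod>i=1..n. Q $ y i $ x i) \<partial>walk M (Suc m))
      = (\<integral>Q. \<integral>S. (\<Prod>i=1..n. (S ** Q) $ y i $ x i) \<partial>M \<partial>?W)"
    by (rule integral_walk_Suc[where B = 1]) (measurable, rule prod_entry_le_one)
  also have "\<dots> = (\<integral>Q. (\<Sum>z\<in>states n. efcp_transition M n z y * (\<Prod>i=1..n. Q $ z i $ x i)) \<partial>?W)"
    unfolding expand efcp_transition_def
    by (intro Bochner_Integration.integral_cong refl)
      (simp add: integrable_bounded(1)[where B = 1] prod_entry_le_one)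
  also have "\<dots> = (\<Sum>z\<in>states n. efcp_transition M n z y * (\<integral>Q. (\<Prod>i=1..n. Q $ z i $ x i) \<partial>?W))"
    by (simp add: integrable_bounded(2)[where B = 1] prod_entry_le_one)
  also have "\<dots> = chain_law (states n) (efcp_transition M n) x (Suc m) y"
    by (simp add: Suc.IH mult.commute)
  finally show ?case by simp
qed

lemma integral_sum_walk:
  "(\<Sum>y\<in>Y. \<integral>Q. (\<Prod>i\<in>I. Q $ u y i $ x i) \<partial>walk M m) = (\<integral>Q. (\<Sum>y\<in>Y. \<Prod>i\<in>I. Q $ u y i $ x i) \<partial>walk M m)"
  by (rule Bochner_Integration.integral_sum[symmetric], rule integrable_bounded(2)[where B = 1])
    (measurable, rule prod_entry_le_one)

end

section \<open>The Lyapunov exponent\<close>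

definition log_contraction :: "(real ^ 'k::finite ^ 'k) measure \<Rightarrow> nat \<Rightarrow> ennreal" where
  "log_contraction M m = (\<integral>\<^sup>+Q. neglog (dobrushin Q) \<partial>walk M m)"

text \<open>The top Lyapunov exponent of the random matrix product on the vectors of total mass zero is
  \<open>- lyapunov M\<close>.\<close>

definition lyapunov :: "(real ^ 'k::finite ^ 'k) measure \<Rightarrow> real" where
  "lyapunov M = (SUP m\<in>{1..}. enn2real (log_contraction M m) / real m)"

section \<open>Moments of the contraction coefficient\<close>

context stochastic_walk
begin

text \<open>Submultiplicativity of the coefficient, combined with the independence of the two
  stretches.\<close>

lemma moment_submultiplicative:
  assumes "0 < s"
  shows "(\<integral>\<^sup>+Q. ennreal (dobrushin Q powr s) \<partial>walk M (l + m))
    \<le> (\<integral>\<^sup>+Q. ennreal (dobrushin Q powr s) \<partial>walk M l) * (\<integral>\<^sup>+Q. ennreal (dobrushin Q powr s) \<partial>walk M m)"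
proof -
  have "(\<integral>\<^sup>+Q. ennreal (dobrushin Q powr s) \<partial>walk M (l + m))
      = (\<integral>\<^sup>+Q. \<integral>\<^sup>+R. ennreal (dobrushin (R ** Q) powr s) \<partial>walk M l \<partial>walk M m)"
    by (rule nn_integral_walk_add) measurable
  also have "\<dots> \<le> (\<integral>\<^sup>+Q. \<integral>\<^sup>+R. ennreal (dobrushin R powr s) * ennreal (dobrushin Q powr s) \<partial>walk M l \<partial>walk M m)"
  proof (rule nn_integral_mono_AE, use AE_walk_stochastic[of m] in eventually_elim, rule nn_integral_mono)
    fix Q R :: "real ^ 'k ^ 'k" assume Q: "Q \<in> col_stochastic"
    have "dobrushin (R ** Q) powr s \<le> (dobrushin R * dobrushin Q) powr s"
      using assms by (intro powr_mono2 dobrushin_mult_le Q dobrushin_nonneg) auto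
    then show "ennreal (dobrushin (R ** Q) powr s) \<le> ennreal (dobrushin R powr s) * ennreal (dobrushin Q powr s)"
      by (simp add: powr_mult dobrushin_nonneg flip: ennreal_mult)
  qed
  also have "\<dots> = (\<integral>\<^sup>+Q. ennreal (dobrushin Q powr s) \<partial>walk M l) * (\<integral>\<^sup>+Q. ennreal (dobrushin Q powr s) \<partial>walk M m)"
    by (simp add: nn_integral_multc nn_integral_cmult)
  finally show ?thesis .
qed

lemma moment_le_one:
  assumes "0 < s"
  shows "(\<integral>\<^sup>+Q. ennreal (dobrushin Q powr s) \<partial>walk M m) \<le> 1"
proof -
  interpret W: prob_space "walk M m" by (rule prob_space_walk)
  have "(\<integral>\<^sup>+Q. ennreal (dobrushin Q powr s) \<partial>walk M m) \<le> (\<integral>\<^sup>+Q. 1 \<partial>walk M m)"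
  proof (rule nn_integral_mono_AE, use AE_walk_stochastic[of m] in eventually_elim)
    fix Q :: "real ^ 'k ^ 'k" assume "Q \<in> col_stochastic"
    then have "dobrushin Q powr s \<le> 1 powr s"
      using assms by (intro powr_mono2 dobrushin_le_one dobrushin_nonneg) auto
    then show "ennreal (dobrushin Q powr s) \<le> 1" by simp
  qed
  then show ?thesis using W.emeasure_space_1 by simp
qed

text \<open>Each full block of length \<open>l\<close> contributes one factor; the remainder
  \<open>r\<close> is absorbed by \<open>moment_le_one\<close>.\<close>

lemma moment_mult_le:
  assumes "0 < s"
  shows "(\<integral>\<^sup>+Q. ennreal (dobrushin Q powr s) \<partial>walk M (j * l + r))
    \<le> (\<integral>\<^sup>+Q. ennreal (dobrushin Q powr s) \<partial>walk M l) ^ j"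
proof (induction j)
  case 0
  then show ?case by (simp add: moment_le_one assms)
next
  case (Suc j)
  have "(\<integral>\<^sup>+Q. ennreal (dobrushin Q powr s) \<partial>walk M (Suc j * l + r))
      \<le> (\<integral>\<^sup>+Q. ennreal (dobrushin Q powr s) \<partial>walk M l) * (\<integral>\<^sup>+Q. ennreal (dobrushin Q powr s) \<partial>walk M (j * l + r))"
    using moment_submultiplicative[OF assms, of l "j * l + r"] by (simp add: add.assoc)
  also have "\<dots> \<le> (\<integral>\<^sup>+Q. ennreal (dobrushin Q powr s) \<partial>walk M l) * (\<integral>\<^sup>+Q. ennreal (dobrushin Q powr s) \<partial>walk M l) ^ j"
    by (intro mult_left_mono Suc) simp
  finally show ?case by simp
qed

end

text \<open>The condition is put on a single entry of \<open>S *v u\<close>: it bounds the loss of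
  \<open>ln\<close> of the norm per factor, and for \<open>u\<close> a unit coordinate vector it
  also shows that the entries of \<open>S\<close> are almost surely nonzero.\<close>

locale log_integrable_walk = stochastic_walk M for M :: "(real ^ 'k::finite ^ 'k) measure" +
  fixes C :: real
  assumes card: "CARD('k) \<ge> 2"
    and C_nonneg: "0 \<le> C"
    and log_bound: "\<And>u a. l1_norm u = 1 \<Longrightarrow> (\<integral>\<^sup>+S. neglog \<bar>(S *v u) $ a\<bar> \<partial>M) \<le> ennreal C"
begin

text \<open>Homogeneity reduces to a vector of norm 1. The hypothesis keeps both factors in the
  range where \<open>neglog\<close> is additive without truncation.\<close>

lemma log_norm_step:
  assumes "l1_norm w \<le> 1"
  shows "(\<integral>\<^sup>+S. neglog (l1_norm (S *v w)) \<partial>M) \<le> neglog (l1_norm w) + ennreal C"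
proof (cases "w = 0")
  case True
  then show ?thesis by (simp add: neglog_def l1_norm_def)
next
  case False
  have [measurable_cong]: "sets M = sets borel" by (rule sets_M)
  define u where "u = (1 / l1_norm w) *\<^sub>R w"
  have pos: "0 < l1_norm w" using False l1_norm_nonneg[of w] l1_norm_eq_0_iff[of w] by linarith
  have u: "l1_norm u = 1" using pos by (simp add: u_def l1_norm_scaleR)
  have w: "w = l1_norm w *\<^sub>R u" using pos by (simp add: u_def)
  have mult: "S *v w = l1_norm w *\<^sub>R (S *v u)" for S
    by (subst w) (simp add: matrix_vector_mult_scaleR)
  \<comment> \<open>Here \<open>undefined\<close> is just some coordinate; any entry is dominated by
    the norm.\<close>
  have "(\<integral>\<^sup>+S. neglog (l1_norm (S *v w)) \<partial>M) \<le> (\<integral>\<^sup>+S. neglog (l1_norm w) + neglog \<bar>(S *v u) $ undefined\<bar> \<partial>M)"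
  proof (rule nn_integral_mono_AE, use AE_stochastic in eventually_elim)
    fix S :: "real ^ 'k ^ 'k" assume S: "S \<in> col_stochastic"
    have "neglog (l1_norm (S *v w)) = neglog (l1_norm w) + neglog (l1_norm (S *v u))"
      unfolding mult l1_norm_scaleR using l1_norm_mult_le[OF S, of u] u assms
      by (simp add: neglog_mult l1_norm_nonneg)
    also have "\<dots> \<le> neglog (l1_norm w) + neglog \<bar>(S *v u) $ undefined\<bar>"
      by (intro add_left_mono neglog_antimono component_le_l1_norm)
    finally show "neglog (l1_norm (S *v w)) \<le> neglog (l1_norm w) + neglog \<bar>(S *v u) $ undefined\<bar>" .
  qed
  also have "\<dots> = neglog (l1_norm w) + (\<integral>\<^sup>+S. neglog \<bar>(S *v u) $ undefined\<bar> \<partial>M)"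
    using emeasure_space_1 by (simp add: nn_integral_add)
  also have "\<dots> \<le> neglog (l1_norm w) + ennreal C"
    by (intro add_left_mono log_bound u)
  finally show ?thesis .
qed

lemma log_norm_walk:
  assumes "l1_norm v \<le> 1"
  shows "(\<integral>\<^sup>+Q. neglog (l1_norm (Q *v v)) \<partial>walk M m) \<le> neglog (l1_norm v) + of_nat m * ennreal C"
proof (induction m)
  case 0
  show ?case unfolding walk.simps by (subst nn_integral_return) auto
next
  case (Suc m)
  interpret W: prob_space "walk M m" by (rule prob_space_walk)
  have "(\<integral>\<^sup>+Q. neglog (l1_norm (Q *v v)) \<partial>walk M (Suc m))
      = (\<integral>\<^sup>+Q. \<integral>\<^sup>+S. neglog (l1_norm ((S ** Q) *v v)) \<partial>M \<partial>walk M m)"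
    by (rule nn_integral_walk_Suc) measurable
  also have "\<dots> \<le> (\<integral>\<^sup>+Q. neglog (l1_norm (Q *v v)) + ennreal C \<partial>walk M m)"
  proof (rule nn_integral_mono_AE, use AE_walk_stochastic[of m] in eventually_elim)
    fix Q :: "real ^ 'k ^ 'k" assume "Q \<in> col_stochastic"
    then have "l1_norm (Q *v v) \<le> 1" using l1_norm_mult_le[of Q v] assms by linarith
    then show "(\<integral>\<^sup>+S. neglog (l1_norm ((S ** Q) *v v)) \<partial>M) \<le> neglog (l1_norm (Q *v v)) + ennreal C"
      using log_norm_step by (simp add: matrix_vector_mul_assoc[symmetric])
  qed
  also have "\<dots> = (\<integral>\<^sup>+Q. neglog (l1_norm (Q *v v)) \<partial>walk M m) + ennreal C"
    using W.emeasure_space_1 by (simp add: nn_integral_add)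
  also have "\<dots> \<le> neglog (l1_norm v) + of_nat m * ennreal C + ennreal C"
    by (intro add_right_mono Suc)
  finally show ?case by (simp add: distrib_right add_ac)
qed

text \<open>Half the difference of two unit coordinate vectors has norm 1, and the norm of its image
  is at most the coefficient. One such vector, available since there are two labels, already bounds
  the mean.\<close>

lemma log_contraction_le: "log_contraction M m \<le> ennreal (real m * C)"
proof -
  obtain a b :: 'k where ab: "a \<noteq> b"
    using card by (metis UNIV_I card_2_iff' card_le_Suc0_iff_eq finite not_numeral_le_zero not_less_eq_eq numeral_2_eq_2)
  define v :: "real ^ 'k" where "v = (1/2) *\<^sub>R (axis a 1 - axis b 1)"
  have "(\<Sum>c\<in>UNIV. \<bar>axis a 1 $ c - axis b 1 $ c\<bar>) = (\<Sum>c\<in>UNIV. (if c = a then 1 else 0) + (if c = b then 1 else (0::real)))"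
    using ab by (intro sum.cong) (auto simp: axis_def)
  also have "\<dots> = 2" by (simp add: sum.distrib)
  finally have v: "l1_norm v = 1"
    unfolding v_def l1_norm_scaleR by (simp add: l1_norm_def)
  have "l1_norm (Q *v v) \<le> dobrushin Q" for Q
    unfolding v_def matrix_vector_mult_scaleR l1_norm_scaleR
    using dobrushin_ge[of Q a b]
    by (simp add: l1_norm_def matrix_vector_mult_diff_distrib matrix_vector_mult_basis column_def)
  then have "log_contraction M m \<le> (\<integral>\<^sup>+Q. neglog (l1_norm (Q *v v)) \<partial>walk M m)"
    unfolding log_contraction_def by (intro nn_integral_mono neglog_antimono)
  also have "\<dots> \<le> of_nat m * ennreal C" using log_norm_walk[of v m] v by simp
  also have "\<dots> = ennreal (real m * C)"
    using C_nonneg by (simp add: ennreal_mult ennreal_of_nat_eq_real_of_nat)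
  finally show ?thesis .
qed

lemma AE_dobrushin_pos: "AE Q in walk M m. 0 < dobrushin Q"
proof -
  have "(\<integral>\<^sup>+Q. neglog (dobrushin Q) \<partial>walk M m) \<noteq> \<infinity>"
    using log_contraction_le[of m] by (auto simp: log_contraction_def top_unique)
  then have "AE Q in walk M m. neglog (dobrushin Q) \<noteq> \<infinity>"
    by (intro nn_integral_PInf_AE) measurable
  then show ?thesis by eventually_elim (metis neglog_finite_iff top.not_eq_extremum infinity_ennreal_def)
qed

text \<open>Passes from \<open>neglog\<close> to the real logarithm; almost sure positivity keeps
  the default value of \<open>ln\<close> at 0 out of the integral.\<close>

lemma ln_dobrushin:
  shows "integrable (walk M m) (\<lambda>Q. - ln (dobrushin Q))"
    and "(\<integral>Q. - ln (dobrushin Q) \<partial>walk M m) = enn2real (log_contraction M m)"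
proof -
  have eq: "(\<integral>\<^sup>+Q. ennreal (- ln (dobrushin Q)) \<partial>walk M m) = log_contraction M m"
    unfolding log_contraction_def
    by (rule nn_integral_cong_AE, use AE_dobrushin_pos[of m] in eventually_elim) (simp add: neglog_def)
  have nn: "AE Q in walk M m. 0 \<le> - ln (dobrushin Q)"
    using AE_dobrushin_pos[of m] AE_walk_stochastic[of m]
    by eventually_elim (simp add: dobrushin_le_one)
  have fin: "log_contraction M m < \<infinity>"
    using log_contraction_le[of m] by (rule le_less_trans) simp
  show "integrable (walk M m) (\<lambda>Q. - ln (dobrushin Q))"
    by (rule integrableI_nonneg) (use nn eq fin in auto)
  show "(\<integral>Q. - ln (dobrushin Q) \<partial>walk M m) = enn2real (log_contraction M m)"
    by (subst integral_eq_nn_integral) (use nn eq in auto)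
qed

text \<open>Taking for \<open>u\<close> the coordinate vector of \<open>b\<close> makes the entry of
  \<open>S *v u\<close> equal to \<open>S $ a $ b\<close>; a finite integral of
  \<open>neglog\<close> excludes the value 0.\<close>

lemma AE_entries_pos: "AE S in M. \<forall>a b. 0 < S $ a $ b"
proof -
  have [measurable_cong]: "sets M = sets borel" by (rule sets_M)
  have "AE S in M. 0 < S $ a $ b" for a b
  proof -
    have "l1_norm (axis b 1 :: real ^ 'k) = (\<Sum>c\<in>UNIV. if c = b then 1 else 0)"
      unfolding l1_norm_def by (intro sum.cong) (auto simp: axis_def)
    then have "(\<integral>\<^sup>+S. neglog \<bar>S $ a $ b\<bar> \<partial>M) \<le> ennreal C"
      using log_bound[of "axis b 1" a] by (simp add: matrix_vector_mult_basis column_def)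
    then have "(\<integral>\<^sup>+S. neglog \<bar>S $ a $ b\<bar> \<partial>M) \<noteq> \<infinity>"
      by (auto simp: top_unique)
    then have "AE S in M. neglog \<bar>S $ a $ b\<bar> \<noteq> \<infinity>"
      by (intro nn_integral_PInf_AE) measurable
    with AE_stochastic show ?thesis
    proof eventually_elim
      fix S :: "real ^ 'k ^ 'k" assume S: "S \<in> col_stochastic" "neglog \<bar>S $ a $ b\<bar> \<noteq> \<infinity>"
      then have "S $ a $ b \<noteq> 0" by (auto simp: neglog_def)
      then show "0 < S $ a $ b" using col_stochastic_nonneg[OF S(1), of a b] by simp
    qed
  qed
  then show ?thesis by (simp add: AE_all_countable)
qed

lemma lyapunov_ge:
  assumes "1 \<le> m" shows "enn2real (log_contraction M m) \<le> lyapunov M * real m"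
proof -
  have "enn2real (log_contraction M m) / real m \<le> C" if "1 \<le> m" for m
    using enn2real_mono[OF log_contraction_le[of m]] that C_nonneg by (simp add: pos_divide_le_eq mult.commute)
  then have "enn2real (log_contraction M m) / real m \<le> lyapunov M"
    unfolding lyapunov_def using assms by (intro cSUP_upper bdd_aboveI2[where M = C]) auto
  then show ?thesis using assms by (simp add: pos_divide_le_eq)
qed

lemma lyapunov_approx:
  assumes "\<mu> < lyapunov M"
  obtains l where "1 \<le> l" "\<mu> * real l < enn2real (log_contraction M l)"
proof -
  have "\<exists>l\<in>{1..}. \<mu> < enn2real (log_contraction M l) / real l"
  proof (rule ccontr)
    assume "\<not> ?thesis"
    then have "lyapunov M \<le> \<mu>"
      unfolding lyapunov_def by (intro cSUP_least) (auto simp: not_less)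
    then show False using assms by simp
  qed
  then obtain l where "1 \<le> l" "\<mu> < enn2real (log_contraction M l) / real l" by auto
  then show thesis by (intro that[of l]) (auto simp: pos_less_divide_eq)
qed

text \<open>Already the first normalised mean is positive: positive entries force the coefficient
  below 1 almost surely.\<close>

lemma lyapunov_pos: "0 < lyapunov M"
proof -
  have [measurable_cong]: "sets M = sets borel" by (rule sets_M)
  have "log_contraction M 1 \<noteq> 0"
  proof
    assume "log_contraction M 1 = 0"
    then have "(\<integral>\<^sup>+S. neglog (dobrushin S) \<partial>M) = 0"
      unfolding log_contraction_def by (subst (asm) nn_integral_walk_1) auto
    then have "AE S in M. neglog (dobrushin S) = 0"
      by (subst (asm) nn_integral_0_iff_AE) measurable
    with AE_stochastic AE_entries_pos have "AE S in M. False"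
    proof eventually_elim
      fix S :: "real ^ 'k ^ 'k"
      assume S: "S \<in> col_stochastic" "\<forall>a b. 0 < S $ a $ b" "neglog (dobrushin S) = 0"
      then have "0 < dobrushin S" "dobrushin S < 1"
        by (auto simp: neglog_def dobrushin_less_one split: if_splits)
      then show False using S(3) by (simp add: neglog_def ennreal_eq_0_iff)
    qed
    then show False using emeasure_space_1 by (simp add: AE_iff_measurable[OF _ refl])
  qed
  moreover have "log_contraction M 1 < \<infinity>"
    using log_contraction_le[of 1] by (rule le_less_trans) simp
  ultimately have "0 < enn2real (log_contraction M 1)"
    by (simp add: enn2real_positive_iff zero_less_iff_neq_zero)
  then show ?thesis using lyapunov_ge[of 1] by simp
qed

end

text \<open>The derivative of \<open>t \<mapsto> x powr t\<close> at 0, up to sign, along the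
  sequence \<open>1 / Suc i\<close>.\<close>

lemma difference_quotient_powr:
  fixes x :: real
  assumes "0 < x"
  shows "(\<lambda>i. (1 - x powr (1 / real (Suc i))) / (1 / real (Suc i))) \<longlonglongrightarrow> - ln x"
proof -
  have "((\<lambda>t. exp (t * ln x)) has_field_derivative ln x) (at 0)"
    by (auto intro!: derivative_eq_intros)
  then have "(\<lambda>t. (exp (t * ln x) - 1) / t) \<midarrow>0\<rightarrow> ln x"
    by (simp add: DERIV_def)
  moreover have "filterlim (\<lambda>i. 1 / real (Suc i)) (at 0) sequentially"
    using lim_1_over_n[THEN LIMSEQ_Suc] by (auto simp: filterlim_at)
  ultimately have "(\<lambda>i. (exp (1 / real (Suc i) * ln x) - 1) / (1 / real (Suc i))) \<longlonglongrightarrow> ln x"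
    by (rule filterlim_compose)
  then have "(\<lambda>i. - ((exp (1 / real (Suc i) * ln x) - 1) / (1 / real (Suc i)))) \<longlonglongrightarrow> - ln x"
    by (rule tendsto_minus)
  then show ?thesis using assms by (simp only: minus_divide_left minus_diff_eq powr_def) simp
qed

section \<open>Tails of the contraction coefficient\<close>

context log_integrable_walk
begin

text \<open>Differentiation of the moment at order 0: \<open>(1 - D powr s) / s\<close> tends to
  \<open>- ln D\<close> and is dominated by it, because \<open>1 + x \<le> exp x\<close>. Hence for
  some small \<open>s\<close> the moment is at most \<open>1 - s * \<mu>\<close>, which is at most
  \<open>exp (- s * \<mu>)\<close>.\<close>

lemma moment_exponent:
  assumes "\<mu> < enn2real (log_contraction M l)"
  obtains s where "0 < s" "(\<integral>\<^sup>+Q. ennreal (dobrushin Q powr s) \<partial>walk M l) \<le> ennreal (exp (- s * \<mu>))"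
proof -
  interpret W: prob_space "walk M l" by (rule prob_space_walk)
  let ?g = "\<lambda>i Q :: real ^ 'k ^ 'k. (1 - dobrushin Q powr (1 / real (Suc i))) / (1 / real (Suc i))"
  have AE: "AE Q in walk M l. 0 < dobrushin Q \<and> dobrushin Q \<le> 1"
    using AE_dobrushin_pos[of l] AE_walk_stochastic[of l] by eventually_elim (simp add: dobrushin_le_one)
  have bound: "norm (?g i Q) \<le> - ln (dobrushin Q)" if "0 < dobrushin Q \<and> dobrushin Q \<le> 1" for i Q
  proof -
    have "1 + 1 / real (Suc i) * ln (dobrushin Q) \<le> exp (1 / real (Suc i) * ln (dobrushin Q))"
      by (rule exp_ge_add_one_self)
    also have "\<dots> = dobrushin Q powr (1 / real (Suc i))"
      using that by (simp add: powr_def)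
    finally have "1 - dobrushin Q powr (1 / real (Suc i)) \<le> - ln (dobrushin Q) * (1 / real (Suc i))"
      by simp
    then have "?g i Q \<le> - ln (dobrushin Q)"
      by (subst pos_divide_le_eq) auto
    moreover have "dobrushin Q powr (1 / real (Suc i)) \<le> 1 powr (1 / real (Suc i))"
      using that by (intro powr_mono2) auto
    then have "0 \<le> ?g i Q" by (intro divide_nonneg_pos) auto
    ultimately show ?thesis by simp
  qed
  have "(\<lambda>i. \<integral>Q. ?g i Q \<partial>walk M l) \<longlonglongrightarrow> (\<integral>Q. - ln (dobrushin Q) \<partial>walk M l)"
  proof (rule integral_dominated_convergence[where w = "\<lambda>Q. - ln (dobrushin Q)"])
    show "AE Q in walk M l. (\<lambda>i. ?g i Q) \<longlonglongrightarrow> - ln (dobrushin Q)"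
      using AE by eventually_elim (rule difference_quotient_powr, simp)
    show "AE Q in walk M l. norm (?g i Q) \<le> - ln (dobrushin Q)" for i
      using AE by eventually_elim (rule bound)
  qed (measurable, rule ln_dobrushin)
  then have "\<forall>\<^sub>F i in sequentially. \<mu> < (\<integral>Q. ?g i Q \<partial>walk M l)"
    unfolding ln_dobrushin(2) by (rule order_tendstoD(1)) (rule assms)
  then obtain i where i: "\<mu> < (\<integral>Q. ?g i Q \<partial>walk M l)"
    by (auto simp: eventually_sequentially)
  define s where "s = 1 / real (Suc i)"
  have s: "0 < s" by (simp add: s_def)
  have int: "integrable (walk M l) (\<lambda>Q. dobrushin Q powr s)"
  proof (rule integrable_bounded(2))
    show "\<bar>dobrushin Q powr s\<bar> \<le> 1" if "Q \<in> col_stochastic" for Q :: "real ^ 'k ^ 'k"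
      using powr_mono2[of s "dobrushin Q" 1] s dobrushin_nonneg[of Q] dobrushin_le_one[OF that] by simp
  qed measurable
  have "(\<integral>Q. ?g i Q \<partial>walk M l) = (1 - (\<integral>Q. dobrushin Q powr s \<partial>walk M l)) / s"
    unfolding s_def[symmetric] using int by (simp add: W.prob_space[simplified])
  then have "\<mu> < (1 - (\<integral>Q. dobrushin Q powr s \<partial>walk M l)) / s" using i by simp
  then have "(\<integral>Q. dobrushin Q powr s \<partial>walk M l) \<le> 1 + - s * \<mu>"
    using s by (simp add: field_simps)
  also have "\<dots> \<le> exp (- s * \<mu>)" by (rule exp_ge_add_one_self)
  finally have "(\<integral>\<^sup>+Q. ennreal (dobrushin Q powr s) \<partial>walk M l) \<le> ennreal (exp (- s * \<mu>))"
    using int by (subst nn_integral_eq_integral) (auto intro: ennreal_leI)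
  then show thesis using that s by blast
qed

text \<open>Chernoff's bound with the moment of a small order of the coefficient over long blocks.\<close>

lemma dobrushin_upper:
  assumes "\<mu> < lyapunov M"
  shows "(\<lambda>m. measure (walk M m) {Q. exp (- \<mu> * real m) < dobrushin Q}) \<longlonglongrightarrow> 0"
proof -
  \<comment> \<open>Room between \<open>\<mu>\<close> and \<open>\<nu>\<close> leaves the decay rate
    \<open>s * (\<nu> - \<mu>)\<close> after Markov's inequality.\<close>
  obtain \<nu> where \<nu>: "\<mu> < \<nu>" "\<nu> < lyapunov M" using dense[OF assms] by blast
  obtain l where l: "1 \<le> l" "\<nu> * real l < enn2real (log_contraction M l)"
    by (rule lyapunov_approx[OF \<nu>(2)])
  obtain s where s: "0 < s"
    "(\<integral>\<^sup>+Q. ennreal (dobrushin Q powr s) \<partial>walk M l) \<le> ennreal (exp (- s * (\<nu> * real l)))"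
    by (rule moment_exponent[OF l(2)])
  \<comment> \<open>Pays for the incomplete last block, shorter than \<open>l\<close>; the absolute
    value is taken because no sign of \<open>\<nu>\<close> is assumed.\<close>
  define K where "K = s * \<bar>\<nu>\<bar> * real l"
  have bound: "measure (walk M m) {Q. exp (- \<mu> * real m) < dobrushin Q} \<le> exp (K - s * (\<nu> - \<mu>) * real m)" for m
  proof -
    interpret W: prob_space "walk M m" by (rule prob_space_walk)
    let ?E = "{Q :: real ^ 'k ^ 'k. exp (- \<mu> * real m) < dobrushin Q}"
    have E [measurable]: "?E \<in> sets borel" by measurable
    have m: "m = (m div l) * l + m mod l" by simp
    have "(\<integral>\<^sup>+Q. ennreal (dobrushin Q powr s) \<partial>walk M m) \<le> (\<integral>\<^sup>+Q. ennreal (dobrushin Q powr s) \<partial>walk M l) ^ (m div l)"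
      by (subst m, rule moment_mult_le[OF s(1)])
    also have "\<dots> \<le> ennreal (exp (- s * (\<nu> * real l))) ^ (m div l)"
      by (intro power_mono s(2)) simp
    also have "\<dots> = ennreal (exp (- s * \<nu> * real (m div l * l)))"
      by (simp add: ennreal_power exp_of_nat_mult[symmetric] algebra_simps)
    also have "\<dots> \<le> ennreal (exp (K - s * \<nu> * real m))"
    proof -
      have split: "real m = real (m div l * l) + real (m mod l)" by (subst m) (simp only: of_nat_add)
      have "\<nu> * real (m mod l) \<le> \<bar>\<nu>\<bar> * real (m mod l)" by (intro mult_right_mono) auto
      also have "\<dots> \<le> \<bar>\<nu>\<bar> * real l"
        using mod_less_divisor[of l m] l(1) by (intro mult_left_mono) auto
      finally have "\<nu> * real m \<le> \<bar>\<nu>\<bar> * real l + \<nu> * real (m div l * l)"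
        by (simp only: split distrib_left)
      then have "s * (\<nu> * real m) \<le> s * (\<bar>\<nu>\<bar> * real l + \<nu> * real (m div l * l))"
        using s(1) by (intro mult_left_mono) auto
      then have "- s * \<nu> * real (m div l * l) \<le> K - s * \<nu> * real m"
        by (simp add: K_def distrib_left mult.assoc)
      then show ?thesis by (intro ennreal_leI) (simp only: exp_le_cancel_iff)
    qed
    finally have moment: "(\<integral>\<^sup>+Q. ennreal (dobrushin Q powr s) \<partial>walk M m) \<le> ennreal (exp (K - s * \<nu> * real m))" .
    have "emeasure (walk M m) ?E = (\<integral>\<^sup>+Q. indicator ?E Q \<partial>walk M m)"
      by (simp add: E)
    also have "\<dots> \<le> (\<integral>\<^sup>+Q. ennreal (exp (s * \<mu> * real m)) * ennreal (dobrushin Q powr s) \<partial>walk M m)"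
    proof (rule nn_integral_mono)
      fix Q :: "real ^ 'k ^ 'k"
      have "1 \<le> exp (s * \<mu> * real m) * dobrushin Q powr s" if "Q \<in> ?E"
      proof -
        have "exp (- \<mu> * real m) powr s \<le> dobrushin Q powr s"
          using that s(1) by (intro powr_mono2) auto
        then have "exp (s * \<mu> * real m) * exp (- \<mu> * real m) powr s \<le> exp (s * \<mu> * real m) * dobrushin Q powr s"
          by (intro mult_left_mono) auto
        then show ?thesis by (simp add: powr_def algebra_simps flip: exp_add)
      qed
      then show "indicator ?E Q \<le> ennreal (exp (s * \<mu> * real m)) * ennreal (dobrushin Q powr s)"
        by (auto simp: indicator_def simp flip: ennreal_mult)
    qed
    also have "\<dots> \<le> ennreal (exp (s * \<mu> * real m)) * ennreal (exp (K - s * \<nu> * real m))"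
      by (subst nn_integral_cmult) (auto intro: mult_left_mono moment)
    also have "\<dots> = ennreal (exp (K - s * (\<nu> - \<mu>) * real m))"
      by (simp add: algebra_simps flip: ennreal_mult exp_add)
    finally show ?thesis by (simp add: W.emeasure_eq_measure)
  qed
  have "(\<lambda>m. exp (K - c * real m)) \<longlonglongrightarrow> 0" if "0 < c" for c
    using that by real_asymp
  from this[of "s * (\<nu> - \<mu>)"] have "(\<lambda>m. exp (K - s * (\<nu> - \<mu>) * real m)) \<longlonglongrightarrow> 0"
    using s \<nu> by simp
  then show ?thesis
    by (rule Lim_null_comparison[OF always_eventually[OF allI], rotated]) (use bound in simp)
qed

lemma dobrushin_lower:
  assumes "lyapunov M < \<mu>"
  shows "(\<lambda>m. measure (walk M m) {Q. dobrushin Q < exp (- \<mu> * real m)}) \<longlonglongrightarrow> 0"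
proof (rule order_tendstoI)
  fix e :: real assume "e < 0"
  then show "\<forall>\<^sub>F m in sequentially. e < measure (walk M m) {Q. dobrushin Q < exp (- \<mu> * real m)}"
    by (auto intro!: always_eventually less_le_trans[OF _ measure_nonneg])
next
  fix e :: real assume "0 < e"
  let ?\<Lambda> = "lyapunov M"
  let ?U = "\<lambda>\<nu> m. {Q :: real ^ 'k ^ 'k. exp (- \<nu> * real m) < dobrushin Q}"
  let ?L = "\<lambda>m. {Q :: real ^ 'k ^ 'k. dobrushin Q < exp (- \<mu> * real m)}"
  \<comment> \<open>So close to the exponent that the gap \<open>?\<Lambda> - \<nu>\<close>, divided
    by \<open>\<mu> - ?\<Lambda>\<close>, stays below \<open>e / 2\<close>.\<close>
  obtain \<nu> where \<nu>: "max 0 (?\<Lambda> - e / 2 * (\<mu> - ?\<Lambda>)) < \<nu>" "\<nu> < ?\<Lambda>"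
    using dense[of "max 0 (?\<Lambda> - e / 2 * (\<mu> - ?\<Lambda>))" ?\<Lambda>] lyapunov_pos \<open>0 < e\<close> assms by auto
  have bound: "(\<mu> - ?\<Lambda>) * measure (walk M m) (?L m) \<le> ?\<Lambda> - \<nu> + \<nu> * measure (walk M m) (?U \<nu> m)" if m: "1 \<le> m" for m
  proof -
    interpret W: prob_space "walk M m" by (rule prob_space_walk)
    have [measurable]: "?L m \<in> sets borel" "?U \<nu> m \<in> sets borel" by measurable
    \<comment> \<open>A step function below \<open>- ln (dobrushin Q)\<close>: 0 on
      \<open>?U\<close>, \<open>\<mu> * m\<close> on \<open>?L\<close>, and \<open>\<nu> * m\<close>
      elsewhere. Its mean is at most \<open>?\<Lambda> * m\<close>, which bounds the probability of
      \<open>?L\<close> by that of \<open>?U\<close> and the gap.\<close>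
    let ?f = "\<lambda>Q. \<nu> * real m - \<nu> * real m * indicator (?U \<nu> m) Q + (\<mu> - \<nu>) * real m * indicator (?L m) Q"
    have "(\<integral>Q. ?f Q \<partial>walk M m) \<le> (\<integral>Q. - ln (dobrushin Q) \<partial>walk M m)"
    proof (rule integral_mono_AE)
      show "integrable (walk M m) ?f"
        by (intro Bochner_Integration.integrable_add Bochner_Integration.integrable_diff integrable_mult_right W.integrable_const)
          (auto intro!: integrable_bounded(2)[where B = 1])
      show "integrable (walk M m) (\<lambda>Q. - ln (dobrushin Q))" by (rule ln_dobrushin)
      show "AE Q in walk M m. ?f Q \<le> - ln (dobrushin Q)"
        using AE_dobrushin_pos[of m] AE_walk_stochastic[of m]
      proof eventually_elim
        fix Q :: "real ^ 'k ^ 'k"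
        assume Q: "0 < dobrushin Q" "Q \<in> col_stochastic"
        have ln: "0 \<le> - ln (dobrushin Q)" using Q by (simp add: dobrushin_le_one)
        have U: "Q \<in> ?U \<nu> m \<longleftrightarrow> - ln (dobrushin Q) < \<nu> * real m"
          using Q by (simp add: ln_less_cancel_iff[symmetric, of "exp _"] del: ln_less_cancel_iff) linarith
        have L: "Q \<in> ?L m \<longleftrightarrow> \<mu> * real m < - ln (dobrushin Q)"
          using Q by (simp add: ln_less_cancel_iff[symmetric, of _ "exp _"] del: ln_less_cancel_iff) linarith
        have "\<nu> * real m \<le> \<mu> * real m" using \<nu> assms by (intro mult_right_mono) auto
        then show "?f Q \<le> - ln (dobrushin Q)"
          unfolding indicator_def U L using ln by (auto simp: algebra_simps)
      qed
    qed
    also have "\<dots> \<le> ?\<Lambda> * real m" unfolding ln_dobrushin by (rule lyapunov_ge[OF m])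
    also have "(\<integral>Q. ?f Q \<partial>walk M m) = \<nu> * real m - \<nu> * real m * measure (walk M m) (?U \<nu> m) + (\<mu> - \<nu>) * real m * measure (walk M m) (?L m)"
      using integrable_bounded(2)[of "indicator (?L m)" 1 m] integrable_bounded(2)[of "indicator (?U \<nu> m)" 1 m]
      by (simp add: W.prob_space[simplified])
    also have "\<dots> = (\<nu> - \<nu> * measure (walk M m) (?U \<nu> m) + (\<mu> - \<nu>) * measure (walk M m) (?L m)) * real m"
      by (simp add: algebra_simps)
    finally have "\<nu> - \<nu> * measure (walk M m) (?U \<nu> m) + (\<mu> - \<nu>) * measure (walk M m) (?L m) \<le> ?\<Lambda>"
      using m by simp
    moreover have "(\<mu> - ?\<Lambda>) * measure (walk M m) (?L m) \<le> (\<mu> - \<nu>) * measure (walk M m) (?L m)"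
      using \<nu> by (intro mult_right_mono) auto
    ultimately show ?thesis by linarith
  qed
  have "(\<lambda>m. ?\<Lambda> - \<nu> + \<nu> * measure (walk M m) (?U \<nu> m)) \<longlonglongrightarrow> ?\<Lambda> - \<nu> + \<nu> * 0"
    by (intro tendsto_intros dobrushin_upper \<nu>)
  moreover have "?\<Lambda> - \<nu> + \<nu> * 0 < (\<mu> - ?\<Lambda>) * e"
  proof -
    have "?\<Lambda> - \<nu> < e / 2 * (\<mu> - ?\<Lambda>)" using \<nu> by simp
    also have "\<dots> \<le> e * (\<mu> - ?\<Lambda>)" using \<open>0 < e\<close> assms by (intro mult_right_mono) auto
    finally show ?thesis by (simp add: mult.commute)
  qed
  ultimately have "\<forall>\<^sub>F m in sequentially. ?\<Lambda> - \<nu> + \<nu> * measure (walk M m) (?U \<nu> m) < (\<mu> - ?\<Lambda>) * e"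
    by (rule order_tendstoD(2))
  then show "\<forall>\<^sub>F m in sequentially. measure (walk M m) (?L m) < e"
    using eventually_ge_at_top[of 1]
  proof eventually_elim
    case (elim m)
    then have "(\<mu> - ?\<Lambda>) * measure (walk M m) (?L m) < (\<mu> - ?\<Lambda>) * e"
      using bound[of m] by linarith
    then show ?case using assms by (simp add: mult_less_cancel_left_pos)
  qed
qed

end

section \<open>Logarithmic integrability from the density\<close>

text \<open>A singularity that dominates all powers of the logarithm near 0 and is still integrable
  at the zero of an affine function on the line.\<close>

definition inv_sqrt :: "real \<Rightarrow> ennreal" where
  "inv_sqrt x = (if x \<le> 0 then \<infinity> else ennreal (x powr (- 1 / 2)))"

lemma borel_measurable_inv_sqrt [measurable]: "inv_sqrt \<in> borel_measurable borel"
  unfolding inv_sqrt_def[abs_def] by measurable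

lemma inv_sqrt_antimono: "x \<le> y \<Longrightarrow> inv_sqrt y \<le> inv_sqrt x"
  by (auto simp: inv_sqrt_def intro!: ennreal_leI powr_mono2')

lemma nn_integral_inv_sqrt_ball:
  assumes "0 < d"
  shows "(\<integral>\<^sup>+y. inv_sqrt (d * \<bar>y\<bar>) * indicator {-1..1} y \<partial>lborel) < \<infinity>"
proof -
  define g :: "real \<Rightarrow> ennreal" where "g y = ennreal (d powr (-1/2)) * ennreal (indicator {0..1} y * y powr (-1/2))" for y
  have [measurable]: "g \<in> borel_measurable borel" unfolding g_def[abs_def] by measurable
  have "((\<lambda>x. x powr (-1/2)) has_integral (1 powr (-1/2 + 1) / (-1/2 + 1))) {0..1::real}"
    by (rule has_integral_powr_from_0) auto
  then have "(\<integral>\<^sup>+y. ennreal (indicator {0..1} y * y powr (-1/2)) \<partial>lborel) = ennreal (1 powr (-1/2 + 1) / (-1/2 + 1))"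
    by (intro nn_integral_has_integral_lebesgue) auto
  then have fin: "(\<integral>\<^sup>+y. g y \<partial>lborel) < \<infinity>"
    unfolding g_def by (subst nn_integral_cmult) (auto simp: ennreal_mult_less_top)
  have "(\<integral>\<^sup>+y. inv_sqrt (d * \<bar>y\<bar>) * indicator {-1..1} y \<partial>lborel) \<le> (\<integral>\<^sup>+y. g y + g (- y) \<partial>lborel)"
  proof (rule nn_integral_mono_AE, use AE_lborel_singleton[of "0::real"] in eventually_elim)
    fix y :: real assume "y \<noteq> 0"
    then show "inv_sqrt (d * \<bar>y\<bar>) * indicator {-1..1} y \<le> g y + g (- y)"
      using assms by (auto simp: inv_sqrt_def g_def indicator_def mult_le_0_iff powr_mult abs_if ennreal_mult[symmetric]
          simp del: ennreal_plus)
  qed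
  also have "\<dots> = (\<integral>\<^sup>+y. g y \<partial>lborel) + (\<integral>\<^sup>+y. g (- y) \<partial>lborel)"
    by (rule nn_integral_add) measurable
  also have "(\<integral>\<^sup>+y. g (- y) \<partial>lborel) = (\<integral>\<^sup>+y. g y \<partial>lborel)"
    by (subst (2) nn_integral_real_affine[where c = "-1" and t = 0]) auto
  also have "(\<integral>\<^sup>+y. g y \<partial>lborel) + (\<integral>\<^sup>+y. g y \<partial>lborel) < \<infinity>"
    using fin by simp
  finally show ?thesis .
qed

text \<open>What matters is uniformity in the position of the zero. Within distance 1 of the zero
  \<open>- \<gamma>\<close> the integral is a translate of a fixed one; farther away the integrand
  is at most \<open>inv_sqrt d\<close> on an interval of length 2.\<close>

lemma nn_integral_inv_sqrt_affine:
  assumes "0 < d"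
  obtains K where "K < \<infinity>"
    "\<And>\<alpha> \<beta>. d \<le> \<bar>\<alpha>\<bar> \<Longrightarrow> (\<integral>\<^sup>+y. inv_sqrt \<bar>\<alpha> * y + \<beta>\<bar> * indicator {-1..1} y \<partial>lborel) \<le> K"
proof
  let ?g = "\<lambda>y. inv_sqrt (d * \<bar>y\<bar>) * indicator {-1..1} y"
  let ?K = "2 * inv_sqrt d + (\<integral>\<^sup>+y. ?g y \<partial>lborel)"
  show "?K < \<infinity>"
    using nn_integral_inv_sqrt_ball[OF assms] assms by (simp add: ennreal_mult_less_top inv_sqrt_def)
  fix \<alpha> \<beta> :: real assume \<alpha>: "d \<le> \<bar>\<alpha>\<bar>"
  define \<gamma> where "\<gamma> = \<beta> / \<alpha>"
  have "(\<integral>\<^sup>+y. inv_sqrt \<bar>\<alpha> * y + \<beta>\<bar> * indicator {-1..1} y \<partial>lborel)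
      \<le> (\<integral>\<^sup>+y. inv_sqrt d * indicator {-1..1} y + ?g (\<gamma> + 1 * y) \<partial>lborel)"
  proof (rule nn_integral_mono)
    fix y :: real
    have "\<alpha> * y + \<beta> = \<alpha> * (\<gamma> + y)" using \<alpha> assms by (auto simp: \<gamma>_def algebra_simps)
    then have "d * \<bar>\<gamma> + y\<bar> \<le> \<bar>\<alpha> * y + \<beta>\<bar>"
      using \<alpha> by (simp add: abs_mult mult_right_mono)
    then have le: "inv_sqrt \<bar>\<alpha> * y + \<beta>\<bar> \<le> inv_sqrt (d * \<bar>\<gamma> + y\<bar>)"
      by (rule inv_sqrt_antimono)
    show "inv_sqrt \<bar>\<alpha> * y + \<beta>\<bar> * indicator {-1..1} y \<le> inv_sqrt d * indicator {-1..1} y + ?g (\<gamma> + 1 * y)"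
    proof (cases "\<gamma> + y \<in> {-1..1}")
      case True
      then show ?thesis using le by (auto simp: indicator_def intro: add_increasing)
    next
      case False
      then have "d * 1 \<le> d * \<bar>\<gamma> + y\<bar>" using assms by (intro mult_left_mono) auto
      then have "inv_sqrt (d * \<bar>\<gamma> + y\<bar>) \<le> inv_sqrt d" by (intro inv_sqrt_antimono) simp
      with le have "inv_sqrt \<bar>\<alpha> * y + \<beta>\<bar> \<le> inv_sqrt d" by (rule order_trans)
      then have "inv_sqrt \<bar>\<alpha> * y + \<beta>\<bar> * indicator {-1..1} y \<le> inv_sqrt d * indicator {-1..1} y"
        by (rule mult_right_mono) simp
      then show ?thesis by (rule order_trans) simp
    qed
  qed
  also have "\<dots> = inv_sqrt d * 2 + (\<integral>\<^sup>+y. ?g (\<gamma> + 1 * y) \<partial>lborel)"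
    by (subst nn_integral_add) (auto simp: nn_integral_cmult)
  also have "(\<integral>\<^sup>+y. ?g (\<gamma> + 1 * y) \<partial>lborel) = (\<integral>\<^sup>+y. ?g y \<partial>lborel)"
    by (subst nn_integral_real_affine[where c = 1 and t = \<gamma> and f = ?g]) auto
  finally show "(\<integral>\<^sup>+y. inv_sqrt \<bar>\<alpha> * y + \<beta>\<bar> * indicator {-1..1} y \<partial>lborel) \<le> ?K"
    by (simp add: mult.commute)
qed

text \<open>Two cases for \<open>L = - ln x\<close>. If \<open>L \<le> y powr (p - 1)\<close>, the
  product is at most \<open>y powr p\<close>; otherwise \<open>y\<close> is bounded by a power of
  \<open>L\<close> and the product by \<open>L powr q\<close>, a power of the logarithm.\<close>

lemma young_neglog:
  fixes y x p :: real
  assumes "1 < p" "0 \<le> y"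
  defines "q \<equiv> p / (p - 1)"
  shows "ennreal y * neglog x \<le> ennreal (y powr p) + ennreal ((2 * q) powr q) * inv_sqrt x"
proof -
  have q: "0 < q" "q = 1 + 1 / (p - 1)" using assms by (auto simp: q_def field_simps)
  consider "x \<le> 0" | "1 \<le> x" | "0 < x" "x < 1" by linarith
  then show ?thesis
  proof cases
    case 1
    then have "ennreal ((2 * q) powr q) * inv_sqrt x = \<infinity>" using q by (simp add: inv_sqrt_def ennreal_mult_eq_top_iff)
    then show ?thesis by simp
  next
    case 2
    then show ?thesis by (simp add: neglog_def ennreal_neg)
  next
    case 3
    define L where "L = - ln x"
    have L: "0 < L" using 3 by (simp add: L_def)
    have "y * L \<le> y powr p + (2 * q) powr q * x powr (-1/2)"
    proof (cases "L \<le> y powr (p - 1)")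
      case True
      then have "y * L \<le> y * y powr (p - 1)" by (intro mult_left_mono \<open>0 \<le> y\<close>)
      also have "\<dots> = y powr p"
        using assms by (cases "y = 0") (simp_all add: powr_diff)
      also have "\<dots> \<le> y powr p + (2 * q) powr q * x powr (-1/2)" by simp
      finally show ?thesis .
    next
      case False
      have "y \<le> L powr (1 / (p - 1))"
      proof -
        have "(y powr (p - 1)) powr (1 / (p - 1)) \<le> L powr (1 / (p - 1))"
          using False assms by (intro powr_mono2) auto
        then show ?thesis using assms by (simp add: powr_powr)
      qed
      then have "y * L \<le> L powr (1 / (p - 1)) * L" using L by (intro mult_right_mono) auto
      also have "\<dots> = L powr q" using L by (simp add: q(2) powr_add)
      \<comment> \<open>The logarithm is beaten by \<open>ln z \<le> z - 1\<close> at
        \<open>z = x powr (- 1 / (2 * q))\<close>, an exponent chosen so that the power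
        \<open>q\<close> leaves exactly \<open>x powr (- 1 / 2)\<close>.\<close>
      also have "\<dots> \<le> (2 * q * x powr (- 1 / (2 * q))) powr q"
      proof (rule powr_mono2)
        have "ln (x powr (- 1 / (2 * q))) \<le> x powr (- 1 / (2 * q)) - 1"
          using 3 by (intro ln_le_minus_one) simp
        then have "L / (2 * q) \<le> x powr (- 1 / (2 * q))"
          using 3 by (simp add: ln_powr L_def)
        then show "L \<le> 2 * q * x powr (- 1 / (2 * q))" using q by (simp add: field_simps)
      qed (use q L in auto)
      also have "\<dots> = (2 * q) powr q * x powr (- 1 / 2)"
        using q(1) by (simp add: powr_mult powr_powr)
      finally show ?thesis using powr_ge_zero[of y p] by linarith
    qed
    then have "ennreal (y * L) \<le> ennreal (y powr p + (2 * q) powr q * x powr (-1/2))"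
      by (rule ennreal_leI)
    then show ?thesis
      using 3 \<open>0 \<le> y\<close> L by (simp add: neglog_def inv_sqrt_def L_def[symmetric] ennreal_mult)
  qed
qed

text \<open>Centred at the barycentre, all coordinates of points of the simplex lie in
  \<open>{-1..1}\<close>; enlarging the simplex to this cube gives a product domain for
  Fubini.\<close>

lemma nn_integral_lebesgue_simplex_le:
  fixes G :: "real ^ 'k::finite \<Rightarrow> ennreal"
  assumes [measurable]: "G \<in> borel_measurable borel"
  shows "(\<integral>\<^sup>+s. G s \<partial>lebesgue_simplex)
    \<le> (\<integral>\<^sup>+w. G (barycentre + sum_zero_of_coords w) * (\<Prod>i\<in>- {omitted}. indicator {-1..1} (w i))
        \<partial>Pi\<^sub>M (- {omitted :: 'k}) (\<lambda>_. lborel))"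
proof -
  let ?N = "Pi\<^sub>M (- {omitted :: 'k}) (\<lambda>_. lborel :: real measure)"
  have [measurable]: "prob_simplex \<in> sets (borel :: (real ^ 'k) measure)" by (rule prob_simplex_borel)
  have sz [measurable]: "sum_zero_of_coords \<in> ?N \<rightarrow>\<^sub>M (borel :: (real ^ 'k) measure)" by (rule measurable_sum_zero_of_coords)
  have shift [measurable]: "(\<lambda>v. barycentre + v) \<in> (lebesgue_sum_zero :: (real ^ 'k) measure) \<rightarrow>\<^sub>M borel"
    unfolding lebesgue_sum_zero_def by measurable
  have "(\<integral>\<^sup>+s. G s \<partial>lebesgue_simplex)
      = (\<integral>\<^sup>+s. G s * indicator prob_simplex s \<partial>distr lebesgue_sum_zero borel (\<lambda>v. barycentre + v))"
    unfolding lebesgue_simplex_def by (subst nn_integral_restrict_space) auto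
  also have "\<dots> = (\<integral>\<^sup>+v. G (barycentre + v) * indicator prob_simplex (barycentre + v) \<partial>lebesgue_sum_zero)"
    by (rule nn_integral_distr) measurable
  also have "\<dots> = (\<integral>\<^sup>+w. G (barycentre + sum_zero_of_coords w) * indicator prob_simplex (barycentre + sum_zero_of_coords w) \<partial>?N)"
    unfolding lebesgue_sum_zero_def by (rule nn_integral_distr) measurable
  also have "\<dots> \<le> (\<integral>\<^sup>+w. G (barycentre + sum_zero_of_coords w) * (\<Prod>i\<in>- {omitted}. indicator {-1..1} (w i)) \<partial>?N)"
  proof (intro nn_integral_mono mult_left_mono)
    fix w :: "'k \<Rightarrow> real"
    show "indicator prob_simplex (barycentre + sum_zero_of_coords w) \<le> (\<Prod>i\<in>- {omitted}. indicator {-1..1} (w i) :: ennreal)"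
    proof (cases "barycentre + sum_zero_of_coords w \<in> prob_simplex")
      case True
      let ?s = "barycentre + sum_zero_of_coords w"
      have "w i \<in> {-1..1}" if "i \<in> - {omitted}" for i
      proof -
        have "?s $ i \<le> (\<Sum>i\<in>UNIV. ?s $ i)"
          using True by (intro member_le_sum) (auto simp: prob_simplex_def)
        then have "0 \<le> ?s $ i" "?s $ i \<le> 1" using True by (auto simp: prob_simplex_def)
        moreover have "?s $ i = 1 / real CARD('k) + w i"
          using that by (simp add: barycentre_def sum_zero_of_coords_def)
        moreover have "0 \<le> 1 / real CARD('k)" "1 / real CARD('k) \<le> 1" by (auto simp: divide_le_eq Suc_le_eq)
        ultimately show ?thesis unfolding atLeastAtMost_iff by linarith
      qed
      then show ?thesis by (simp add: indicator_def)
    qed simp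
  qed simp
  finally show ?thesis .
qed

lemma emeasure_lebesgue_simplex_finite:
  "emeasure (lebesgue_simplex :: (real ^ 'k::finite) measure) (space lebesgue_simplex) < \<infinity>"
proof -
  interpret product_sigma_finite "\<lambda>_ :: 'k. lborel :: real measure" ..
  have "emeasure (lebesgue_simplex :: (real ^ 'k) measure) (space lebesgue_simplex) = (\<integral>\<^sup>+s. 1 \<partial>(lebesgue_simplex :: (real ^ 'k) measure))"
    by simp
  also have "\<dots> \<le> (\<integral>\<^sup>+w. 1 * (\<Prod>i\<in>- {omitted :: 'k}. indicator {-1..1} (w i)) \<partial>Pi\<^sub>M (- {omitted :: 'k}) (\<lambda>_. lborel :: real measure))"
    by (rule nn_integral_lebesgue_simplex_le[where G = "\<lambda>_. 1"]) measurable
  also have "\<dots> = (\<Prod>i\<in>- {omitted :: 'k}. \<integral>\<^sup>+y. indicator {-1..1} y \<partial>(lborel :: real measure))"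
    unfolding mult_1 by (rule product_nn_integral_prod) auto
  also have "\<dots> < \<infinity>" by (simp add: power_less_top_ennreal)
  finally show ?thesis .
qed

text \<open>The \<open>a\<close>-th entry of a point of the simplex is, up to sign, one of the coordinates plus a
  function of the other coordinates.\<close>

lemma nn_integral_inv_sqrt_simplex:
  assumes "CARD('k::finite) \<ge> 2" "0 < d"
  obtains K where "K < \<infinity>"
    "\<And>\<alpha> \<beta> a. d \<le> \<bar>\<alpha>\<bar> \<Longrightarrow> (\<integral>\<^sup>+s. inv_sqrt \<bar>\<alpha> * s $ a + \<beta>\<bar> \<partial>(lebesgue_simplex :: (real ^ 'k) measure)) \<le> K"
proof -
  interpret product_sigma_finite "\<lambda>_ :: 'k. lborel :: real measure" ..
  let ?I = "- {omitted :: 'k}"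
  obtain K where K: "K < \<infinity>"
    "\<And>\<alpha> \<beta>. d \<le> \<bar>\<alpha>\<bar> \<Longrightarrow> (\<integral>\<^sup>+y. inv_sqrt \<bar>\<alpha> * y + \<beta>\<bar> * indicator {-1..1} y \<partial>lborel) \<le> K"
    by (rule nn_integral_inv_sqrt_affine[OF assms(2)]) blast
  show thesis
  proof
    show "K * 2 ^ (CARD('k) - 2) < \<infinity>"
      using K(1) by (simp add: ennreal_mult_less_top power_less_top_ennreal)
    fix \<alpha> \<beta> :: real and a :: 'k assume \<alpha>: "d \<le> \<bar>\<alpha>\<bar>"
    \<comment> \<open>The coordinate to integrate first. The omitted entry is minus the sum of all
      coordinates plus a constant, so any \<open>j\<close> serves for it; there is one because of
      the two labels.\<close>
    have "\<exists>j. j \<in> ?I \<and> (a \<noteq> omitted \<longrightarrow> j = a)"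
    proof (cases "a = omitted")
      case True
      have "?I \<noteq> {}"
      proof
        assume "?I = {}"
        then have "UNIV = {omitted :: 'k}" by auto
        then have "CARD('k) = 1" by (metis is_singletonI is_singleton_altdef)
        then show False using assms(1) by simp
      qed
      then show ?thesis using True by blast
    qed auto
    then obtain j where j: "j \<in> ?I" "a \<noteq> omitted \<longrightarrow> j = a" by blast
    define I where "I = ?I - {j}"
    have I: "?I = insert j I" "finite I" "j \<notin> I" using j by (auto simp: I_def)
    have "card ?I = CARD('k) - 1" by (simp add: Compl_eq_Diff_UNIV card_Diff_singleton)
    then have card_I: "card I = CARD('k) - 2" using I by simp
    define \<sigma> :: real where "\<sigma> = (if a = omitted then - 1 else 1)"
    define r where "r w = (if a = omitted then - (\<Sum>i\<in>I. w i) else 0)" for w :: "'k \<Rightarrow> real"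
    have entry: "(barycentre + sum_zero_of_coords w) $ a = 1 / real CARD('k) + \<sigma> * w j + r w" for w
      using j I by (auto simp: barycentre_def sum_zero_of_coords_def \<sigma>_def r_def)
    have r: "r (x(j := y)) = r x" for x y
      unfolding r_def using I by (intro if_cong refl arg_cong[where f = uminus] sum.cong) auto
    have r_meas [measurable]: "r \<in> borel_measurable (Pi\<^sub>M (insert j I) (\<lambda>_. lborel :: real measure))"
      unfolding r_def[abs_def] by measurable
    let ?B = "\<lambda>x. \<alpha> * (1 / real CARD('k) + r x) + \<beta>"
    let ?f = "\<lambda>w. inv_sqrt \<bar>\<alpha> * \<sigma> * w j + ?B w\<bar> * (\<Prod>i\<in>insert j I. indicator {-1..1} (w i))"
    have "(\<integral>\<^sup>+s. inv_sqrt \<bar>\<alpha> * s $ a + \<beta>\<bar> \<partial>(lebesgue_simplex :: (real ^ 'k) measure))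
        \<le> (\<integral>\<^sup>+w. inv_sqrt \<bar>\<alpha> * (barycentre + sum_zero_of_coords w) $ a + \<beta>\<bar> * (\<Prod>i\<in>?I. indicator {-1..1} (w i)) \<partial>Pi\<^sub>M ?I (\<lambda>_. lborel :: real measure))"
      by (rule nn_integral_lebesgue_simplex_le) measurable
    also have "\<dots> = (\<integral>\<^sup>+w. ?f w \<partial>Pi\<^sub>M (insert j I) (\<lambda>_. lborel :: real measure))"
      unfolding I(1) entry by (simp add: algebra_simps)
    also have "\<dots> = (\<integral>\<^sup>+x. \<integral>\<^sup>+y. ?f (x(j := y)) \<partial>lborel \<partial>Pi\<^sub>M I (\<lambda>_. lborel :: real measure))"
      by (rule product_nn_integral_insert[OF I(2,3)]) measurable
    also have "\<dots> \<le> (\<integral>\<^sup>+x. K * (\<Prod>i\<in>I. indicator {-1..1} (x i)) \<partial>Pi\<^sub>M I (\<lambda>_. lborel :: real measure))"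
    proof (rule nn_integral_mono)
      fix x :: "'k \<Rightarrow> real"
      have upd: "(\<Prod>i\<in>I. indicator {-1..1} ((x(j := y)) i)) = (\<Prod>i\<in>I. indicator {-1..1} (x i) :: ennreal)" for y
        using I by (intro prod.cong) auto
      have "(\<integral>\<^sup>+y. ?f (x(j := y)) \<partial>lborel)
          = (\<integral>\<^sup>+y. inv_sqrt \<bar>(\<alpha> * \<sigma>) * y + ?B x\<bar> * indicator {-1..1} y * (\<Prod>i\<in>I. indicator {-1..1} (x i)) \<partial>lborel)"
        unfolding r prod.insert[OF I(2,3)] upd by (simp add: mult.assoc)
      also have "\<dots> = (\<integral>\<^sup>+y. inv_sqrt \<bar>(\<alpha> * \<sigma>) * y + ?B x\<bar> * indicator {-1..1} y \<partial>lborel) * (\<Prod>i\<in>I. indicator {-1..1} (x i))"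
        by (rule nn_integral_multc) measurable
      also have "\<dots> \<le> K * (\<Prod>i\<in>I. indicator {-1..1} (x i))"
        using \<alpha> by (intro mult_right_mono K(2)) (auto simp: \<sigma>_def)
      finally show "(\<integral>\<^sup>+y. ?f (x(j := y)) \<partial>lborel) \<le> K * (\<Prod>i\<in>I. indicator {-1..1} (x i))" .
    qed
    also have "\<dots> = K * (\<integral>\<^sup>+x. (\<Prod>i\<in>I. indicator {-1..1} (x i)) \<partial>Pi\<^sub>M I (\<lambda>_. lborel :: real measure))"
      by (rule nn_integral_cmult) measurable
    also have "(\<integral>\<^sup>+x. (\<Prod>i\<in>I. indicator {-1..1} (x i)) \<partial>Pi\<^sub>M I (\<lambda>_. lborel :: real measure)) = (\<Prod>i\<in>I. \<integral>\<^sup>+y. indicator {-1..1} y \<partial>(lborel :: real measure))"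
      by (rule product_nn_integral_prod) (use I in auto)
    also have "\<dots> = 2 ^ (CARD('k) - 2)" by (simp add: card_I)
    finally show "(\<integral>\<^sup>+s. inv_sqrt \<bar>\<alpha> * s $ a + \<beta>\<bar> \<partial>(lebesgue_simplex :: (real ^ 'k) measure)) \<le> K * 2 ^ (CARD('k) - 2)" .
  qed
qed

text \<open>As a function of the column \<open>b\<close> alone, the entry of \<open>S *v u\<close>
  is affine with slope \<open>u $ b\<close>. By pigeonhole some \<open>b\<close> has slope at least
  \<open>1 / CARD('k)\<close> in modulus; this column is integrated first and the others contribute
  their finite total mass.\<close>

lemma nn_integral_inv_sqrt_stochastic:
  assumes "CARD('k::finite) \<ge> 2"
  obtains K where "K < \<infinity>"
    "\<And>(u :: real ^ 'k) a. l1_norm u = 1 \<Longrightarrow> (\<integral>\<^sup>+S. inv_sqrt \<bar>(S *v u) $ a\<bar> \<partial>lebesgue_stochastic) \<le> K"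
proof -
  let ?M = "lebesgue_simplex :: (real ^ 'k) measure"
  have sf: "sigma_finite_measure ?M"
    by (intro finite_measure.axioms(1) finite_measureI) (use emeasure_lebesgue_simplex_finite[where 'k = 'k] in auto)
  interpret product_sigma_finite "\<lambda>_ :: 'k. ?M"
    by (simp add: product_sigma_finite_def sf)
  have pos: "0 < 1 / real CARD('k)" by simp
  obtain K where K: "K < \<infinity>"
    "\<And>\<alpha> \<beta> a. 1 / real CARD('k) \<le> \<bar>\<alpha>\<bar> \<Longrightarrow> (\<integral>\<^sup>+s. inv_sqrt \<bar>\<alpha> * s $ a + \<beta>\<bar> \<partial>?M) \<le> K"
    by (rule nn_integral_inv_sqrt_simplex[OF assms pos]) blast
  let ?E = "emeasure ?M (space ?M)"
  show thesis
  proof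
    show "K * ?E ^ (CARD('k) - 1) < \<infinity>"
      using K(1) emeasure_lebesgue_simplex_finite[where 'k = 'k] by (simp add: ennreal_mult_less_top power_less_top_ennreal)
    fix u :: "real ^ 'k" and a :: 'k assume u: "l1_norm u = 1"
    have "\<exists>b. 1 / real CARD('k) \<le> \<bar>u $ b\<bar>"
    proof (rule ccontr)
      assume "\<not> ?thesis"
      then have "(\<Sum>b\<in>UNIV. \<bar>u $ b\<bar>) < (\<Sum>b\<in>(UNIV :: 'k set). 1 / real CARD('k))"
        by (intro sum_strict_mono) (auto simp: not_le)
      then show False using u by (simp add: l1_norm_def)
    qed
    then obtain b where b: "1 / real CARD('k) \<le> \<bar>u $ b\<bar>" by blast
    define I where "I = UNIV - {b}"
    have I: "UNIV = insert b I" "finite I" "b \<notin> I" by (auto simp: I_def)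
    let ?h = "\<lambda>S :: real ^ 'k ^ 'k. inv_sqrt \<bar>(S *v u) $ a\<bar>"
    have h: "?h \<in> borel_measurable (restrict_space borel col_stochastic)"
      by (intro measurable_restrict_space1) measurable
    have entry: "(matrix_of_columns c *v u) $ a = (\<Sum>b\<in>UNIV. c b $ a * u $ b)" for c
      by (simp add: matrix_of_columns_def matrix_vector_mult_def)
    have hc: "(\<lambda>c. ?h (matrix_of_columns c)) \<in> borel_measurable (Pi\<^sub>M (UNIV :: 'k set) (\<lambda>_. ?M))"
      by (rule measurable_compose[OF measurable_matrix_of_columns h])
    have "(\<integral>\<^sup>+S. ?h S \<partial>lebesgue_stochastic) = (\<integral>\<^sup>+c. ?h (matrix_of_columns c) \<partial>Pi\<^sub>M UNIV (\<lambda>_. ?M))"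
      unfolding lebesgue_stochastic_def by (rule nn_integral_distr[OF measurable_matrix_of_columns]) (simp add: h)
    also have "\<dots> = (\<integral>\<^sup>+x. \<integral>\<^sup>+s. ?h (matrix_of_columns (x(b := s))) \<partial>?M \<partial>Pi\<^sub>M I (\<lambda>_. ?M))"
      using product_nn_integral_insert[OF I(2,3), of "\<lambda>c. ?h (matrix_of_columns c)"] hc unfolding I(1)[symmetric] by simp
    also have "\<dots> \<le> (\<integral>\<^sup>+x. K \<partial>Pi\<^sub>M I (\<lambda>_. ?M))"
    proof (rule nn_integral_mono)
      fix x :: "'k \<Rightarrow> real ^ 'k"
      have "(\<Sum>b'\<in>UNIV. (x(b := s)) b' $ a * u $ b') = u $ b * s $ a + (\<Sum>b'\<in>I. x b' $ a * u $ b')" for s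
      proof -
        have "(\<Sum>b'\<in>UNIV. (x(b := s)) b' $ a * u $ b') = s $ a * u $ b + (\<Sum>b'\<in>I. (x(b := s)) b' $ a * u $ b')"
          by (subst I(1), subst sum.insert[OF I(2,3)]) simp
        also have "(\<Sum>b'\<in>I. (x(b := s)) b' $ a * u $ b') = (\<Sum>b'\<in>I. x b' $ a * u $ b')"
          using I(3) by (intro sum.cong) auto
        finally show ?thesis by (simp add: mult.commute)
      qed
      then show "(\<integral>\<^sup>+s. ?h (matrix_of_columns (x(b := s))) \<partial>?M) \<le> K"
        unfolding entry using K(2)[OF b] by simp
    qed
    also have "\<dots> = K * ?E ^ (CARD('k) - 1)"
    proof -
      have "emeasure (Pi\<^sub>M I (\<lambda>_. ?M)) (space (Pi\<^sub>M I (\<lambda>_. ?M))) = (\<Prod>i\<in>I. ?E)"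
        unfolding space_PiM by (rule emeasure_PiM[OF I(2)]) auto
      moreover have "card I = CARD('k) - 1" by (simp add: I_def)
      ultimately show ?thesis by simp
    qed
    finally show "(\<integral>\<^sup>+S. ?h S \<partial>lebesgue_stochastic) \<le> K * ?E ^ (CARD('k) - 1)" .
  qed
qed

text \<open>\<open>young_neglog\<close> is applied pointwise with \<open>y\<close> the density and
  \<open>x\<close> the modulus of the entry; both resulting integrals are bounded independently of
  \<open>u\<close> and \<open>a\<close>. The push-forward under the identity replaces the space of
  stochastic matrices by that of all matrices.\<close>

lemma log_integrable_walk_density:
  fixes \<Sigma> :: "(real ^ 'k::finite ^ 'k) measure"
  assumes card: "CARD('k) \<ge> 2" and prob: "prob_space \<Sigma>"
    and sets: "sets \<Sigma> = sets (restrict_space borel col_stochastic)"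
    and p: "p > 1" and f: "f \<in> borel_measurable lebesgue_stochastic"
    and nonneg: "\<And>S. S \<in> col_stochastic \<Longrightarrow> 0 \<le> f S"
    and density: "\<Sigma> = density lebesgue_stochastic (\<lambda>S. ennreal (f S))"
    and int: "integrable lebesgue_stochastic (\<lambda>S. f S powr p)"
  obtains C where "log_integrable_walk (distr \<Sigma> borel (\<lambda>S. S)) C"
proof -
  let ?M = "distr \<Sigma> borel (\<lambda>S. S)" and ?L = "lebesgue_stochastic :: (real ^ 'k ^ 'k) measure"
  have id: "(\<lambda>S. S) \<in> \<Sigma> \<rightarrow>\<^sub>M borel"
    by (subst measurable_cong_sets[OF sets refl]) (intro measurable_restrict_space1, simp)
  have space_L: "space ?L = col_stochastic" by (simp add: lebesgue_stochastic_def space_restrict_space)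
  have sets_L: "sets ?L = sets (restrict_space borel col_stochastic)" by (simp add: lebesgue_stochastic_def)
  have space: "space \<Sigma> = col_stochastic" using sets_eq_imp_space_eq[OF sets] by (simp add: space_restrict_space)
  define q where "q = p / (p - 1)"
  obtain K where K: "K < \<infinity>"
    "\<And>(u :: real ^ 'k) a. l1_norm u = 1 \<Longrightarrow> (\<integral>\<^sup>+S. inv_sqrt \<bar>(S *v u) $ a\<bar> \<partial>?L) \<le> K"
    by (rule nn_integral_inv_sqrt_stochastic[OF card]) blast
  have fin: "(\<integral>\<^sup>+S. ennreal (f S powr p) \<partial>?L) < \<infinity>"
    using int by (subst nn_integral_eq_integral) auto
  let ?C = "(\<integral>\<^sup>+S. ennreal (f S powr p) \<partial>?L) + ennreal ((2 * q) powr q) * K"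
  have C: "?C < \<infinity>" using fin K(1) by (simp add: ennreal_mult_less_top)
  then have C': "ennreal (enn2real ?C) = ?C" by (intro ennreal_enn2real) simp
  have bound: "(\<integral>\<^sup>+S. neglog \<bar>(S *v u) $ a\<bar> \<partial>?M) \<le> ?C" if u: "l1_norm u = 1" for u :: "real ^ 'k" and a
  proof -
    have meas: "(\<lambda>S. h ((S *v u) $ a)) \<in> borel_measurable ?L" if [measurable]: "h \<in> borel_measurable borel" for h :: "real \<Rightarrow> ennreal"
      by (subst measurable_cong_sets[OF sets_L refl]) (intro measurable_restrict_space1, measurable)
    have meas' [measurable]: "(\<lambda>S. neglog \<bar>(S *v u) $ a\<bar>) \<in> borel_measurable ?L" "(\<lambda>S. inv_sqrt \<bar>(S *v u) $ a\<bar>) \<in> borel_measurable ?L"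
      using meas[of "\<lambda>x. neglog \<bar>x\<bar>"] meas[of "\<lambda>x. inv_sqrt \<bar>x\<bar>"] by simp_all
    note [measurable] = f
    have "(\<integral>\<^sup>+S. neglog \<bar>(S *v u) $ a\<bar> \<partial>?M) = (\<integral>\<^sup>+S. neglog \<bar>(S *v u) $ a\<bar> \<partial>\<Sigma>)"
      by (rule nn_integral_distr[OF id]) measurable
    also have "\<dots> = (\<integral>\<^sup>+S. ennreal (f S) * neglog \<bar>(S *v u) $ a\<bar> \<partial>?L)"
      unfolding density by (intro nn_integral_density measurable_compose[OF f measurable_ennreal] meas')
    also have "\<dots> \<le> (\<integral>\<^sup>+S. ennreal (f S powr p) + ennreal ((2 * q) powr q) * inv_sqrt \<bar>(S *v u) $ a\<bar> \<partial>?L)"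
      unfolding q_def by (intro nn_integral_mono young_neglog p nonneg) (simp add: space_L)
    also have "\<dots> = (\<integral>\<^sup>+S. ennreal (f S powr p) \<partial>?L) + ennreal ((2 * q) powr q) * (\<integral>\<^sup>+S. inv_sqrt \<bar>(S *v u) $ a\<bar> \<partial>?L)"
      by (simp add: nn_integral_add nn_integral_cmult)
    also have "\<dots> \<le> ?C" by (intro add_left_mono mult_left_mono K(2) u) simp
    finally show ?thesis .
  qed
  have "log_integrable_walk ?M (enn2real ?C)"
  proof (intro log_integrable_walk.intro stochastic_walk.intro stochastic_walk_axioms.intro log_integrable_walk_axioms.intro)
    show "prob_space ?M" by (rule prob_space.prob_space_distr[OF prob id])
    show "sets ?M = sets borel" by simp
    show "AE S in ?M. S \<in> col_stochastic"
      using col_stochastic_borel by (subst AE_distr_iff[OF id]) (simp, auto simp: space intro!: AE_I2)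
    show "(\<integral>\<^sup>+S. neglog \<bar>(S *v u) $ a\<bar> \<partial>?M) \<le> ennreal (enn2real ?C)" if "l1_norm u = 1" for u a
      unfolding C' by (rule bound[OF that])
  qed (use card in auto)
  then show thesis by (rule that)
qed

section \<open>Cutoff\<close>

declare One_nat_def [simp del]

text \<open>Chebyshev for the difference of the frequencies of \<open>c\<close> in two blocks: a
  coordinate has weight \<open>1 / r\<close>, \<open>- 1 / r\<close> or 0, and the
  \<open>2 * r\<close> nonzero weights give variance at most \<open>2 / r\<close>.\<close>

lemma block_frequency:
  fixes p :: "'i \<Rightarrow> 'k::finite \<Rightarrow> real"
  assumes "finite I" and p: "\<And>i. i \<in> I \<Longrightarrow> (\<Sum>a\<in>UNIV. p i a) = 1"
    and nonneg: "\<And>i a. i \<in> I \<Longrightarrow> 0 \<le> p i a"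
    and AB: "A \<subseteq> I" "B \<subseteq> I" "A \<inter> B = {}" "card A = r" "card B = r" "0 < r"
    and \<alpha>: "\<And>i. i \<in> A \<Longrightarrow> p i c = \<alpha>" and \<beta>: "\<And>i. i \<in> B \<Longrightarrow> p i c = \<beta>"
    and \<tau>: "0 < \<tau>" and T: "T \<subseteq> PiE I (\<lambda>_. UNIV)"
    and dev: "\<And>y. y \<in> T \<Longrightarrow>
      \<tau> \<le> \<bar>((\<Sum>i\<in>A. of_bool (y i = c)) - (\<Sum>i\<in>B. of_bool (y i = c))) / real r - (\<alpha> - \<beta>)\<bar>"
  shows "(\<Sum>y\<in>T. \<Prod>i\<in>I. p i (y i)) \<le> 2 / (real r * \<tau>\<^sup>2)"
proof -
  define w where "w i = (if i \<in> A then 1 / real r else 0) - (if i \<in> B then 1 / real r else 0)" for i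
  define h where "h i a = w i * (of_bool (a = c) - p i c)" for i a
  have IA: "I \<inter> A = A" "I \<inter> B = B" using AB by auto
  have restrict: "(\<Sum>i\<in>I. if i \<in> D then g i else 0) = (\<Sum>i\<in>D. g i)" if "I \<inter> D = D" for D and g :: "'i \<Rightarrow> real"
    using that \<open>finite I\<close> by (simp add: sum.inter_restrict[symmetric])
  have p_le: "p i a \<le> 1" if "i \<in> I" for i a
    using member_le_sum[of a UNIV "p i"] p[OF that] nonneg[OF that] by simp
  have h_sum: "(\<Sum>i\<in>I. h i (y i)) = ((\<Sum>i\<in>A. of_bool (y i = c)) - (\<Sum>i\<in>B. of_bool (y i = c))) / real r - (\<alpha> - \<beta>)" for y
  proof -
    have "(\<Sum>i\<in>I. h i (y i)) = (\<Sum>i\<in>I. if i \<in> A then (of_bool (y i = c) - \<alpha>) / real r else 0)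
        - (\<Sum>i\<in>I. if i \<in> B then (of_bool (y i = c) - \<beta>) / real r else 0)"
      unfolding sum_subtractf[symmetric] using AB(3)
      by (intro sum.cong refl) (auto simp: h_def w_def \<alpha> \<beta>)
    also have "\<dots> = ((\<Sum>i\<in>A. of_bool (y i = c)) - real r * \<alpha>) / real r - ((\<Sum>i\<in>B. of_bool (y i = c)) - real r * \<beta>) / real r"
      unfolding restrict[OF IA(1)] restrict[OF IA(2)] by (simp add: sum_subtractf AB flip: sum_divide_distrib)
    finally show ?thesis using \<open>0 < r\<close> by (simp add: diff_divide_distrib)
  qed
  have "(\<Sum>y\<in>T. \<Prod>i\<in>I. p i (y i)) \<le> (\<Sum>i\<in>I. (w i)\<^sup>2) / \<tau>\<^sup>2"
  proof (rule product_chebyshev[where h = h])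
    show "(\<Sum>a\<in>UNIV. p i a * h i a) = 0" if "i \<in> I" for i
    proof -
      have "(\<Sum>a\<in>UNIV. p i a * h i a) = (\<Sum>a\<in>UNIV. w i * (if a = c then p i a else 0) - w i * p i c * p i a)"
        unfolding h_def by (intro sum.cong refl) (auto simp: algebra_simps)
      also have "\<dots> = 0"
        by (simp add: sum_subtractf p[OF that] of_bool_def flip: sum_distrib_left)
      finally show ?thesis .
    qed
    show "(h i a)\<^sup>2 \<le> (w i)\<^sup>2" if "i \<in> I" for i a
    proof -
      have "\<bar>of_bool (a = c) - p i c\<bar> \<le> 1" using p_le[OF that, of c] nonneg[OF that, of c] by auto
      then have "(of_bool (a = c) - p i c)\<^sup>2 \<le> 1" by (simp add: abs_square_le_1)
      then show ?thesis by (simp add: h_def power_mult_distrib mult_left_le)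
    qed
    show "\<tau> \<le> \<bar>\<Sum>i\<in>I. h i (y i)\<bar>" if "y \<in> T" for y
      unfolding h_sum by (rule dev[OF that])
  qed (use assms in auto)
  also have "(\<Sum>i\<in>I. (w i)\<^sup>2) = (\<Sum>i\<in>I. if i \<in> A then (1 / real r)\<^sup>2 else 0) + (\<Sum>i\<in>I. if i \<in> B then (1 / real r)\<^sup>2 else 0)"
    unfolding sum.distrib[symmetric] using AB(3) by (intro sum.cong refl) (auto simp: w_def)
  also have "\<dots> = 2 / real r"
    unfolding restrict[OF IA(1)] restrict[OF IA(2)] using AB by (simp add: power2_eq_square)
  finally show ?thesis by simp
qed

lemma finite_states: "finite (states n :: (nat \<Rightarrow> 'k::finite) set)"
  by (simp add: states_def finite_PiE)

lemma sum_states_prod: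
  assumes "Q \<in> col_stochastic"
  shows "(\<Sum>y\<in>states n. \<Prod>i=1..n. Q $ y i $ x i) = 1"
  unfolding states_def using assms
  by (intro sum_PiE_one[where p = "\<lambda>i a. Q $ a $ x i"]) (auto simp: col_stochastic_sum)

lemma sum_prod_le_one:
  assumes "Q \<in> col_stochastic" "T \<subseteq> states n"
  shows "(\<Sum>y\<in>T. \<Prod>i=1..n. Q $ y i $ x i) \<le> 1"
proof -
  have "(\<Sum>y\<in>T. \<Prod>i=1..n. Q $ y i $ x i) \<le> (\<Sum>y\<in>states n. \<Prod>i=1..n. Q $ y i $ x i)"
    using assms by (intro sum_mono2 finite_states prod_nonneg) (auto simp: col_stochastic_nonneg)
  then show ?thesis using assms(1) by (simp add: sum_states_prod)
qed

section \<open>The chain conditioned on the matrix product\<close>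

context log_integrable_walk
begin

lemma positive_chain_efcp: "positive_chain (states n) (efcp_transition M n)"
proof
  show "finite (states n :: (nat \<Rightarrow> 'k) set)" by (rule finite_states)
  show "states n \<noteq> ({} :: (nat \<Rightarrow> 'k) set)" by (simp add: states_def PiE_eq_empty_iff)
  fix x y :: "nat \<Rightarrow> 'k"
  let ?f = "\<lambda>S :: real ^ 'k ^ 'k. \<Prod>i=1..n. S $ y i $ x i"
  have int: "integrable M ?f"
    by (rule integrable_bounded(1)[where B = 1]) (measurable, rule prod_entry_le_one)
  have pos: "AE S in M. 0 < ?f S"
    using AE_entries_pos by eventually_elim (auto intro: prod_pos)
  have "(\<integral>S. ?f S \<partial>M) \<noteq> 0"
  proof
    assume "(\<integral>S. ?f S \<partial>M) = 0"
    then have "AE S in M. ?f S = 0"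
      using int pos by (subst (asm) integral_nonneg_eq_0_iff_AE) auto
    with pos have "AE S in M. False" by eventually_elim (metis less_irrefl)
    then show False by simp
  qed
  moreover have "0 \<le> (\<integral>S. ?f S \<partial>M)"
    using pos by (intro integral_nonneg_AE) auto
  ultimately show "0 < efcp_transition M n x y" by (simp add: efcp_transition_def)
next
  fix x :: "nat \<Rightarrow> 'k"
  have "(\<Sum>y\<in>states n. efcp_transition M n x y) = (\<integral>S. (\<Sum>y\<in>states n. \<Prod>i=1..n. S $ y i $ x i) \<partial>M)"
    unfolding efcp_transition_def
    by (rule Bochner_Integration.integral_sum[symmetric], rule integrable_bounded(1)[where B = 1])
      (measurable, rule prod_entry_le_one)
  also have "\<dots> = (\<integral>S. 1 \<partial>M)"
    by (rule integral_cong_AE) (use AE_stochastic in \<open>auto simp: sum_states_prod measurable_cong_sets[OF sets_M refl]\<close>)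
  finally show "(\<Sum>y\<in>states n. efcp_transition M n x y) = 1" by (simp add: prob_space[simplified])
qed

lemma sum_chain_law:
  assumes "x \<in> states n" "T \<subseteq> states n"
  shows "(\<Sum>y\<in>T. chain_law (states n) (efcp_transition M n) x m y)
    = (\<integral>Q. (\<Sum>y\<in>T. \<Prod>i=1..n. Q $ y i $ x i) \<partial>walk M m)"
  unfolding integral_sum_walk[symmetric] using assms by (intro sum.cong refl chain_law_eq_walk) auto

text \<open>For fixed \<open>Q\<close> with small coefficient and entries at least \<open>c\<close>,
  the chi-square bound applies, with \<open>2 * d\<close> since the coefficient is half an l1
  distance. On the two exceptional events the trivial bound 2 is used.\<close>

lemma chain_law_difference_le:
  assumes x: "x \<in> states n" "x' \<in> states n" and "0 < c" "0 \<le> d"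
  shows "(\<Sum>y\<in>states n. \<bar>chain_law (states n) (efcp_transition M n) x m y - chain_law (states n) (efcp_transition M n) x' m y\<bar>)
    \<le> sqrt ((1 + (2 * d)\<^sup>2 / c) ^ n - 1) + 2 * measure (walk M m) {Q. d < dobrushin Q}
      + 2 * measure (walk M m) {Q. \<exists>a b. Q $ a $ b < c}"
proof -
  interpret W: prob_space "walk M m" by (rule prob_space_walk)
  let ?F = "\<lambda>Q :: real ^ 'k ^ 'k. \<lambda>x y. \<Prod>i=1..n. Q $ y i $ x i"
  let ?K = "sqrt ((1 + (2 * d)\<^sup>2 / c) ^ n - 1)"
  let ?D = "{Q :: real ^ 'k ^ 'k. d < dobrushin Q}" and ?E = "{Q :: real ^ 'k ^ 'k. \<exists>a b. Q $ a $ b < c}"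
  have [measurable]: "?D \<in> sets borel" "?E \<in> sets borel" by measurable
  have int: "integrable (walk M m) (\<lambda>Q. ?F Q x y)" for x y
    by (rule integrable_bounded(2)[where B = 1]) (measurable, rule prod_entry_le_one)
  have int_ind: "integrable (walk M m) (indicator A :: _ \<Rightarrow> real)" if [measurable]: "A \<in> sets borel" for A
    by (rule integrable_bounded(2)[where B = 1]) auto
  have K: "0 \<le> ?K" using assms by simp
  have "(\<Sum>y\<in>states n. \<bar>chain_law (states n) (efcp_transition M n) x m y - chain_law (states n) (efcp_transition M n) x' m y\<bar>)
      = (\<Sum>y\<in>states n. \<bar>\<integral>Q. ?F Q x y - ?F Q x' y \<partial>walk M m\<bar>)"
    unfolding Bochner_Integration.integral_diff[OF int int]
    by (intro sum.cong refl arg_cong2[where f = "\<lambda>u v. \<bar>u - v\<bar>"] chain_law_eq_walk x)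
  also have "\<dots> \<le> (\<Sum>y\<in>states n. \<integral>Q. \<bar>?F Q x y - ?F Q x' y\<bar> \<partial>walk M m)"
    by (intro sum_mono integral_abs_bound)
  also have "\<dots> = (\<integral>Q. (\<Sum>y\<in>states n. \<bar>?F Q x y - ?F Q x' y\<bar>) \<partial>walk M m)"
    by (rule Bochner_Integration.integral_sum[symmetric]) (intro integrable_abs Bochner_Integration.integrable_diff int)
  also have "\<dots> \<le> (\<integral>Q. ?K + 2 * indicator ?D Q + 2 * indicator ?E Q \<partial>walk M m)"
  proof (rule integral_mono_AE)
    show "integrable (walk M m) (\<lambda>Q. \<Sum>y\<in>states n. \<bar>?F Q x y - ?F Q x' y\<bar>)"
      by (intro Bochner_Integration.integrable_sum integrable_abs Bochner_Integration.integrable_diff int)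
    show "integrable (walk M m) (\<lambda>Q. ?K + 2 * indicator ?D Q + 2 * indicator ?E Q)"
      by (intro Bochner_Integration.integrable_add integrable_mult_right int_ind) auto
    show "AE Q in walk M m. (\<Sum>y\<in>states n. \<bar>?F Q x y - ?F Q x' y\<bar>) \<le> ?K + 2 * indicator ?D Q + 2 * indicator ?E Q"
      using AE_walk_stochastic[of m]
    proof eventually_elim
      fix Q :: "real ^ 'k ^ 'k" assume Q: "Q \<in> col_stochastic"
      show "(\<Sum>y\<in>states n. \<bar>?F Q x y - ?F Q x' y\<bar>) \<le> ?K + 2 * indicator ?D Q + 2 * indicator ?E Q"
      proof (cases "Q \<in> ?D \<or> Q \<in> ?E")
        case True
        have nn: "0 \<le> ?F Q x y" for x y using Q by (intro prod_nonneg) (auto simp: col_stochastic_nonneg)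
        have "(\<Sum>y\<in>states n. \<bar>?F Q x y - ?F Q x' y\<bar>) \<le> (\<Sum>y\<in>states n. ?F Q x y + ?F Q x' y)"
        proof (rule sum_mono)
          fix y
          show "\<bar>?F Q x y - ?F Q x' y\<bar> \<le> ?F Q x y + ?F Q x' y"
            using nn[of y x] nn[of y x'] by linarith
        qed
        also have "\<dots> = 2" using Q by (simp add: sum.distrib sum_states_prod)
        finally have "(\<Sum>y\<in>states n. \<bar>?F Q x y - ?F Q x' y\<bar>) \<le> 2" .
        moreover have "2 \<le> 2 * indicator ?D Q + 2 * (indicator ?E Q :: real)"
          using True by (auto simp: indicator_def)
        ultimately show ?thesis using K by linarith
      next
        case False
        then have D: "dobrushin Q \<le> d" and E: "\<And>a b. c \<le> Q $ a $ b" by (auto simp: not_less)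
        have "(\<Sum>y\<in>states n. \<bar>?F Q x y - ?F Q x' y\<bar>) \<le> sqrt ((1 + (2 * d)\<^sup>2 / c) ^ card {1..n} - 1)"
          unfolding states_def
        proof (rule product_l1_le[where p = "\<lambda>i a. Q $ a $ x i" and q = "\<lambda>i a. Q $ a $ x' i"])
          show "(\<Sum>a\<in>UNIV. (Q $ a $ x i)\<^sup>2 / Q $ a $ x' i) \<le> 1 + (2 * d)\<^sup>2 / c" for i
            using dobrushin_ge[of Q "x i" "x' i"] D Q E assms(3)
            by (intro chi_square_le) (auto simp: col_stochastic_sum)
          show "0 < Q $ a $ x' i" for i a using E[of a "x' i"] assms(3) by linarith
        qed (use Q assms in \<open>auto simp: col_stochastic_sum\<close>)
        then show ?thesis by (simp add: add_increasing2)
      qed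
    qed
  qed
  also have "\<dots> = ?K + 2 * measure (walk M m) ?D + 2 * measure (walk M m) ?E"
    using int_ind[of ?D] int_ind[of ?E] by (simp add: W.prob_space[simplified])
  finally show ?thesis .
qed

text \<open>For a single factor this is continuity from above as \<open>c\<close> decreases to 0,
  the entries being almost surely positive; \<open>emeasure_walk_Suc_le\<close> transfers it to
  every positive time.\<close>

lemma small_entries:
  assumes "0 < e"
  obtains c where "0 < c" "\<And>m. measure (walk M (Suc m)) {Q. \<exists>a b. Q $ a $ b < c} < e"
proof -
  let ?B = "\<lambda>c. {S :: real ^ 'k ^ 'k. \<exists>a b. S $ a $ b < c}"
  have B [measurable]: "?B c \<in> sets borel" for c by measurable
  have "(\<lambda>j. measure M (?B (1 / real (Suc j)))) \<longlonglongrightarrow> measure M (\<Inter>j. ?B (1 / real (Suc j)))"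
  proof (rule finite_Lim_measure_decseq)
    show "decseq (\<lambda>j. ?B (1 / real (Suc j)))"
    proof (rule decseq_SucI, safe)
      fix j a b and S :: "real ^ 'k ^ 'k" assume "S $ a $ b < 1 / real (Suc (Suc j))"
      also have "\<dots> \<le> 1 / real (Suc j)" by (intro divide_left_mono) auto
      finally show "\<exists>a b. S $ a $ b < 1 / real (Suc j)" by blast
    qed
  qed (auto simp: B sets_M)
  moreover have "measure M (\<Inter>j. ?B (1 / real (Suc j))) = 0"
  proof -
    have "AE S in M. S \<notin> (\<Inter>j. ?B (1 / real (Suc j)))"
      using AE_entries_pos
    proof eventually_elim
      fix S :: "real ^ 'k ^ 'k" assume S: "\<forall>a b. 0 < S $ a $ b"
      let ?m = "Min (range (\<lambda>(a, b). S $ a $ b))"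
      have "?m \<in> range (\<lambda>(a, b). S $ a $ b)" by (intro Min_in) auto
      then have "0 < ?m" using S by auto
      then obtain j where j: "inverse (real (Suc j)) < ?m" using reals_Archimedean by blast
      have "?m \<le> S $ a $ b" for a b by (intro Min_le) (auto intro: image_eqI[where x = "(a, b)"])
      then have "1 / real (Suc j) \<le> S $ a $ b" for a b
        using j by (simp only: inverse_eq_divide) (meson less_imp_le order_trans)
      then have "S \<notin> ?B (1 / real (Suc j))" by (simp add: not_less)
      then show "S \<notin> (\<Inter>j. ?B (1 / real (Suc j)))" by blast
    qed
    moreover have "(\<Inter>j. ?B (1 / real (Suc j))) \<in> sets M" unfolding sets_M by measurable
    ultimately show ?thesis by (simp add: prob_eq_0)
  qed
  ultimately have "\<forall>\<^sub>F j in sequentially. measure M (?B (1 / real (Suc j))) < e"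
    using assms by (intro order_tendstoD(2)) auto
  then obtain j where j: "measure M (?B (1 / real (Suc j))) < e" by (auto simp: eventually_sequentially)
  show thesis
  proof
    show "0 < 1 / real (Suc j)" by simp
    fix m
    interpret W: prob_space "walk M (Suc m)" by (rule prob_space_walk)
    have "measure (walk M (Suc m)) (?B (1 / real (Suc j))) \<le> measure M (?B (1 / real (Suc j)))"
      using emeasure_walk_Suc_le[of "1 / real (Suc j)" m]
      by (simp add: emeasure_eq_measure W.emeasure_eq_measure del: walk.simps)
    then show "measure (walk M (Suc m)) (?B (1 / real (Suc j))) < e" using j by linarith
  qed
qed

end

section \<open>The two bounds on the mixing time\<close>

context log_integrable_walk
begin

lemma upper_cutoff:
  assumes \<theta>: "1 / (2 * lyapunov M) < \<theta>" and "0 < \<epsilon>"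
  shows "\<forall>\<^sub>F n in sequentially. 1 \<le> nat \<lfloor>\<theta> * ln (real n)\<rfloor> \<and>
    (\<forall>x\<in>states n. tv_dist (states n) (chain_law (states n) (efcp_transition M n) x (nat \<lfloor>\<theta> * ln (real n)\<rfloor>))
        (stationary (states n) (efcp_transition M n)) < \<epsilon>)"
proof -
  let ?m = "\<lambda>n. nat \<lfloor>\<theta> * ln (real n)\<rfloor>"
  have pos: "0 < 1 / (2 * lyapunov M)" using lyapunov_pos by simp
  then have "0 < \<theta>" using \<theta> by linarith
  then have "1 / (2 * \<theta>) < lyapunov M" using \<theta> lyapunov_pos by (simp add: field_simps)
  then obtain \<mu> where \<mu>: "1 / (2 * \<theta>) < \<mu>" "\<mu> < lyapunov M" using dense by blast
  \<comment> \<open>With \<open>d n\<close> of order \<open>n powr (- \<mu> * \<theta>)\<close>, the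
    total divergence \<open>n * (d n)^2\<close> is of order \<open>n powr (- \<eta>)\<close> and
    vanishes.\<close>
  define \<eta> where "\<eta> = 2 * \<mu> * \<theta> - 1"
  have \<eta>: "0 < \<eta>" using \<mu>(1) \<open>0 < \<theta>\<close> by (simp add: \<eta>_def field_simps)
  have "0 < \<mu>" using \<mu>(1) \<open>0 < \<theta>\<close> by (auto intro: less_trans[rotated])
  obtain c where c: "0 < c" "\<And>m. measure (walk M (Suc m)) {Q. \<exists>a b. Q $ a $ b < c} < \<epsilon> / 4"
    by (rule small_entries[of "\<epsilon> / 4"]) (use \<open>0 < \<epsilon>\<close> in auto)
  have m_lim: "filterlim ?m at_top sequentially"
    using \<open>0 < \<theta>\<close> by real_asymp
  define d where "d n = exp (- \<mu> * real (?m n))" for n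
  have "(\<lambda>n. measure (walk M (?m n)) {Q. d n < dobrushin Q}) \<longlonglongrightarrow> 0"
    unfolding d_def by (rule filterlim_compose[OF dobrushin_upper[OF \<mu>(2)] m_lim])
  then have ev1: "\<forall>\<^sub>F n in sequentially. measure (walk M (?m n)) {Q. d n < dobrushin Q} < \<epsilon> / 4"
    by (rule order_tendstoD(2)) (use \<open>0 < \<epsilon>\<close> in auto)
  \<comment> \<open>The 4 stems from \<open>(2 * d n)^2\<close>, the exponential from rounding the
    time down, and \<open>c\<close> from the denominators of the chi-square divergence.\<close>
  define K where "K = 4 * exp (2 * \<mu>) / c"
  have "(\<lambda>n. K * real n powr - \<eta>) \<longlonglongrightarrow> K * 0"
    by (intro tendsto_intros tendsto_neg_powr filterlim_real_sequentially) (use \<eta> in simp)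
  then have "(\<lambda>n. sqrt (exp (K * real n powr - \<eta>) - 1)) \<longlonglongrightarrow> sqrt (exp (K * 0) - 1)"
    by (intro tendsto_real_sqrt tendsto_diff tendsto_exp tendsto_const)
  then have ev2: "\<forall>\<^sub>F n in sequentially. sqrt (exp (K * real n powr - \<eta>) - 1) < \<epsilon> / 2"
    by (rule order_tendstoD(2)) (use \<open>0 < \<epsilon>\<close> in auto)
  have ev3: "\<forall>\<^sub>F n in sequentially. 1 \<le> ?m n"
    using m_lim by (simp add: filterlim_at_top)
  show ?thesis
    using ev1 ev2 ev3 eventually_ge_at_top[of 1]
  proof eventually_elim
    case (elim n)
    let ?P = "efcp_transition M n"
    interpret positive_chain "states n" ?P by (rule positive_chain_efcp)
    have n: "0 < real n" using elim(4) by simp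
    have d_sq: "(2 * d n)\<^sup>2 / c \<le> K * real n powr - \<eta> / real n"
    proof -
      have "\<theta> * ln (real n) - 1 \<le> real (?m n)" by linarith
      then have "\<mu> * (\<theta> * ln (real n) - 1) \<le> \<mu> * real (?m n)"
        using \<open>0 < \<mu>\<close> by (intro mult_left_mono) auto
      then have "- 2 * \<mu> * real (?m n) \<le> 2 * \<mu> + (- \<eta> - 1) * ln (real n)"
        by (simp add: \<eta>_def algebra_simps)
      then have "exp (- 2 * \<mu> * real (?m n)) \<le> exp (2 * \<mu> + (- \<eta> - 1) * ln (real n))"
        by (simp only: exp_le_cancel_iff)
      also have "\<dots> = exp (2 * \<mu>) * (real n powr - \<eta> / real n)"
        using n by (simp add: exp_add powr_def left_diff_distrib exp_diff exp_minus field_simps)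
      finally have "exp (- 2 * \<mu> * real (?m n)) \<le> exp (2 * \<mu>) * (real n powr - \<eta> / real n)" .
      moreover have "(2 * d n)\<^sup>2 = 4 * exp (- 2 * \<mu> * real (?m n))"
        by (simp add: d_def power_mult_distrib power2_eq_square flip: exp_add)
      ultimately show ?thesis
        using c(1) by (simp add: K_def field_simps)
    qed
    have "(1 + (2 * d n)\<^sup>2 / c) ^ n \<le> exp ((2 * d n)\<^sup>2 / c) ^ n"
      using c(1) by (intro power_mono exp_ge_add_one_self) (auto intro: add_nonneg_nonneg)
    also have "\<dots> = exp (real n * ((2 * d n)\<^sup>2 / c))" by (rule exp_of_nat_mult[symmetric])
    also have "\<dots> \<le> exp (real n * (K * real n powr - \<eta> / real n))"
      unfolding exp_le_cancel_iff by (intro mult_left_mono d_sq) simp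
    also have "\<dots> = exp (K * real n powr - \<eta>)" using n by simp
    finally have "sqrt ((1 + (2 * d n)\<^sup>2 / c) ^ n - 1) \<le> sqrt (exp (K * real n powr - \<eta>) - 1)"
      by simp
    then have root: "sqrt ((1 + (2 * d n)\<^sup>2 / c) ^ n - 1) < \<epsilon> / 2" using elim(2) by linarith
    obtain m' where m': "?m n = Suc m'" using elim(3) by (cases "?m n") auto
    let ?D = "sqrt ((1 + (2 * d n)\<^sup>2 / c) ^ n - 1) / 2 + measure (walk M (?m n)) {Q. d n < dobrushin Q}
          + measure (walk M (?m n)) {Q. \<exists>a b. Q $ a $ b < c}"
    have D: "?D < \<epsilon>" using root elim(1) c(2)[of m'] \<open>0 < \<epsilon>\<close> by (simp only: m')
    show ?case
    proof (intro conjI ballI)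
      show "1 \<le> ?m n" by (rule elim(3))
      fix x :: "nat \<Rightarrow> 'k" assume x: "x \<in> states n"
      have "tv_dist (states n) (chain_law (states n) ?P x (?m n)) (stationary (states n) ?P) \<le> ?D"
      proof (rule tv_dist_stationary_le[OF is_stationary_stationary])
        fix x' :: "nat \<Rightarrow> 'k" assume x': "x' \<in> states n"
        have "0 \<le> d n" by (simp add: d_def)
        from chain_law_difference_le[OF x x' c(1) this, of "?m n"]
        show "(\<Sum>y\<in>states n. \<bar>chain_law (states n) ?P x (?m n) y - chain_law (states n) ?P x' (?m n) y\<bar>) \<le> 2 * ?D"
          by (simp add: algebra_simps)
      qed
      then show "tv_dist (states n) (chain_law (states n) ?P x (?m n)) (stationary (states n) ?P) < \<epsilon>"
        using D by linarith
    qed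
  qed
qed

text \<open>The \<open>k\<close> blocks of the initial state carry the \<open>k\<close> different labels. At time \<open>m\<close> the label
  frequencies in two blocks differ as long as \<open>dobrushin Q\<close> is much larger than \<open>n powr (-1/2)\<close>, whereas
  under the stationary law, the limit of the chain started from a constant state, they agree
  up to fluctuations of order \<open>n powr (-1/2)\<close>.\<close>

lemma tv_dist_lower_bound:
  assumes "0 < \<tau>" "CARD('k) \<le> n"
  shows "\<exists>x0\<in>states n. 1 - measure (walk M m) {Q. dobrushin Q < real CARD('k) * \<tau>}
      - (2 + 2 * real CARD('k) ^ 3) / (real (n div CARD('k)) * \<tau>\<^sup>2)
    \<le> tv_dist (states n) (chain_law (states n) (efcp_transition M n) x0 m) (stationary (states n) (efcp_transition M n))"
proof -
  let ?P = "efcp_transition M n"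
  let ?k = "CARD('k)"
  let ?Y = "states n :: (nat \<Rightarrow> 'k) set"
  let ?L = "chain_law ?Y ?P"
  interpret positive_chain ?Y ?P by (rule positive_chain_efcp)
  define r where "r = n div ?k"
  have k: "0 < ?k" by simp
  have r: "0 < r" using assms(2) by (simp add: r_def div_greater_zero_iff)
  have rk: "r * ?k \<le> n" by (simp add: r_def)
  obtain g :: "'k \<Rightarrow> nat" where g: "bij_betw g UNIV {0..<?k}"
    using ex_bij_betw_finite_nat[of "UNIV :: 'k set"] by auto
  have g_less: "g a < ?k" for a using bij_betwE[OF g] by auto
  have g_inj: "inj g" using g by (simp add: bij_betw_def)
  \<comment> \<open>Blocks are residue classes modulo \<open>?k\<close> among the first
    \<open>r * ?k\<close> positions, shifted by one because coordinates start at 1.\<close>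
  define B where "B a = (\<lambda>t. t * ?k + g a + 1) ` {..<r}" for a
  have B_sub: "B a \<subseteq> {1..n}" for a
  proof
    fix i assume "i \<in> B a"
    then obtain t where t: "t < r" "i = t * ?k + g a + 1" by (auto simp: B_def)
    have "t * ?k + ?k \<le> r * ?k" using t(1) mult_le_mono1[of "Suc t" r ?k] by simp
    then show "i \<in> {1..n}" using t(2) g_less[of a] rk by auto
  qed
  have B_mod: "(i - 1) mod ?k = g a" if "i \<in> B a" for i a
    using that g_less[of a] by (auto simp: B_def)
  have B_card: "card (B a) = r" for a
    unfolding B_def using k by (subst card_image) (auto simp: inj_on_def)
  have B_disj: "B a \<inter> B b = {}" if "a \<noteq> b" for a b
  proof (rule ccontr)
    assume "B a \<inter> B b \<noteq> {}"
    then obtain i where "i \<in> B a" "i \<in> B b" by blast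
    then have "g a = g b" using B_mod[of i a] B_mod[of i b] by simp
    then show False using that injD[OF g_inj] by blast
  qed
  define x0 where "x0 = (\<lambda>i\<in>{1..n}. inv g ((i - 1) mod ?k))"
  have x0: "x0 \<in> ?Y" by (auto simp: x0_def states_def)
  have x0_B: "x0 i = a" if "i \<in> B a" for i a
    using that B_sub[of a] B_mod[OF that] g_inj by (auto simp: x0_def)
  \<comment> \<open>A constant state with an arbitrary label: all coordinates then have the same
    distribution for each fixed \<open>Q\<close>, at every time.\<close>
  define x1 :: "nat \<Rightarrow> 'k" where "x1 = (\<lambda>i\<in>{1..n}. undefined)"
  have x1: "x1 \<in> ?Y" by (auto simp: x1_def states_def)
  have x1_B: "x1 i = undefined" if "i \<in> B a" for i a
    using that B_sub[of a] by (auto simp: x1_def)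
  define D where "D a b c y = ((\<Sum>i\<in>B a. of_bool (y i = c)) - (\<Sum>i\<in>B b. of_bool (y i = c))) / real r"
    for a b c and y :: "nat \<Rightarrow> 'k"
  \<comment> \<open>The test: some label has visibly different frequencies in some two blocks. A
    union bound over the triples \<open>(a, b, c)\<close> costs the factor
    \<open>?k ^ 3\<close>.\<close>
  define T where "T = {y \<in> ?Y. \<exists>a b c. \<tau> < \<bar>D a b c y\<bar>}"
  define e where "e = 2 / (real r * \<tau>\<^sup>2)"
  have e: "0 \<le> e" by (simp add: e_def)
  have T_sub: "T \<subseteq> ?Y" by (auto simp: T_def)
  have freq: "(\<Sum>y\<in>U. \<Prod>i=1..n. Q $ y i $ x i) \<le> e"
    if Q: "Q \<in> col_stochastic" and U: "U \<subseteq> ?Y" and "a \<noteq> b"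
      and xa: "\<And>i. i \<in> B a \<Longrightarrow> x i = a'" and xb: "\<And>i. i \<in> B b \<Longrightarrow> x i = b'"
      and dev: "\<And>y. y \<in> U \<Longrightarrow> \<tau> \<le> \<bar>D a b l y - (Q $ l $ a' - Q $ l $ b')\<bar>"
    for Q :: "real ^ 'k ^ 'k" and U x a b a' b' l
    unfolding e_def
    by (rule block_frequency[where p = "\<lambda>i a. Q $ a $ x i" and A = "B a" and B = "B b" and c = l
          and \<alpha> = "Q $ l $ a'" and \<beta> = "Q $ l $ b'"])
      (use Q U \<open>0 < \<tau>\<close> r B_sub B_card B_disj[OF \<open>a \<noteq> b\<close>] xa xb dev in
        \<open>auto simp: col_stochastic_sum col_stochastic_nonneg states_def D_def\<close>)
  have int: "integrable (walk M m) (\<lambda>Q. \<Sum>y\<in>U. \<Prod>i=1..n. Q $ y i $ x i)" for U :: "(nat \<Rightarrow> 'k) set" and x m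
    by (intro Bochner_Integration.integrable_sum integrable_bounded(2)[where B = 1])
      (measurable, rule prod_entry_le_one)
  \<comment> \<open>A bound for the chain from \<open>x1\<close> that is uniform in time passes to
    the limit, the stationary law.\<close>
  have upper: "(\<Sum>y\<in>T. stationary ?Y ?P y) \<le> real ?k ^ 3 * e"
  proof (rule LIMSEQ_le_const2)
    show "(\<lambda>m. \<Sum>y\<in>T. ?L x1 m y) \<longlonglongrightarrow> (\<Sum>y\<in>T. stationary ?Y ?P y)"
      using T_sub by (intro tendsto_sum chain_law_tendsto_stationary is_stationary_stationary x1) auto
    have "(\<Sum>y\<in>T. ?L x1 m y) \<le> real ?k ^ 3 * e" for m
    proof -
      interpret W: prob_space "walk M m" by (rule prob_space_walk)
      have "(\<Sum>y\<in>T. ?L x1 m y) = (\<integral>Q. (\<Sum>y\<in>T. \<Prod>i=1..n. Q $ y i $ x1 i) \<partial>walk M m)"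
        by (rule sum_chain_law[OF x1 T_sub])
      also have "\<dots> \<le> (\<integral>Q. real ?k ^ 3 * e \<partial>walk M m)"
      proof (rule integral_mono_AE[OF int])
        show "AE Q in walk M m. (\<Sum>y\<in>T. \<Prod>i=1..n. Q $ y i $ x1 i) \<le> real ?k ^ 3 * e"
          using AE_walk_stochastic[of m]
        proof eventually_elim
          fix Q :: "real ^ 'k ^ 'k" assume Q: "Q \<in> col_stochastic"
          let ?F = "\<lambda>y. \<Prod>i=1..n. Q $ y i $ x1 i"
          define U where "U = (\<lambda>(a, b, c). {y \<in> ?Y. \<tau> < \<bar>D a b c y\<bar>})"
          have nn: "0 \<le> ?F y" for y using Q by (intro prod_nonneg) (auto simp: col_stochastic_nonneg)
          have U_le: "(\<Sum>y\<in>U s. ?F y) \<le> e" for s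
          proof (cases s)
            case (fields a b c)
            show ?thesis
            proof (cases "a = b")
              case True
              then have "U s = {}" using \<open>0 < \<tau>\<close> by (auto simp: U_def fields D_def)
              then show ?thesis using e by simp
            next
              case False
              have dev: "\<tau> \<le> \<bar>D a b c y - (Q $ c $ undefined - Q $ c $ undefined)\<bar>" if "y \<in> U s" for y
                using that by (simp add: U_def fields)
              show ?thesis
                by (rule freq[OF Q _ False x1_B x1_B dev]) (auto simp: U_def fields)
            qed
          qed
          have "T = (\<Union>s\<in>UNIV. U s)" by (auto simp: T_def U_def)
          then have "(\<Sum>y\<in>T. ?F y) \<le> (\<Sum>s\<in>UNIV. \<Sum>y\<in>U s. ?F y)"
            by (simp only:) (rule sum_UN_le, auto simp: U_def finite_states nn)
          also have "\<dots> \<le> (\<Sum>s\<in>(UNIV :: ('k \<times> 'k \<times> 'k) set). e)" by (intro sum_mono U_le)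
          also have "\<dots> = real ?k ^ 3 * e" by (simp add: card_prod power3_eq_cube)
          finally show "(\<Sum>y\<in>T. ?F y) \<le> real ?k ^ 3 * e" .
        qed
      qed simp
      also have "\<dots> = real ?k ^ 3 * e" by (simp add: W.prob_space[simplified])
      finally show ?thesis .
    qed
    then show "\<exists>N. \<forall>m\<ge>N. (\<Sum>y\<in>T. ?L x1 m y) \<le> real ?k ^ 3 * e" by blast
  qed
  interpret W: prob_space "walk M m" by (rule prob_space_walk)
  let ?E = "{Q :: real ^ 'k ^ 'k. dobrushin Q < real ?k * \<tau>}"
  have E [measurable]: "?E \<in> sets borel" by measurable
  have int_E: "integrable (walk M m) (indicator ?E :: _ \<Rightarrow> real)"
    by (rule integrable_bounded(2)[where B = 1]) auto
  have "(\<Sum>y\<in>?Y - T. ?L x0 m y) = (\<integral>Q. (\<Sum>y\<in>?Y - T. \<Prod>i=1..n. Q $ y i $ x0 i) \<partial>walk M m)"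
    by (rule sum_chain_law[OF x0]) auto
  also have "\<dots> \<le> (\<integral>Q. indicator ?E Q + e \<partial>walk M m)"
  proof (rule integral_mono_AE[OF int])
    show "integrable (walk M m) (\<lambda>Q. indicator ?E Q + e)" using int_E by simp
    show "AE Q in walk M m. (\<Sum>y\<in>?Y - T. \<Prod>i=1..n. Q $ y i $ x0 i) \<le> indicator ?E Q + e"
      using AE_walk_stochastic[of m]
    proof eventually_elim
      fix Q :: "real ^ 'k ^ 'k" assume Q: "Q \<in> col_stochastic"
      show "(\<Sum>y\<in>?Y - T. \<Prod>i=1..n. Q $ y i $ x0 i) \<le> indicator ?E Q + e"
      proof (cases "Q \<in> ?E")
        case True
        have "(\<Sum>y\<in>?Y - T. \<Prod>i=1..n. Q $ y i $ x0 i) \<le> 1"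
          by (rule sum_prod_le_one[OF Q]) auto
        then show ?thesis using True e by simp
      next
        case False
        obtain a b c where abc: "2 * dobrushin Q / real ?k \<le> \<bar>Q $ c $ a - Q $ c $ b\<bar>"
          by (rule dobrushin_attained_entry)
        \<comment> \<open>The gap is twice the threshold of the test, so an observation outside
          \<open>T\<close> misses the expected difference by at least \<open>\<tau>\<close>.\<close>
        have "2 * \<tau> \<le> 2 * dobrushin Q / real ?k" using False k by (simp add: field_simps)
        then have gap: "2 * \<tau> \<le> \<bar>Q $ c $ a - Q $ c $ b\<bar>" using abc by linarith
        then have "a \<noteq> b" using \<open>0 < \<tau>\<close> by auto
        have dev: "\<tau> \<le> \<bar>D a b c y - (Q $ c $ a - Q $ c $ b)\<bar>" if "y \<in> ?Y - T" for y
        proof -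
          have "\<bar>D a b c y\<bar> \<le> \<tau>" using that by (auto simp: T_def not_less)
          then show ?thesis using gap by linarith
        qed
        have "(\<Sum>y\<in>?Y - T. \<Prod>i=1..n. Q $ y i $ x0 i) \<le> e"
          by (rule freq[OF Q _ \<open>a \<noteq> b\<close> x0_B x0_B dev]) auto
        then show ?thesis by (simp add: add_increasing)
      qed
    qed
  qed
  also have "\<dots> = measure (walk M m) ?E + e"
    using int_E by (simp add: W.prob_space[simplified])
  finally have "(\<Sum>y\<in>?Y - T. ?L x0 m y) \<le> measure (walk M m) ?E + e" .
  moreover have "(\<Sum>y\<in>?Y. ?L x0 m y) = (\<Sum>y\<in>?Y - T. ?L x0 m y) + (\<Sum>y\<in>T. ?L x0 m y)"
    by (rule sum.subset_diff[OF T_sub finite_states])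
  ultimately have lower: "1 - measure (walk M m) ?E - e \<le> (\<Sum>y\<in>T. ?L x0 m y)"
    using chain_law_sum[OF x0, of m] by linarith
  have "(\<Sum>y\<in>T. ?L x0 m y) - (\<Sum>y\<in>T. stationary ?Y ?P y) \<le> tv_dist ?Y (?L x0 m) (stationary ?Y ?P)"
    using is_stationary_stationary
    by (intro tv_dist_ge finite_states T_sub chain_law_sum x0) (simp add: is_stationary_def)
  moreover have "(2 + 2 * real ?k ^ 3) / (real r * \<tau>\<^sup>2) = e + real ?k ^ 3 * e"
    by (simp add: e_def add_divide_distrib)
  ultimately show ?thesis
    using lower upper x0 unfolding r_def by (intro bexI[of _ x0]) linarith+
qed

lemma lower_cutoff:
  assumes \<theta>: "0 < \<theta>" "\<theta> < 1 / (2 * lyapunov M)" and "0 < \<epsilon>"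
  shows "\<forall>\<^sub>F n in sequentially. \<exists>x\<in>states n.
    1 - \<epsilon> < tv_dist (states n) (chain_law (states n) (efcp_transition M n) x (nat \<lfloor>\<theta> * ln (real n)\<rfloor>))
        (stationary (states n) (efcp_transition M n))"
proof -
  let ?m = "\<lambda>n. nat \<lfloor>\<theta> * ln (real n)\<rfloor>" and ?k = "real CARD('k)"
  have "lyapunov M < 1 / (2 * \<theta>)" using \<theta> lyapunov_pos by (simp add: field_simps)
  then obtain \<mu> where \<mu>: "lyapunov M < \<mu>" "\<mu> < 1 / (2 * \<theta>)" using dense by blast
  \<comment> \<open>Below 1, so that \<open>n * \<tau>^2\<close>, of order at least
    \<open>n powr (1 - \<eta>)\<close>, tends to infinity and the fluctuations become
    negligible.\<close>
  define \<eta> where "\<eta> = 2 * \<mu> * \<theta>"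
  have "0 < \<mu>" using \<mu>(1) lyapunov_pos by linarith
  then have \<eta>: "0 < \<eta>" "\<eta> < 1" using \<mu>(2) \<theta>(1) by (simp_all add: \<eta>_def field_simps)
  have m_lim: "filterlim ?m at_top sequentially"
    using \<theta>(1) by real_asymp
  have "(\<lambda>n. measure (walk M (?m n)) {Q. dobrushin Q < exp (- \<mu> * real (?m n))}) \<longlonglongrightarrow> 0"
    by (rule filterlim_compose[OF dobrushin_lower[OF \<mu>(1)] m_lim])
  then have ev1: "\<forall>\<^sub>F n in sequentially. measure (walk M (?m n)) {Q. dobrushin Q < exp (- \<mu> * real (?m n))} < \<epsilon> / 2"
    by (rule order_tendstoD(2)) (use \<open>0 < \<epsilon>\<close> in auto)
  define K where "K = (2 + 2 * ?k ^ 3) * ?k\<^sup>2"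
  have K: "0 \<le> K" by (simp add: K_def)
  have lim: "(\<lambda>n. K / ((real n / k - 1) * real n powr - \<eta>)) \<longlonglongrightarrow> 0" if "0 < k" for k
    using that \<eta> by real_asymp
  have "(\<lambda>n. K / ((real n / ?k - 1) * real n powr - \<eta>)) \<longlonglongrightarrow> 0"
    by (rule lim) simp
  then have ev2: "\<forall>\<^sub>F n in sequentially. K / ((real n / ?k - 1) * real n powr - \<eta>) < \<epsilon> / 2"
    by (rule order_tendstoD(2)) (use \<open>0 < \<epsilon>\<close> in auto)
  show ?thesis
    using ev1 ev2 eventually_gt_at_top[of "CARD('k)"]
  proof eventually_elim
    case (elim n)
    \<comment> \<open>Chosen so that \<open>?k * \<tau>\<close> is exactly the threshold in
      \<open>dobrushin_lower\<close>; this accounts for the factor \<open>?k\<^sup>2\<close> in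
      \<open>K\<close>.\<close>
    define \<tau> where "\<tau> = exp (- \<mu> * real (?m n)) / ?k"
    have "0 < \<tau>" by (simp add: \<tau>_def)
    have k: "0 < ?k" by simp
    have n: "?k < real n" using elim(3) by simp
    have "real (?m n) \<le> \<theta> * ln (real n)" using n k \<theta>(1) by (simp add: of_nat_floor)
    then have "\<mu> * real (?m n) \<le> \<mu> * (\<theta> * ln (real n))" using \<open>0 < \<mu>\<close> by (intro mult_left_mono) auto
    then have "- \<eta> * ln (real n) \<le> - 2 * \<mu> * real (?m n)" by (simp add: \<eta>_def)
    then have "exp (- \<eta> * ln (real n)) \<le> exp (- 2 * \<mu> * real (?m n))" by (simp only: exp_le_cancel_iff)
    then have "real n powr - \<eta> \<le> exp (- 2 * \<mu> * real (?m n))" using n k by (simp add: powr_def)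
    also have "\<dots> = ?k\<^sup>2 * \<tau>\<^sup>2"
      by (simp add: \<tau>_def power_divide power2_eq_square[of "exp _"] flip: exp_add)
    finally have \<tau>_sq: "real n powr - \<eta> / ?k\<^sup>2 \<le> \<tau>\<^sup>2" by (simp add: field_simps)
    have "n = (n div CARD('k)) * CARD('k) + n mod CARD('k)" by simp
    then have "real n = real (n div CARD('k)) * ?k + real (n mod CARD('k))" by (metis of_nat_add of_nat_mult)
    moreover have "real (n mod CARD('k)) \<le> ?k" by simp
    ultimately have "real n / ?k - 1 \<le> real (n div CARD('k))" by (simp add: field_simps)
    then have "(real n / ?k - 1) * (real n powr - \<eta> / ?k\<^sup>2) \<le> real (n div CARD('k)) * \<tau>\<^sup>2"
      using \<tau>_sq by (intro mult_mono) auto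
    moreover have "0 < (real n / ?k - 1) * (real n powr - \<eta> / ?k\<^sup>2)"
      using n k by (intro mult_pos_pos divide_pos_pos) (auto simp: field_simps)
    ultimately have "(2 + 2 * ?k ^ 3) / (real (n div CARD('k)) * \<tau>\<^sup>2)
        \<le> (2 + 2 * ?k ^ 3) / ((real n / ?k - 1) * (real n powr - \<eta> / ?k\<^sup>2))"
      by (intro frac_le) auto
    also have "\<dots> = K / ((real n / ?k - 1) * real n powr - \<eta>)"
      by (simp add: K_def)
    finally have small: "(2 + 2 * ?k ^ 3) / (real (n div CARD('k)) * \<tau>\<^sup>2) < \<epsilon> / 2"
      using elim(2) by linarith
    have "?k * \<tau> = exp (- \<mu> * real (?m n))" by (simp add: \<tau>_def)
    then have "measure (walk M (?m n)) {Q. dobrushin Q < ?k * \<tau>} < \<epsilon> / 2" using elim(1) by simp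
    moreover obtain x0 where "x0 \<in> states n" "1 - measure (walk M (?m n)) {Q. dobrushin Q < ?k * \<tau>}
        - (2 + 2 * ?k ^ 3) / (real (n div CARD('k)) * \<tau>\<^sup>2)
      \<le> tv_dist (states n) (chain_law (states n) (efcp_transition M n) x0 (?m n)) (stationary (states n) (efcp_transition M n))"
      using tv_dist_lower_bound[OF \<open>0 < \<tau>\<close>, of n "?m n"] elim(3) by auto
    ultimately show ?case using small by (intro bexI[of _ x0]) linarith+
  qed
qed

lemma cutoff:
  "\<exists>\<theta> :: real. \<theta> > 0 \<and> (\<exists>\<delta>0>0. \<exists>\<epsilon>0>0. \<forall>\<delta>\<in>{0<..<\<delta>0}. \<forall>\<epsilon>\<in>{0<..<\<epsilon>0}.
    \<forall>\<^sub>F n in sequentially.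
      (\<theta> - \<delta>) * ln (real n) \<le> real (efcp_mixing_time M n (1 - \<epsilon>)) \<and>
      efcp_mixing_time M n (1 - \<epsilon>) \<le> efcp_mixing_time M n \<epsilon> \<and>
      real (efcp_mixing_time M n \<epsilon>) \<le> (\<theta> + \<delta>) * ln (real n))"
proof -
  define \<theta> where "\<theta> = 1 / (2 * lyapunov M)"
  have \<theta>: "0 < \<theta>" using lyapunov_pos by (simp add: \<theta>_def)
  \<comment> \<open>The range of \<open>\<delta>\<close> keeps the time for the lower bound
    positive; that of \<open>\<epsilon>\<close> gives
    \<open>\<epsilon> \<le> 1 - \<epsilon>\<close>, which orders the two mixing times.\<close>
  have "\<forall>\<^sub>F n in sequentially.
      (\<theta> - \<delta>) * ln (real n) \<le> real (efcp_mixing_time M n (1 - \<epsilon>)) \<and>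
      efcp_mixing_time M n (1 - \<epsilon>) \<le> efcp_mixing_time M n \<epsilon> \<and>
      real (efcp_mixing_time M n \<epsilon>) \<le> (\<theta> + \<delta>) * ln (real n)"
    if \<delta>: "\<delta> \<in> {0<..<\<theta>}" and \<epsilon>: "\<epsilon> \<in> {0<..<1/2}" for \<delta> \<epsilon>
  proof -
    have "\<forall>\<^sub>F n in sequentially. 1 \<le> nat \<lfloor>(\<theta> + \<delta>) * ln (real n)\<rfloor> \<and>
      (\<forall>x\<in>states n. tv_dist (states n) (chain_law (states n) (efcp_transition M n) x (nat \<lfloor>(\<theta> + \<delta>) * ln (real n)\<rfloor>))
        (stationary (states n) (efcp_transition M n)) < \<epsilon>)"
      by (rule upper_cutoff) (use \<delta> \<epsilon> in \<open>auto simp: \<theta>_def\<close>)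
    moreover have "\<forall>\<^sub>F n in sequentially. \<exists>x\<in>states n.
      1 - \<epsilon> < tv_dist (states n) (chain_law (states n) (efcp_transition M n) x (nat \<lfloor>(\<theta> - \<delta>) * ln (real n)\<rfloor>))
        (stationary (states n) (efcp_transition M n))"
      by (rule lower_cutoff) (use \<delta> \<epsilon> in \<open>auto simp: \<theta>_def\<close>)
    ultimately show ?thesis
      using eventually_ge_at_top[of 1]
    proof eventually_elim
      case (elim n)
      let ?P = "efcp_transition M n"
      let ?m = "nat \<lfloor>(\<theta> + \<delta>) * ln (real n)\<rfloor>" and ?t = "efcp_mixing_time M n (1 - \<epsilon>)"
      interpret positive_chain "states n" ?P by (rule positive_chain_efcp)
      have ln: "0 \<le> ln (real n)" using elim(3) by simp
      have m: "1 \<le> ?m" "\<And>x. x \<in> states n \<Longrightarrow> tv_dist (states n) (chain_law (states n) ?P x ?m) (stationary (states n) ?P) < \<epsilon>"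
        using elim(1) by auto
      have \<epsilon>_le: "\<epsilon> \<le> 1 - \<epsilon>" using \<epsilon> by simp
      have m': "tv_dist (states n) (chain_law (states n) ?P x ?m) (stationary (states n) ?P) < 1 - \<epsilon>"
        if "x \<in> states n" for x
        using m(2)[OF that] \<epsilon>_le by linarith
      have "efcp_mixing_time M n \<epsilon> \<le> ?m"
        unfolding efcp_mixing_time_def by (rule mixing_time_le) (use m in auto)
      then have "real (efcp_mixing_time M n \<epsilon>) \<le> real ?m" by simp
      also have "\<dots> \<le> (\<theta> + \<delta>) * ln (real n)"
        using \<theta> \<delta> ln by (intro of_nat_floor) auto
      finally have upper: "real (efcp_mixing_time M n \<epsilon>) \<le> (\<theta> + \<delta>) * ln (real n)" .
      have "?t \<le> efcp_mixing_time M n \<epsilon>"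
        unfolding efcp_mixing_time_def
      proof (rule mixing_time_le)
        show "1 \<le> mixing_time (states n) ?P \<epsilon>" by (rule tv_dist_mixing_time(1)) (use m in auto)
        show "tv_dist (states n) (chain_law (states n) ?P x (mixing_time (states n) ?P \<epsilon>)) (stationary (states n) ?P) < 1 - \<epsilon>"
          if "x \<in> states n" for x
          by (rule less_le_trans[OF tv_dist_mixing_time(2)[OF m that] \<epsilon>_le])
      qed
      moreover have "(\<theta> - \<delta>) * ln (real n) \<le> real ?t"
      \<comment> \<open>Otherwise the mixing time would not exceed a time at which some distance is
        still above \<open>1 - \<epsilon>\<close>, and by monotonicity that distance would be as
        large at the mixing time itself.\<close>
      proof (rule ccontr)
        assume "\<not> ?thesis"
        then have "?t \<le> nat \<lfloor>(\<theta> - \<delta>) * ln (real n)\<rfloor>"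
          by (simp add: not_le le_nat_iff le_floor_iff)
        moreover obtain x where x: "x \<in> states n"
          "1 - \<epsilon> < tv_dist (states n) (chain_law (states n) ?P x (nat \<lfloor>(\<theta> - \<delta>) * ln (real n)\<rfloor>)) (stationary (states n) ?P)"
          using elim(2) by blast
        ultimately have "1 - \<epsilon> < tv_dist (states n) (chain_law (states n) ?P x ?t) (stationary (states n) ?P)"
          using tv_dist_antimono[OF is_stationary_stationary, of ?t "nat \<lfloor>(\<theta> - \<delta>) * ln (real n)\<rfloor>" x] by linarith
        moreover have "tv_dist (states n) (chain_law (states n) ?P x ?t) (stationary (states n) ?P) < 1 - \<epsilon>"
          unfolding efcp_mixing_time_def by (rule tv_dist_mixing_time(2)[OF m(1) m' x(1)])
        ultimately show False by linarith
      qed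
      ultimately show ?case using upper by blast
    qed
  qed
  then show ?thesis
    using \<theta> by (intro exI[of _ \<theta>] conjI exI[of _ "1/2"] ballI) auto
qed

end

theorem theorem1p2:
  fixes \<Sigma> :: "(real ^ 'k::finite ^ 'k) measure"
    and f :: "real ^ 'k ^ 'k \<Rightarrow> real"
    and p :: real
  assumes "CARD('k) \<ge> 2"
    and "prob_space \<Sigma>"
    and "sets \<Sigma> = sets (restrict_space borel col_stochastic)"
    and "p > 1"
    and "f \<in> borel_measurable lebesgue_stochastic"
    and "\<And>S. S \<in> col_stochastic \<Longrightarrow> 0 \<le> f S"
    and "\<Sigma> = density lebesgue_stochastic (\<lambda>S. ennreal (f S))"
    and "integrable lebesgue_stochastic (\<lambda>S. f S powr p)"
  shows "\<exists>\<theta> :: real. \<theta> > 0 \<and> (\<exists>\<delta>0>0. \<exists>\<epsilon>0>0. \<forall>\<delta>\<in>{0<..<\<delta>0}. \<forall>\<epsilon>\<in>{0<..<\<epsilon>0}.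
    \<forall>\<^sub>F n in sequentially.
      (\<theta> - \<delta>) * ln (real n) \<le> real (efcp_mixing_time \<Sigma> n (1 - \<epsilon>)) \<and>
      efcp_mixing_time \<Sigma> n (1 - \<epsilon>) \<le> efcp_mixing_time \<Sigma> n \<epsilon> \<and>
      real (efcp_mixing_time \<Sigma> n \<epsilon>) \<le> (\<theta> + \<delta>) * ln (real n))"
proof -
  obtain C where C: "log_integrable_walk (distr \<Sigma> borel (\<lambda>S. S)) C"
    by (rule log_integrable_walk_density[OF assms])
  have id: "(\<lambda>S. S) \<in> \<Sigma> \<rightarrow>\<^sub>M borel"
    by (subst measurable_cong_sets[OF assms(3) refl]) (intro measurable_restrict_space1, simp)
  \<comment> \<open>The change of the underlying measurable space affects no integral, hence neither
    the transition probabilities nor the mixing times.\<close>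
  have eq: "efcp_transition (distr \<Sigma> borel (\<lambda>S. S)) = efcp_transition \<Sigma>"
    unfolding efcp_transition_def by (intro ext integral_distr[OF id]) measurable
  have "efcp_mixing_time (distr \<Sigma> borel (\<lambda>S. S)) = efcp_mixing_time \<Sigma>"
    by (intro ext) (simp only: efcp_mixing_time_def eq)
  then show ?thesis using log_integrable_walk.cutoff[OF C] by simp
qed

end
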